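(* Let $Y$ be either the interval $[0,1]$ or the circle $\mathbb S^1$, and let $E_Y$ be the topological conjugacy relation on the set of all continuous maps $T:Y\to Y$ such that the system $(Y,T)$ is chaotic. Then $$E_v\leq_B E_Y\leq_B E_{=^+},$$ where $E_v$ is the Vitali equivalence relation and $E_{=^+}$ is the relation of equality of countable sets of reals (the universal $F_{\sigma\delta}$ relation induced by the group $S_\infty$).
   Context: A dynamical system is a pair $(X,T)$ where $X$ is a compact metrizable space and $T:X\to X$ is continuous (not necessarily invertible). Two systems $(X,T)$, $(Y,S)$ are (topologically) conjugate if there is a homeomorphism $h:X\to Y$ with $h\circ T=S\circ h$. $(X,T)$ is (Devaney) chaotic if for every finite cover $\mathcal U$ of $X$ by nonempty open sets there is a periodic point $x\in X$ whose orbit $\{T^n(x):n\ge 0\}$ meets every element of $\mathcal U$; equivalently, $T$ is transitive (for all nonempty open $U,V$ there is $n\ge0$ with $T^n(U)\cap V\ne\emptyset$) and has a dense set of periodic points. For equivalence relations $E$ on $X$ and $F$ on $Y$, where $X,Y$ are Polish (or standard Borel) spaces, $E\leq_B F$ (Borel reducible) means there is a Borel map $f:X\to Y$ with $x\,E\,x'\iff f(x)\,F\,f(x')$ for all $x,x'\in X$. Continuous self-maps of $Y$ are regarded as elements of the Polish space $C(Y,Y)$ with the topology of uniform convergence. The Vitali equivalence relation is $E_v=\{(x,y)\in\mathbb R^2:x-y\in\mathbb Q\}$. The relation $E_{=^+}$ is defined on $\mathbb R^{\mathbb N}$ by: $(a_n)$ and $(a_n')$ are equivalent iff $\{a_n:n\in\mathbb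 N\}=\{a_n':n\in\mathbb N\}$. *)

theory Defs
  imports "HOL-Analysis.Analysis"
begin

definition dynamical_system :: "'a topology \<Rightarrow> ('a \<Rightarrow> 'a) \<Rightarrow> bool" where
  "dynamical_system X T \<longleftrightarrow>
     compact_space X \<and> metrizable_space X \<and> continuous_map X X T"

definition conjugate ::
  "'a topology \<Rightarrow> ('a \<Rightarrow> 'a) \<Rightarrow> 'b topology \<Rightarrow> ('b \<Rightarrow> 'b) \<Rightarrow> bool" where
  "conjugate X T Y S \<longleftrightarrow>
     (\<exists>h. homeomorphic_map X Y h \<and> (\<forall>x\<in>topspace X. h (T x) = S (h x)))"

definition periodic_point :: "'a topology \<Rightarrow> ('a \<Rightarrow> 'a) \<Rightarrow> 'a \<Rightarrow> bool" where
  "periodic_point X T x \<longleftrightarrow> x \<in> topspace X \<and> (\<exists>n>0. (T ^^ n) x = x)"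

definition chaotic :: "'a topology \<Rightarrow> ('a \<Rightarrow> 'a) \<Rightarrow> bool" where
  "chaotic X T \<longleftrightarrow>
     dynamical_system X T \<and>
     (\<forall>\<U>. finite \<U> \<and> (\<forall>U\<in>\<U>. openin X U \<and> U \<noteq> {}) \<and> \<Union>\<U> = topspace X \<longrightarrow>
        (\<exists>x. periodic_point X T x \<and> (\<forall>U\<in>\<U>. \<exists>n. (T ^^ n) x \<in> U)))"

text \<open>
  \<open>C(Y,Y)\<close> with the uniform metric. As everywhere in \<^const>\<open>cfunspace\<close>, its elements are
  extensional functions (constantly \<^term>\<open>undefined\<close> off \<open>Y\<close>), so that a continuous self-map
  of \<open>Y\<close> is represented by exactly one element.
\<close>
definition self_maps :: "'a::metric_space set \<Rightarrow> ('a \<Rightarrow> 'a) metric" where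
  "self_maps Y = cfunspace (top_of_set Y) (submetric euclidean_metric Y)"

definition chaotic_maps :: "'a::metric_space set \<Rightarrow> ('a \<Rightarrow> 'a) set" where
  "chaotic_maps Y = {T \<in> mspace (self_maps Y). chaotic (top_of_set Y) T}"

text \<open>
  The Borel structure on the set of chaotic maps is the trace of the Borel sigma-algebra
  of \<open>C(Y,Y)\<close>.
\<close>
definition chaotic_maps_borel :: "'a::metric_space set \<Rightarrow> ('a \<Rightarrow> 'a) measure" where
  "chaotic_maps_borel Y =
     restrict_space
       (sigma (mspace (self_maps Y)) {U. openin (mtopology_of (self_maps Y)) U})
       (chaotic_maps Y)"

definition chaotic_conjugacy :: "'a::metric_space set \<Rightarrow> (('a \<Rightarrow> 'a) \<times> ('a \<Rightarrow> 'a)) set" where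
  "chaotic_conjugacy Y =
     {(T, S). T \<in> chaotic_maps Y \<and> S \<in> chaotic_maps Y \<and>
              conjugate (top_of_set Y) T (top_of_set Y) S}"

definition vitali_rel :: "(real \<times> real) set" where
  "vitali_rel = {(x, y). x - y \<in> \<rat>}"

definition eq_plus_rel :: "((nat \<Rightarrow> real) \<times> (nat \<Rightarrow> real)) set" where
  "eq_plus_rel = {(a, b). range a = range b}"

text \<open>
  Only the sigma-algebras of the two measure arguments matter: a measure serves here
  as a measurable space.
\<close>
definition borel_reducible ::
  "'a measure \<Rightarrow> ('a \<times> 'a) set \<Rightarrow> 'b measure \<Rightarrow> ('b \<times> 'b) set \<Rightarrow> bool" where
  "borel_reducible M E N F \<longleftrightarrow>
     (\<exists>f \<in> measurable M N. \<forall>x\<in>space M. \<forall>x'\<in>space M. (x, x') \<in> E \<longleftrightarrow> (f x, f x') \<in> F)"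

text \<open>Well-formedness of the encodings.\<close>

lemma space_chaotic_maps_borel [simp]: "space (chaotic_maps_borel Y) = chaotic_maps Y"
proof -
  have "{U. openin (mtopology_of (self_maps Y)) U} \<subseteq> Pow (mspace (self_maps Y))"
    using openin_subset by fastforce
  then show ?thesis
    by (auto simp: chaotic_maps_borel_def chaotic_maps_def space_restrict_space space_measure_of)
qed

lemma mspace_self_maps:
  assumes "compact Y"
  shows "mspace (self_maps Y) =
           {f. f \<in> Y \<rightarrow> Y \<and> f \<in> extensional Y \<and> continuous_on Y f}"
proof -
  have m: "mtopology_of (submetric euclidean_metric Y) = top_of_set Y"
    by (simp add: mtopology_of_submetric)
  have c: "compactin (top_of_set Y) (topspace (top_of_set Y))"
    using assms by (simp add: compactin_subtopology)
  show ?thesis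
    unfolding self_maps_def compactin_mspace_cfunspace[OF c] m by auto
qed

lemma mdist_self_maps_le:
  assumes "Y \<noteq> {}" "f \<in> mspace (self_maps Y)" "g \<in> mspace (self_maps Y)"
  shows "mdist (self_maps Y) f g \<le> a \<longleftrightarrow> (\<forall>x\<in>Y. dist (f x) (g x) \<le> a)"
  using assms unfolding self_maps_def by (subst cfunspace_mdist_le) auto

lemma equiv_vitali_rel: "equiv UNIV vitali_rel"
proof (rule equivI)
  show "refl vitali_rel" by (simp add: refl_on_def vitali_rel_def)
  show "sym vitali_rel"
  proof (rule symI)
    fix x y assume "(x, y) \<in> vitali_rel"
    then have "- (x - y) \<in> \<rat>" by (simp only: vitali_rel_def mem_Collect_eq prod.case Rats_minus_iff)
    then show "(y, x) \<in> vitali_rel" by (simp add: vitali_rel_def)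
  qed
  show "trans vitali_rel"
  proof (rule transI)
    fix x y z assume "(x, y) \<in> vitali_rel" "(y, z) \<in> vitali_rel"
    then have "(x - y) + (y - z) \<in> \<rat>" by (intro Rats_add) (simp_all add: vitali_rel_def)
    then show "(x, z) \<in> vitali_rel" by (simp add: vitali_rel_def)
  qed
qed (simp add: vitali_rel_def)

lemma equiv_eq_plus_rel: "equiv UNIV eq_plus_rel"
  by (auto simp: equiv_def refl_on_def sym_def trans_def eq_plus_rel_def)

end

(*
  Lower bound.  A zigzag map of the real line maps [n, n+1] onto [n-1, n+2] with a(n) returns to
  the bottom value n-1.  It expands, so every interval eventually covers every compact set; hence
  it is chaotic on the two-point (interval) and the one-point (circle) compactification of the
  line.  The integers are the fixed local minima and there are no fixed local maxima, so a conjugacy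
  preserves orientation, acts on the integers as a translation, and preserves the numbers a(n).
  Thus two such maps are conjugate iff the sequences a are shifts of each other.  If d_k are the
  digits of x in the factorial number system, x - y is rational iff the digits of x and y agree
  eventually, iff the profinite integers sum d_k k! differ by an integer (floor expansions are not
  eventually maximal, so carries stop).  The sequence a(n) records the least k for which n is not
  congruent modulo k! to that profinite integer.

  Upper bound.  Fix a parametrisation of Y by [0,1] (for the circle, starting at a periodic point)
  and finitely many points that are isolated from the left in some Fix(T^n), so that they are moved
  correctly by conjugacies.  By sensitivity the points can be chosen such that every interval has an
  iterate that meets two disjoint arcs between them, whereas short intervals need many iterations.
  Cutting [0,1] greedily into intervals that succeed within n steps gives, for n = 1, 2, ..., a
  dense sequence of points.  The relative order of these points and of their images determines T up
  to conjugacy; coding it by a real number and collecting the codes over the countably many choices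
  gives a countable set of reals that is a complete invariant.
*)
theory Submission
  imports Defs
begin

text \<open>Lower bound: a zigzag moves each point by at most 2, while bounded distances shrink to 0
  near the ends of the compactification. Hence the extension by the identity is continuous, and up
  to a given error it depends on finitely many \<open>a n\<close>, which makes the reduction Borel.
  The information sits in lap counts because a conjugacy sees no lengths. Upper bound: the obstacle
  is that a conjugacy preserves neither lengths nor rationals, and that it may reverse the
  orientation or rotate the circle. Every choice must be defined from the order and the dynamics,
  and each family of choices must be countable and closed under conjugacy. Points isolated from the
  left in some Fix(T^n) meet both demands: each is named by n and a rational shortly before it, and
  a conjugacy changes only the rational. No choice of names is canonical, hence a set of codes and
  not a single real. One common code already yields a conjugacy, so two such sets coincide or share
  only the filler 0.\<close>

section \<open>Zigzag maps of the line\<close>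

text \<open>The distance to the nearest even integer.\<close>

definition tri :: "real \<Rightarrow> real" where
  "tri u = arccos (cos (pi * u)) / pi"

lemma continuous_on_tri: "continuous_on A tri"
  unfolding tri_def by (intro continuous_intros) (auto intro: cos_ge_minus_one cos_le_one)

lemma tri_bounds: "0 \<le> tri u" "tri u \<le> 1"
  using arccos_lbound[of "cos (pi * u)"] arccos_ubound[of "cos (pi * u)"]
  by (auto simp: tri_def field_simps)

lemma tri_even:
  assumes "2 * of_int k \<le> u" "u \<le> 2 * of_int k + 1" shows "tri u = u - 2 * of_int k"
proof -
  have "cos (pi * u) = cos (pi * (u - 2 * of_int k))"
    using cos.plus_of_int[of "pi * (u - 2 * of_int k)" k] by (simp add: algebra_simps)
  moreover have "arccos (cos (pi * (u - 2 * of_int k))) = pi * (u - 2 * of_int k)"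
    by (rule arccos_cos) (use assms mult_left_mono[of "u - 2 * of_int k" 1 pi] in auto)
  ultimately show ?thesis by (simp add: tri_def)
qed

lemma tri_odd:
  assumes "2 * of_int k - 1 \<le> u" "u \<le> 2 * of_int k" shows "tri u = 2 * of_int k - u"
proof -
  have "tri u = tri (- u)" by (simp add: tri_def)
  also have "\<dots> = - u - 2 * of_int (- k)" by (rule tri_even) (use assms in auto)
  finally show ?thesis by simp
qed

lemma tri_cases:
  fixes k :: int
  shows "(\<forall>u. of_int k \<le> u \<and> u \<le> of_int k + 1 \<longrightarrow> tri u = u - of_int k) \<or>
         (\<forall>u. of_int k \<le> u \<and> u \<le> of_int k + 1 \<longrightarrow> tri u = of_int k + 1 - u)"
proof (cases "even k")
  case True
  then obtain j where "k = 2 * j" by (auto elim: evenE)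
  then show ?thesis using tri_even[of j] by auto
next
  case False
  then obtain j where "k = 2 * j + 1" by (auto elim: oddE)
  then show ?thesis using tri_odd[of "j+1"] by (auto simp: algebra_simps)
qed

lemma tri_isometry:
  fixes k :: int
  assumes "of_int k \<le> u" "u \<le> of_int k + 1" "of_int k \<le> v" "v \<le> of_int k + 1"
  shows "\<bar>tri u - tri v\<bar> = \<bar>u - v\<bar>"
  using tri_cases[of k] assms by auto

text \<open>A fold at one integer costs at most half of the length, because one of the two sides has
  half the length and slope 1 or -1 on it. An interval that passes two integers contains a whole
  lap, of height 1.\<close>

lemma tri_spread:
  assumes "u < v"
  shows "\<exists>z\<in>{u..v}. \<exists>w\<in>{u..v}. min 1 ((v - u) / 2) \<le> \<bar>tri z - tri w\<bar>"
proof -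
  define k where "k = \<lfloor>u\<rfloor>"
  have k: "of_int k \<le> u" "u < of_int k + 1" unfolding k_def by linarith+
  consider "v \<le> of_int k + 1" | "of_int k + 1 < v" "v \<le> of_int k + 2" | "of_int k + 2 < v"
    by linarith
  then show ?thesis
  proof cases
    case 1
    then have "\<bar>tri u - tri v\<bar> = \<bar>u - v\<bar>" using k assms by (intro tri_isometry[of k]) auto
    then show ?thesis using assms by - (rule bexI[of _ u], rule bexI[of _ v], auto simp: min_def)
  next
    case 2
    have 1: "\<bar>tri u - tri (of_int k + 1)\<bar> = \<bar>u - (of_int k + 1)\<bar>"
      using k by (intro tri_isometry[of k]) auto
    have 2: "\<bar>tri (of_int k + 1) - tri v\<bar> = \<bar>of_int k + 1 - v\<bar>"
      using 2 by (intro tri_isometry[of "k + 1"]) auto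
    show ?thesis
    proof (cases "of_int k + 1 - u \<ge> (v - u) / 2")
      case True
      then show ?thesis using 1 k \<open>of_int k + 1 < v\<close>
        by - (rule bexI[of _ u], rule bexI[of _ "of_int k + 1"], auto)
    next
      case False
      then show ?thesis using 2 k \<open>of_int k + 1 < v\<close>
        by - (rule bexI[of _ "of_int k + 1"], rule bexI[of _ v], auto simp: min_def)
    qed
  next
    case 3
    have "\<bar>tri (of_int k + 1) - tri (of_int k + 2)\<bar> = \<bar>(of_int k + 1) - (of_int k + 2 :: real)\<bar>"
      by (intro tri_isometry[of "k + 1"]) auto
    then show ?thesis using k 3
      by - (rule bexI[of _ "of_int k + 1"], rule bexI[of _ "of_int k + 2"], auto)
  qed
qed

lemma tri_eq_0_iff: "tri u = 0 \<longleftrightarrow> (\<exists>j::int. u = 2 * of_int j)"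
proof
  define k where "k = \<lfloor>u\<rfloor>"
  have k: "of_int k \<le> u" "u < of_int k + 1" unfolding k_def by linarith+
  assume z: "tri u = 0"
  show "\<exists>j::int. u = 2 * of_int j"
  proof (cases "even k")
    case True
    then obtain j where "k = 2 * j" by (auto elim: evenE)
    then show ?thesis using tri_even[of j u] k z by auto
  next
    case False
    then obtain j where "k = 2 * j + 1" by (auto elim: oddE)
    then show ?thesis using tri_odd[of "j+1" u] k z by (auto simp: algebra_simps)
  qed
next
  assume "\<exists>j::int. u = 2 * of_int j"
  then obtain j :: int where "u = 2 * of_int j" by blast
  then show "tri u = 0" using tri_even[of j u] by simp
qed

text \<open>All folds have value 0 or 1; elsewhere the slope is locally 1 or -1, so smaller and
  larger values occur arbitrarily close.\<close>

lemma tri_not_extremal: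
  assumes "0 < tri u" "tri u < 1" "0 < e"
  shows "\<exists>v. \<bar>v - u\<bar> < e \<and> tri v < tri u" "\<exists>v. \<bar>v - u\<bar> < e \<and> tri v > tri u"
proof -
  define k where "k = \<lfloor>u\<rfloor>"
  have k: "of_int k \<le> u" "u < of_int k + 1" unfolding k_def by linarith+
  have "of_int k \<noteq> u"
    using tri_cases[of k] assms by auto
  then have k': "of_int k < u" using k by simp
  define d where "d = min (e / 2) (min (u - of_int k) (of_int k + 1 - u))"
  have d: "0 < d" "d < e" "of_int k \<le> u - d" "u + d \<le> of_int k + 1"
    using k' k assms by (auto simp: d_def min_def)
  have "(tri (u - d) < tri u \<and> tri (u + d) > tri u) \<or> (tri (u - d) > tri u \<and> tri (u + d) < tri u)"
    using tri_cases[of k] k d by auto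
  then show "\<exists>v. \<bar>v - u\<bar> < e \<and> tri v < tri u" "\<exists>v. \<bar>v - u\<bar> < e \<and> tri v > tri u"
    using d by (metis abs_of_pos add_diff_cancel_left' diff_diff_eq2 abs_minus_commute)+
qed

text \<open>The phase \<open>1/3\<close> makes the lap pattern on \<open>[n, n + 1]\<close> start at the value \<open>n\<close> going up and
  end at \<open>n + 1\<close> going down; hence every integer is a fixed local minimum.\<close>

definition zig :: "(int \<Rightarrow> nat) \<Rightarrow> real \<Rightarrow> real" where
  "zig a x = of_int \<lfloor>x\<rfloor> - 1 + 3 * tri (1/3 + (2 * real (a \<lfloor>x\<rfloor>) + 1) * (x - of_int \<lfloor>x\<rfloor>))"

text \<open>At the right end the floor jumps to the next cell. Both formulas give
  \<open>n + 1\<close> there, since the lap pattern ends with \<open>tri = 2/3\<close> and starts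
  with \<open>tri = 1/3\<close>; this is what lets the cells glue continuously.\<close>

lemma zig_cell:
  assumes "of_int n \<le> x" "x \<le> of_int n + 1"
  shows "zig a x = of_int n - 1 + 3 * tri (1/3 + (2 * real (a n) + 1) * (x - of_int n))"
proof (cases "x = of_int n + 1")
  case True
  have "tri (1/3) = 1/3" using tri_even[of 0 "1/3"] by simp
  moreover have "tri (1/3 + (2 * real (a n) + 1)) = 2/3"
    using tri_odd[of "int (a n) + 1" "1/3 + (2 * real (a n) + 1)"] by simp
  moreover have "\<lfloor>x\<rfloor> = n + 1" using True by simp
  ultimately show ?thesis using True by (simp add: zig_def)
next
  case False
  then have "\<lfloor>x\<rfloor> = n" using assms by linarith
  then show ?thesis by (simp add: zig_def)
qed

lemma zig_of_int [simp]: "zig a (of_int n) = of_int n"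
  using tri_even[of 0 "1/3"] zig_cell[of n "of_int n" a] by simp

lemma zig_cell_bounds:
  assumes "of_int n \<le> x" "x \<le> of_int n + 1"
  shows "of_int n - 1 \<le> zig a x" "zig a x \<le> of_int n + 2"
  unfolding zig_cell[OF assms] using tri_bounds by (auto simp: algebra_simps)

lemma zig_near: "\<bar>zig a x - x\<bar> \<le> 2"
proof -
  have "of_int \<lfloor>x\<rfloor> \<le> x" "x \<le> of_int \<lfloor>x\<rfloor> + 1" by linarith+
  from zig_cell_bounds[OF this, of a] this show ?thesis by linarith
qed

lemma continuous_on_cell_gluing:
  fixes f :: "real \<Rightarrow> 'a::topological_space"
  assumes "\<And>n::int. continuous_on {of_int n..of_int n + 1} f"
  shows "continuous_on UNIV f"
proof -
  have "isCont f x" for x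
  proof -
    define n where "n = \<lfloor>x\<rfloor>"
    have n: "of_int n - 1 < x" "x < of_int n + 1" unfolding n_def by linarith+
    have "continuous_on ({of_int (n-1)..of_int (n-1) + 1} \<union> {of_int n..of_int n + 1}) f"
      by (intro continuous_on_closed_Un assms) auto
    then have "continuous_on {of_int n - 1 .. of_int n + 1} f"
      by (rule continuous_on_subset) auto
    then have "continuous_on {of_int n - 1 <..< of_int n + 1} f"
      by (rule continuous_on_subset) auto
    then show ?thesis using n by (simp add: continuous_on_eq_continuous_at)
  qed
  then show ?thesis by (simp add: continuous_on_eq_continuous_at)
qed

lemma continuous_zig: "continuous_on UNIV (zig a)"
proof (rule continuous_on_cell_gluing)
  fix n :: int
  have "continuous_on {of_int n..of_int n + 1}
     (\<lambda>x. of_int n - 1 + 3 * tri (1/3 + (2 * real (a n) + 1) * (x - of_int n)))"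
    by (intro continuous_intros continuous_on_compose2[OF continuous_on_tri[of UNIV]]) auto
  then show "continuous_on {of_int n..of_int n + 1} (zig a)"
    by (rule continuous_on_eq) (auto simp: zig_cell[of n])
qed

section \<open>Expansion and covering\<close>

lemma zig_cell_image:
  assumes "1 \<le> a n"
  shows "{of_int n - 1..of_int n + 2} \<subseteq> zig a ` {of_int n..of_int n + 1}"
proof -
  define s where "s = 2 * real (a n) + 1"
  have s: "s \<ge> 3" using assms by (simp add: s_def)
  \<comment> \<open>The points where the phase equals 1 and 2, that is, the first top and the first
    bottom in the cell. Both lie in the cell because \<open>s\<close> is at least
    \<open>5/3\<close>.\<close>
  define x y where "x = of_int n + (2/3) / s" and "y = of_int n + (5/3) / s"
  have x: "of_int n \<le> x" "x \<le> y" "y \<le> of_int n + 1"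
    using s by (auto simp: x_def y_def field_simps)
  have "zig a x = of_int n - 1 + 3 * tri 1"
    using x s by (subst zig_cell[of n]) (auto simp: s_def[symmetric] x_def)
  then have zx: "zig a x = of_int n + 2" using tri_even[of 0 1] by simp
  have "zig a y = of_int n - 1 + 3 * tri 2"
    using x s by (subst zig_cell[of n]) (auto simp: s_def[symmetric] y_def)
  then have zy: "zig a y = of_int n - 1" using tri_even[of 1 2] by simp
  have "continuous_on {x..y} (zig a)" using continuous_zig continuous_on_subset by blast
  then have "{zig a y..zig a x} \<subseteq> zig a ` {x..y}"
    using IVT2'[of "zig a" y _ x] x by fastforce
  also have "\<dots> \<subseteq> zig a ` {of_int n..of_int n + 1}" using x by (intro image_mono) auto
  finally show ?thesis using zx zy by simp
qed

text \<open>The phase stretches by \<open>s >= 3\<close>, a fold costs a factor 2 and the height of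
  the laps gives a factor 3, together 9/2. A factor 4 is kept, so that losing one half at a cell
  boundary in \<open>zig_spread\<close> still leaves 2.\<close>

lemma zig_spread_cell:
  assumes "1 \<le> a n" "of_int n \<le> x" "x < y" "y \<le> of_int n + 1"
  shows "\<exists>z\<in>{x..y}. \<exists>w\<in>{x..y}. min 2 (4 * (y - x)) \<le> \<bar>zig a z - zig a w\<bar>"
proof -
  define s where "s = 2 * real (a n) + 1"
  have s: "s \<ge> 3" using assms by (simp add: s_def)
  define L where "L t = 1/3 + s * (t - of_int n)" for t
  have "L x < L y" using s assms by (simp add: L_def)
  from tri_spread[OF this] obtain u v where uv: "u \<in> {L x..L y}" "v \<in> {L x..L y}"
    "min 1 ((L y - L x) / 2) \<le> \<bar>tri u - tri v\<bar>" by blast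
  define z w where "z = of_int n + (u - 1/3) / s" and "w = of_int n + (v - 1/3) / s"
  have zw: "L z = u" "L w = v" using s by (simp_all add: L_def z_def w_def)
  have zw': "z \<in> {x..y}" "w \<in> {x..y}"
    using uv s by (auto simp: L_def z_def w_def field_simps)
  have "L y - L x = s * (y - x)" by (simp add: L_def algebra_simps)
  then have "L y - L x \<ge> 3 * (y - x)" using mult_right_mono[of 3 s "y - x"] s assms by simp
  then have "min 2 (4 * (y - x)) \<le> 3 * min 1 ((L y - L x) / 2)"
    using assms by (cases "L y - L x \<le> 2") (auto simp: min_def)
  also have "\<dots> \<le> \<bar>zig a z - zig a w\<bar>"
    using uv zw zw' assms by (simp add: zig_cell[of n] L_def s_def)
  finally show ?thesis using zw' by blast
qed

lemma zig_spread:
  assumes a: "\<forall>n. 1 \<le> a n" and xy: "x < y" "y \<le> x + 1"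
  shows "\<exists>z\<in>{x..y}. \<exists>w\<in>{x..y}. min 2 (2 * (y - x)) \<le> \<bar>zig a z - zig a w\<bar>"
proof -
  define n where "n = \<lfloor>x\<rfloor>"
  have n: "of_int n \<le> x" "x < of_int n + 1" unfolding n_def by linarith+
  define m :: real where "m = of_int n + 1"
  \<comment> \<open>As \<open>y \<le> x + 1\<close>, at most one cell boundary lies inside the
    interval, and one of the two sides has half of its length.\<close>
  consider "y \<le> m" | "m < y" "m - x \<ge> (y - x) / 2" | "m < y" "y - m \<ge> (y - x) / 2"
    by argo
  then obtain p q k where "of_int k \<le> p" "p < q" "q \<le> of_int k + 1" "(y - x) / 2 \<le> q - p"
    "x \<le> p" "q \<le> y"
  proof cases
    case 1 then show ?thesis using that[of n x y] n xy m_def by auto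
  next
    case 2 then show ?thesis using that[of n x m] n xy m_def by auto
  next
    case 3 then show ?thesis using that[of "n+1" m y] n xy m_def by auto
  qed
  with zig_spread_cell[of a k p q] a obtain z w where
    "z \<in> {p..q}" "w \<in> {p..q}" "min 2 (4 * (q - p)) \<le> \<bar>zig a z - zig a w\<bar>" by blast
  with \<open>(y - x) / 2 \<le> q - p\<close> \<open>x \<le> p\<close> \<open>q \<le> y\<close> show ?thesis
    by - (rule bexI[of _ z], rule bexI[of _ w], auto)
qed

lemma zig_image_grow:
  assumes a: "\<forall>n. 1 \<le> a n" and xy: "x < y"
  shows "\<exists>p q. p < q \<and> min 2 (2 * (y - x)) \<le> q - p \<and> {p..q} \<subseteq> zig a ` {x..y}"
proof -
  \<comment> \<open>A length of 1 already reaches the cap 2, so longer intervals may be cut down to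
    it.\<close>
  define y' where "y' = min y (x + 1)"
  have y': "x < y'" "y' \<le> x + 1" "y' \<le> y" "min 2 (2 * (y - x)) = min 2 (2 * (y' - x))" "2 * (y' - x) > 0"
    using xy unfolding y'_def by (auto split: split_min)
  obtain z w where zw: "z\<in>{x..y'}" "w\<in>{x..y'}" "min 2 (2 * (y' - x)) \<le> \<bar>zig a z - zig a w\<bar>"
    using zig_spread[OF a y'(1,2)] by blast
  have "connected (zig a ` {x..y'})"
    by (intro connected_continuous_image continuous_on_subset[OF continuous_zig]) auto
  then have "{min (zig a z) (zig a w)..max (zig a z) (zig a w)} \<subseteq> zig a ` {x..y'}"
    using zw by (intro connected_contains_Icc) (auto simp: min_def max_def)
  also have "\<dots> \<subseteq> zig a ` {x..y}" using y' by (intro image_mono) auto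
  finally show ?thesis using zw(3) y'
    by (intro exI[of _ "min (zig a z) (zig a w)"] exI[of _ "max (zig a z) (zig a w)"]) auto
qed

lemma zig_funpow_grow:
  assumes a: "\<forall>n. 1 \<le> a n" and xy: "x < y"
  shows "\<exists>p q. p < q \<and> min 2 (2 ^ k * (y - x)) \<le> q - p \<and> {p..q} \<subseteq> (zig a ^^ k) ` {x..y}"
proof (induction k)
  case 0
  show ?case using xy by (intro exI[of _ x] exI[of _ y]) auto
next
  case (Suc k)
  then obtain p q where pq: "p < q" "min 2 (2 ^ k * (y - x)) \<le> q - p" "{p..q} \<subseteq> (zig a ^^ k) ` {x..y}"
    by blast
  obtain p' q' where pq': "p' < q'" "min 2 (2 * (q - p)) \<le> q' - p'" "{p'..q'} \<subseteq> zig a ` {p..q}"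
    using zig_image_grow[OF a pq(1)] by blast
  have "{p'..q'} \<subseteq> (zig a ^^ Suc k) ` {x..y}"
    using order_trans[OF pq'(3) image_mono[OF pq(3)]] by (simp add: image_comp)
  moreover have "min 2 (2 ^ Suc k * (y - x)) \<le> q' - p'" using pq(2) pq'(2) by auto
  ultimately show ?case using pq' by blast
qed

text \<open>Each cell covers both of its neighbours, so the image gains one unit on either side per
  step.\<close>

lemma zig_funpow_expand:
  assumes a: "\<forall>n. 1 \<le> a n"
  shows "{of_int m - real j..of_int m + 1 + real j} \<subseteq> (zig a ^^ j) ` {of_int m..of_int m + 1}"
proof (induction j)
  case (Suc j)
  have "{of_int m - real (Suc j)..of_int m + 1 + real (Suc j)} \<subseteq> zig a ` {of_int m - real j..of_int m + 1 + real j}"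
  proof
    fix y assume y: "y \<in> {of_int m - real (Suc j)..of_int m + 1 + real (Suc j)}"
    \<comment> \<open>The cell closest to \<open>y\<close> among those covered so far; its image
      reaches one unit further.\<close>
    define n where "n = max (m - int j) (min (m + int j) \<lfloor>y\<rfloor>)"
    have "of_int n - 1 \<le> y" "y \<le> of_int n + 2" "m - int j \<le> n" "n \<le> m + int j"
      using y unfolding n_def by (auto simp: max_def min_def) linarith+
    then have "y \<in> zig a ` {of_int n..of_int n + 1}" using zig_cell_image[of a n] a by auto
    moreover have "{of_int n..of_int n + 1} \<subseteq> {of_int m - real j..of_int m + 1 + real j}"
      using \<open>m - int j \<le> n\<close> \<open>n \<le> m + int j\<close> by auto
    ultimately show "y \<in> zig a ` {of_int m - real j..of_int m + 1 + real j}" by blast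
  qed
  also have "\<dots> \<subseteq> zig a ` (zig a ^^ j) ` {of_int m..of_int m + 1}" using Suc by blast
  finally show ?case by (simp add: image_comp)
qed auto

text \<open>Two stages: the length doubles until it reaches 2, which forces a whole cell into the
  image, and from there the image grows by one cell on either side per step. A positive
  \<open>k\<close> is what a periodic point will require.\<close>

lemma zig_eventually_covers:
  assumes a: "\<forall>n. 1 \<le> a n" and xy: "x < y"
  shows "\<exists>k>0. {-N..N} \<subseteq> (zig a ^^ k) ` {x..y}"
proof -
  obtain k where "2 / (y - x) < 2 ^ k" using real_arch_pow[of 2 "2 / (y - x)"] by auto
  then have k: "2 \<le> 2 ^ k * (y - x)" using xy by (simp add: field_simps)
  obtain p q where pq: "p < q" "min 2 (2 ^ k * (y - x)) \<le> q - p" "{p..q} \<subseteq> (zig a ^^ k) ` {x..y}"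
    using zig_funpow_grow[OF a xy] by blast
  define m where "m = \<lceil>p\<rceil>"
  have m: "{of_int m..of_int m + 1} \<subseteq> {p..q}" using pq(2) k unfolding m_def by auto linarith+
  obtain j where j: "real j \<ge> \<bar>N\<bar> + \<bar>of_int m\<bar> + 1" using real_arch_simple by blast
  have "{-N..N} \<subseteq> {of_int m - real j..of_int m + 1 + real j}" using j by auto
  also have "\<dots> \<subseteq> (zig a ^^ j) ` {of_int m..of_int m + 1}" by (rule zig_funpow_expand[OF a])
  also have "\<dots> \<subseteq> (zig a ^^ j) ` (zig a ^^ k) ` {x..y}" using m pq(3) by (intro image_mono) auto
  also have "\<dots> = (zig a ^^ (j + k)) ` {x..y}" by (simp add: funpow_add image_comp)
  finally show ?thesis using j by (intro exI[of _ "j + k"]) auto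
qed

section \<open>Fixed points and the number of bottom points\<close>

lemma zig_of_int_local_min: "\<exists>e>0. \<forall>x. \<bar>x - of_int n\<bar> < e \<longrightarrow> of_int n \<le> zig a x"
proof -
  define s where "s = 2 * real (a n) + 1"
  define s' where "s' = 2 * real (a (n - 1)) + 1"
  have s: "s \<ge> 1" "s' \<ge> 1" by (simp_all add: s_def s'_def)
  \<comment> \<open>Within \<open>e\<close> of \<open>n\<close> the phase moves by at most
    \<open>1/3\<close>: to the right it stays on the rising lap from \<open>1/3\<close>, to the left
    on the falling lap that ends at \<open>tri = 2/3\<close>.\<close>
  define e where "e = 1 / (3 * s * s')"
  have "e * s \<le> 1/3" "e * s' \<le> 1/3" "e > 0" "e < 1"
    using s mult_mono[of 1 s 1 s'] by (auto simp: e_def field_simps)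
  moreover have "of_int n \<le> zig a x" if x: "\<bar>x - of_int n\<bar> < e" for x
  proof (cases "of_int n \<le> x")
    case True
    have sx: "0 \<le> s * (x - of_int n)" "s * (x - of_int n) \<le> s * e"
      using True x s by (auto intro!: mult_left_mono)
    then have "tri (1/3 + s * (x - of_int n)) = 1/3 + s * (x - of_int n)"
      using tri_even[of 0 "1/3 + s * (x - of_int n)"] \<open>e * s \<le> 1/3\<close> by (simp add: mult.commute)
    then show ?thesis using zig_cell[of n x a] True x sx \<open>e < 1\<close> by (simp add: s_def)
  next
    case False
    define t where "t = s' * (of_int n - x)"
    have t: "0 \<le> t" "t \<le> s' * e"
      unfolding t_def using False x s by (auto intro!: mult_left_mono)
    have u: "1/3 + s' * (x - of_int (n - 1)) = 2 * of_int (int (a (n - 1)) + 1) - (2/3 + t)"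
      by (simp add: s'_def t_def algebra_simps)
    have "tri (1/3 + s' * (x - of_int (n - 1))) = 2/3 + t"
      unfolding u by (subst tri_odd[of "int (a (n - 1)) + 1"])
        (use t \<open>e * s' \<le> 1/3\<close> in \<open>auto simp: mult.commute\<close>)
    then show ?thesis using zig_cell[of "n - 1" x a] False x t \<open>e < 1\<close> by (simp add: s'_def)
  qed
  ultimately show ?thesis by blast
qed

text \<open>A fixed point strictly inside cell \<open>n\<close> has a value strictly between
  \<open>n\<close> and \<open>n + 1\<close>, far from the extreme values \<open>n - 1\<close> and
  \<open>n + 2\<close> of the cell, so it does not lie on a fold.\<close>

lemma zig_fixed_not_extremal:
  assumes "zig a x = x" "x \<notin> \<int>" "0 < e"
  shows "\<exists>z. \<bar>z - x\<bar> < e \<and> zig a z < x" "\<exists>z. \<bar>z - x\<bar> < e \<and> x < zig a z"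
proof -
  define n where "n = \<lfloor>x\<rfloor>"
  define s where "s = 2 * real (a n) + 1"
  have s: "s > 0" by (simp add: s_def)
  have "of_int n \<noteq> x" using assms(2) by auto
  then have n: "of_int n < x" "x < of_int n + 1" unfolding n_def by linarith+
  define u where "u = 1/3 + s * (x - of_int n)"
  have zx: "zig a x = of_int n - 1 + 3 * tri u"
    using n by (simp add: zig_cell[of n] u_def s_def)
  then have tri: "0 < tri u" "tri u < 1" using assms(1) n by linarith+
  define e' where "e' = min e (min (x - of_int n) (of_int n + 1 - x))"
  have e': "e' > 0" "e' \<le> e" using n assms(3) by (auto simp: e'_def)
  have *: "\<bar>x + (v - u) / s - x\<bar> < e' \<and> zig a (x + (v - u) / s) = of_int n - 1 + 3 * tri v"
    if "\<bar>v - u\<bar> < s * e'" for v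
  proof -
    have "\<bar>(v - u) / s\<bar> < e'" using that s by (simp add: field_simps)
    moreover from this have "of_int n \<le> x + (v - u) / s" "x + (v - u) / s \<le> of_int n + 1"
      unfolding e'_def by linarith+
    then have "zig a (x + (v - u) / s) =
        of_int n - 1 + 3 * tri (1/3 + s * (x + (v - u) / s - of_int n))"
      by (simp add: zig_cell[of n] s_def)
    moreover have "1/3 + s * (x + (v - u) / s - of_int n) = v"
      using s by (simp add: u_def field_simps)
    ultimately show ?thesis by simp
  qed
  from tri_not_extremal[OF tri, of "s * e'"] s e' obtain v w where
    vw: "\<bar>v - u\<bar> < s * e'" "tri v < tri u" "\<bar>w - u\<bar> < s * e'" "tri w > tri u" by auto
  show "\<exists>z. \<bar>z - x\<bar> < e \<and> zig a z < x"
    using *[of v] vw zx assms(1) e'(2) by (intro exI[of _ "x + (v - u) / s"]) linarith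
  show "\<exists>z. \<bar>z - x\<bar> < e \<and> x < zig a z"
    using *[of w] vw zx assms(1) e'(2) by (intro exI[of _ "x + (w - u) / s"]) linarith
qed

lemma zig_fixed_not_local_max:
  assumes "zig a x = x" "0 < e"
  shows "\<exists>z. \<bar>z - x\<bar> < e \<and> x < zig a z"
proof (cases "x \<in> \<int>")
  case False
  then show ?thesis using zig_fixed_not_extremal assms by blast
next
  case True
  then obtain n where n: "x = of_int n" by (auto elim: Ints_cases)
  define s where "s = 2 * real (a n) + 1"
  have s: "s \<ge> 1" by (simp add: s_def)
  define t where "t = min (e / 2) (1 / (3 * s))"
  have t: "0 < t" "t < e" "s * t \<le> 1/3" "t \<le> 1"
  proof -
    have "1 / (3 * s) \<le> 1" using s by (simp add: field_simps)
    then show "t \<le> 1" by (simp add: t_def)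
  qed (use s assms(2) in \<open>auto simp: t_def min_def field_simps\<close>)
  have "zig a (x + t) = of_int n - 1 + 3 * tri (1/3 + s * t)"
    using t n by (simp add: zig_cell[of n] s_def)
  also have "tri (1/3 + s * t) = 1/3 + s * t"
    using tri_even[of 0 "1/3 + s * t"] t s by simp
  finally have "zig a (x + t) > x" using t s n by simp
  then show ?thesis using t by (intro exI[of _ "x + t"]) auto
qed

text \<open>The bottom is reached where the phase is an even integer. The phase runs from
  \<open>1/3\<close> to \<open>2 * a n + 4/3\<close>, which leaves 2, 4, ...,
  \<open>2 * a n\<close>.\<close>

lemma card_zig_bottom:
  "card {x \<in> {of_int n..of_int n + 1}. zig a x = of_int n - 1} = a n"
proof -
  define s where "s = 2 * real (a n) + 1"
  have s: "s > 0" by (simp add: s_def)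
  define g where "g i = of_int n + (2 * real i - 1/3) / s" for i :: nat
  have "{x \<in> {of_int n..of_int n + 1}. zig a x = of_int n - 1} = g ` {1..a n}"
  proof (intro set_eqI iffI)
    fix x assume x: "x \<in> {x \<in> {of_int n..of_int n + 1}. zig a x = of_int n - 1}"
    then have "tri (1/3 + s * (x - of_int n)) = 0" using zig_cell[of n x a] by (simp add: s_def)
    then obtain j :: int where j: "1/3 + s * (x - of_int n) = 2 * of_int j"
      unfolding tri_eq_0_iff by blast
    have b: "0 \<le> s * (x - of_int n)" "s * (x - of_int n) \<le> s * 1"
      using x s by (auto intro!: mult_left_mono)
    have "0 < (of_int j :: real)" "(of_int j :: real) < real (a n) + 1"
      using b j s_def by linarith+
    then have "1 \<le> j" "j \<le> int (a n)" by linarith+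
    moreover have "x = g (nat j)" using j s \<open>1 \<le> j\<close> by (simp add: g_def field_simps)
    ultimately show "x \<in> g ` {1..a n}" by (intro image_eqI[of _ _ "nat j"]) auto
  next
    fix x assume "x \<in> g ` {1..a n}"
    then obtain i where i: "1 \<le> i" "i \<le> a n" "x = g i" by auto
    have "2 * real i - 1/3 \<le> s" using i by (simp add: s_def)
    then have "0 \<le> (2 * real i - 1/3) / s" "(2 * real i - 1/3) / s \<le> 1"
      using s i by (simp_all add: divide_le_eq_1)
    then have x: "of_int n \<le> x" "x \<le> of_int n + 1" using i by (auto simp: g_def)
    moreover have "1/3 + s * (x - of_int n) = 2 * of_int (int i)"
      using s i by (simp add: g_def)
    then have "tri (1/3 + s * (x - of_int n)) = 0" unfolding tri_eq_0_iff by blast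
    ultimately show "x \<in> {x \<in> {of_int n..of_int n + 1}. zig a x = of_int n - 1}"
      by (simp add: zig_cell[of n] s_def)
  qed
  moreover have "inj_on g {1..a n}" using s by (auto simp: inj_on_def g_def)
  ultimately show ?thesis by (simp add: card_image)
qed

section \<open>Conjugacies between zigzag maps\<close>

lemma strict_mono_conj_zig_Ints:
  assumes h: "strict_mono h" "surj h" and conj: "\<And>x. h (zig a x) = zig b (h x)"
  shows "h (of_int n) \<in> \<int>"
proof (rule ccontr)
  assume nI: "h (of_int n) \<notin> \<int>"
  obtain e where e: "e > 0" "\<And>x. \<bar>x - of_int n\<bar> < e \<Longrightarrow> of_int n \<le> zig a x"
    using zig_of_int_local_min by blast
  have fx: "zig b (h (of_int n)) = h (of_int n)" using conj[of "of_int n"] by simp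
  \<comment> \<open>Within \<open>e'\<close> of \<open>h n\<close> all points are images of points
    within \<open>e\<close> of \<open>n\<close>, so \<open>zig b\<close> stays above
    \<open>h n\<close> there. This contradicts \<open>zig_fixed_not_extremal\<close>.\<close>
  define e' where "e' = min (h (of_int n) - h (of_int n - e)) (h (of_int n + e) - h (of_int n))"
  have "e' > 0" using strict_monoD[OF h(1)] e(1) by (simp add: e'_def)
  then obtain z where z: "\<bar>z - h (of_int n)\<bar> < e'" "zig b z < h (of_int n)"
    using zig_fixed_not_extremal(1)[OF fx nI] by blast
  obtain x where x: "z = h x" using h(2) by (meson surjD)
  have "h (of_int n - e) < h x" "h x < h (of_int n + e)" using z(1) x unfolding e'_def by linarith+
  then have "\<bar>x - of_int n\<bar> < e" using strict_mono_less[OF h(1)] by auto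
  then have "h (of_int n) \<le> h (zig a x)" using e strict_mono_less_eq[OF h(1)] by auto
  then show False using z(2) x conj by auto
qed

lemma zig_conj_shift:
  assumes a: "continuous_on UNIV h" "bij h" and conj: "\<And>x. h (zig a x) = zig b (h x)"
  shows "\<exists>c. \<forall>n. a n = b (n + c)"
proof -
  have "strict_mono h \<or> strict_antimono_on UNIV h"
    using injective_eq_monotone_map[of UNIV h] a by (auto simp: bij_def)
  moreover have "\<not> strict_antimono_on UNIV h"
  proof
    assume "strict_antimono_on UNIV h"
    then have anti: "h x < h y \<longleftrightarrow> y < x" for x y
      by (metis UNIV_I linorder_neq_iff monotone_on_def order_less_asym')
    obtain e where e: "e > 0" "\<And>x. \<bar>x - of_int 0\<bar> < e \<Longrightarrow> of_int 0 \<le> zig a x"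
      using zig_of_int_local_min by blast
    have fx: "zig b (h 0) = h 0" using conj[of 0] zig_of_int[of a 0] by simp
    define e' where "e' = min (h 0 - h e) (h (- e) - h 0)"
    have "e' > 0" using anti e(1) by (simp add: e'_def)
    then obtain z where z: "\<bar>z - h 0\<bar> < e'" "h 0 < zig b z"
      using zig_fixed_not_local_max[OF fx] by blast
    obtain x where x: "z = h x" using a(2) by (meson bij_pointE)
    have "h e < h x" "h x < h (- e)" using z(1) x unfolding e'_def by linarith+
    then have "\<bar>x\<bar> < e" using anti by auto
    then have "0 \<le> zig a x" using e(2)[of x] by simp
    then have "\<not> h 0 < h (zig a x)" using anti by auto
    then show False using z(2) x conj by auto
  qed
  ultimately have mono: "strict_mono h" by blast
  define k where "k = inv h"
  have hk: "h (k x) = x" "k (h x) = x" for x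
    using a(2) by (simp_all add: k_def bij_is_surj surj_f_inv_f bij_is_inj)
  \<comment> \<open>The inverse sends integers to integers as well. Hence no integer is skipped
    between the images of two consecutive integers, which gives \<open>step\<close>.\<close>
  have kmono: "strict_mono k"
    by (metis hk(1) mono strict_mono_less strict_monoI)
  have "k (zig b x) = zig a (k x)" for x
    using conj[of "k x"] hk by metis
  moreover have "surj k" using hk by (metis surjI)
  ultimately have kInt: "k (of_int n) \<in> \<int>" for n using strict_mono_conj_zig_Ints[OF kmono] by blast
  have hInt: "h (of_int n) \<in> \<int>" for n
    using strict_mono_conj_zig_Ints[OF mono _ conj] a(2) by (simp add: bij_is_surj)
  have step: "h (of_int (n + 1)) = h (of_int n) + 1" for n
  proof -
    obtain p q where pq: "h (of_int n) = of_int p" "h (of_int (n + 1)) = of_int q"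
      using hInt by (metis Ints_cases)
    have "h (of_int n) < h (of_int (n + 1))" using strict_monoD[OF mono] by simp
    then have "p + 1 \<le> q" using pq by simp
    obtain m where m: "k (of_int (p + 1)) = of_int m" using kInt by (metis Ints_cases)
    have hm: "h (of_int m) = of_int p + 1" using m hk(1)[of "of_int (p + 1)"] by simp
    have "\<not> p + 1 < q"
    proof
      assume "p + 1 < q"
      then have "h (of_int m) < h (of_int (n + 1))" "h (of_int n) < h (of_int m)"
        using pq hm by simp_all
      then have "m < n + 1" "n < m"
        using strict_mono_less[OF mono, of "of_int m" "of_int (n + 1)"]
          strict_mono_less[OF mono, of "of_int n" "of_int m"] by (simp_all only: of_int_less_iff)
      then show False by linarith
    qed
    then show ?thesis using \<open>p + 1 \<le> q\<close> pq by simp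
  qed
  obtain c where c: "h 0 = of_int c" using hInt[of 0] by (auto elim: Ints_cases)
  have hn: "h (of_int n) = of_int (n + c)" for n
  proof (induction n rule: int_induct[of _ 0])
    case (step1 i) then show ?case using step[of i] by simp
  next
    case (step2 i) then show ?case using step[of "i - 1"] by simp
  qed (use c in simp)
  have "a n = b (n + c)" for n
  proof -
    let ?A = "{x \<in> {of_int n..of_int n + 1}. zig a x = of_int n - 1}"
    let ?B = "{x \<in> {of_int (n + c)..of_int (n + c) + 1}. zig b x = of_int (n + c) - 1}"
    \<comment> \<open>By \<open>hn\<close> the cell \<open>n\<close> goes onto the cell
      \<open>n + c\<close> and the value \<open>n - 1\<close> to \<open>n + c - 1\<close>, so the
      bottom points of the two cells correspond.\<close>
    have iff: "h x \<in> ?B \<longleftrightarrow> x \<in> ?A" for x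
    proof -
      have "of_int (n + c) \<le> h x \<longleftrightarrow> of_int n \<le> x"
        using strict_mono_less_eq[OF mono, of "of_int n" x] hn[of n] by simp
      moreover have "h x \<le> of_int (n + c) + 1 \<longleftrightarrow> x \<le> of_int n + 1"
        using strict_mono_less_eq[OF mono, of x "of_int (n + 1)"] hn[of "n + 1"]
        by (simp add: add_ac)
      moreover have "zig b (h x) = of_int (n + c) - 1 \<longleftrightarrow> zig a x = of_int n - 1"
      proof -
        have "h (of_int (n - 1)) = of_int (n + c) - 1" using hn[of "n - 1"] by simp
        then have "zig b (h x) = of_int (n + c) - 1 \<longleftrightarrow> h (zig a x) = h (of_int (n - 1))"
          by (simp only: conj)
        then show ?thesis using strict_mono_eq[OF mono, of "zig a x" "of_int (n - 1)"] by simp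
      qed
      ultimately show ?thesis by simp
    qed
    have "?B = h ` ?A"
    proof (intro set_eqI iffI)
      fix z assume "z \<in> ?B"
      then show "z \<in> h ` ?A" using iff[of "k z"] hk(1)[of z] by (metis (no_types, lifting) image_eqI)
    qed (use iff in blast)
    then have "card ?B = card ?A"
      using strict_mono_imp_inj_on[OF mono] by (metis (no_types, lifting) card_image inj_on_subset subset_UNIV)
    then show ?thesis using card_zig_bottom[of n a] card_zig_bottom[of "n + c" b] by simp
  qed
  then show ?thesis by blast
qed

section \<open>Factorial digits\<close>

text \<open>The digits of the Cantor expansion: \<open>frac x\<close> is the sum of
  \<open>fact_digit x k / fact (k + 1)\<close>, and \<open>frac (fact k * x)\<close> is the
  remainder left before digit \<open>k\<close>.\<close>

definition fact_digit :: "real \<Rightarrow> nat \<Rightarrow> int" where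
  "fact_digit x k = \<lfloor>real (Suc k) * frac (fact k * x)\<rfloor>"

lemma frac_fact_Suc:
  "frac (fact (Suc k) * x) = real (Suc k) * frac (fact k * x) - of_int (fact_digit x k)"
proof -
  have "fact (Suc k) * x = real (Suc k) * frac (fact k * x) + of_int (int (Suc k) * \<lfloor>fact k * x\<rfloor>)"
    by (simp add: frac_def algebra_simps)
  then have "frac (fact (Suc k) * x) = frac (real (Suc k) * frac (fact k * x))"
    by (simp only: frac_add_of_int_right)
  then show ?thesis by (simp add: frac_def fact_digit_def)
qed

lemma fact_digit_bounds: "0 \<le> fact_digit x k" "fact_digit x k \<le> int k"
proof -
  have "0 \<le> frac (fact k * x)" "frac (fact k * x) < 1" by (simp_all add: frac_lt_1)
  then have "real (Suc k) * frac (fact k * x) < real (Suc k) * 1"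
    by (intro mult_strict_left_mono) auto
  then have "fact_digit x k < int (Suc k)" unfolding fact_digit_def by (simp add: floor_less_iff)
  then show "0 \<le> fact_digit x k" "fact_digit x k \<le> int k"
    by (simp_all add: fact_digit_def)
qed

text \<open>The factors are at least 2 because \<open>1 \<le> K\<close>, so a nonzero value would
  outgrow the bound. Serves both for the distance of a remainder from 1 and for the difference of
  two remainders.\<close>

lemma factorial_growth_bounded_imp_zero:
  fixes \<delta> :: "nat \<Rightarrow> real"
  assumes step: "\<And>k. K \<le> k \<Longrightarrow> \<delta> (Suc k) = real (Suc k) * \<delta> k" and bd: "\<And>k. \<bar>\<delta> k\<bar> \<le> 1"
    and "1 \<le> K"
  shows "\<delta> K = 0"
proof (rule ccontr)
  assume nz: "\<delta> K \<noteq> 0"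
  have "2 ^ j * \<bar>\<delta> K\<bar> \<le> \<bar>\<delta> (K + j)\<bar>" for j
  proof (induction j)
    case (Suc j)
    have "2 ^ Suc j * \<bar>\<delta> K\<bar> \<le> 2 * \<bar>\<delta> (K + j)\<bar>" using Suc by simp
    also have "\<dots> \<le> real (Suc (K + j)) * \<bar>\<delta> (K + j)\<bar>" using assms(3) by (intro mult_right_mono) auto
    also have "\<dots> = \<bar>\<delta> (K + Suc j)\<bar>" using step[of "K + j"] by (simp add: abs_mult)
    finally show ?case .
  qed simp
  moreover obtain j where "1 / \<bar>\<delta> K\<bar> < 2 ^ j" using real_arch_pow[of 2 "1 / \<bar>\<delta> K\<bar>"] by auto
  then have "1 < 2 ^ j * \<bar>\<delta> K\<bar>" using nz by (simp add: field_simps)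
  ultimately show False using bd[of "K + j"] by (meson leD order_trans)
qed

text \<open>With maximal digits the distance of the remainder from 1 is multiplied by
  \<open>k + 1\<close> in each step and so would have to vanish, but a fractional part is less than
  1.\<close>

lemma fact_digit_not_eventually_maximal: "\<exists>k\<ge>K. fact_digit x k \<noteq> int k"
proof (rule ccontr)
  assume "\<not> ?thesis"
  then have d: "fact_digit x k = int k" if "k \<ge> K + 1" for k using that by auto
  have "1 - frac (fact (K + 1) * x) = 0"
  proof (rule factorial_growth_bounded_imp_zero[of "K + 1" "\<lambda>k. 1 - frac (fact k * x)"])
    fix k assume "K + 1 \<le> k"
    then show "1 - frac (fact (Suc k) * x) = real (Suc k) * (1 - frac (fact k * x))"
      unfolding frac_fact_Suc d[OF \<open>K + 1 \<le> k\<close>] by (simp add: algebra_simps)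
  next
    fix k show "\<bar>1 - frac (fact k * x)\<bar> \<le> 1"
      using frac_ge_0[of "fact k * x"] frac_lt_1[of "fact k * x"] by linarith
  qed simp
  then show False using frac_lt_1[of "fact (K + 1) * x"] by simp
qed

lemma fact_digits_eventually_eq_imp_rat:
  assumes "\<And>k. K \<le> k \<Longrightarrow> fact_digit x k = fact_digit y k"
  shows "x - y \<in> \<rat>"
proof -
  have "frac (fact (K + 1) * x) - frac (fact (K + 1) * y) = 0"
  proof (rule factorial_growth_bounded_imp_zero[of "K + 1" "\<lambda>k. frac (fact k * x) - frac (fact k * y)"])
    fix k assume "K + 1 \<le> k"
    then show "frac (fact (Suc k) * x) - frac (fact (Suc k) * y) =
        real (Suc k) * (frac (fact k * x) - frac (fact k * y))"
      using assms[of k] unfolding frac_fact_Suc by (simp add: algebra_simps)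
  next
    fix k show "\<bar>frac (fact k * x) - frac (fact k * y)\<bar> \<le> 1"
      using frac_ge_0[of "fact k * x"] frac_lt_1[of "fact k * x"]
        frac_ge_0[of "fact k * y"] frac_lt_1[of "fact k * y"] by linarith
  qed simp
  then have "fact (K + 1) * (x - y) = of_int (\<lfloor>fact (K + 1) * x\<rfloor> - \<lfloor>fact (K + 1) * y\<rfloor>)"
    by (simp only: frac_def right_diff_distrib of_int_diff)
  then have "x - y = of_int (\<lfloor>fact (K + 1) * x\<rfloor> - \<lfloor>fact (K + 1) * y\<rfloor>) / of_nat (fact (K + 1))"
    by (metis fact_nonzero nonzero_mult_div_cancel_left of_nat_fact)
  also have "\<dots> \<in> \<rat>" by (intro Rats_divide Rats_of_int Rats_of_nat)
  finally show ?thesis .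
qed

text \<open>Once \<open>k\<close> is at least the denominator \<open>q\<close>,
  \<open>fact k * (x - y)\<close> is an integer and the two remainders agree.\<close>

lemma rat_diff_imp_fact_digits_eventually_eq:
  assumes "x - y \<in> \<rat>"
  shows "\<exists>K. \<forall>k\<ge>K. fact_digit x k = fact_digit y k"
proof -
  obtain p q :: int where q: "q > 0" "x - y = of_int p / of_int q"
    using assms by (metis Rats_cases')
  have "fact_digit x k = fact_digit y k" if "k \<ge> nat q" for k
  proof -
    have "nat q dvd fact k" using that q by (intro dvd_fact) auto
    then have "int (nat q) dvd int (fact k)" by (simp only: int_dvd_int_iff)
    then have "q dvd fact k" using q by simp
    then obtain m where m: "fact k = q * m" by (auto elim: dvdE)
    have "(fact k :: real) = of_int (fact k)" by simp
    then have "fact k * (x - y) = of_int (m * p)" using m q by simp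
    then have "fact k * x = fact k * y + of_int (m * p)" by (simp add: algebra_simps)
    then have "frac (fact k * x) = frac (fact k * y)" by (simp only: frac_add_of_int_right)
    then show ?thesis by (simp add: fact_digit_def)
  qed
  then show ?thesis by blast
qed

text \<open>The same digits with the growing weights \<open>fact j\<close>: the residue modulo
  \<open>fact k\<close> of the profinite integer attached to \<open>x\<close>.\<close>

definition residue_at :: "real \<Rightarrow> nat \<Rightarrow> int" where
  "residue_at x k = (\<Sum>j<k. fact_digit x j * fact j)"

lemma residue_at_Suc: "residue_at x (Suc k) = residue_at x k + fact_digit x k * fact k"
  by (simp add: residue_at_def)

lemma residue_at_bounds: "0 \<le> residue_at x k" "residue_at x k < fact k"
proof -
  show "0 \<le> residue_at x k"
    unfolding residue_at_def by (intro sum_nonneg mult_nonneg_nonneg fact_digit_bounds) auto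
  show "residue_at x k < fact k"
  proof (induction k)
    case (Suc k)
    have "fact_digit x k * fact k \<le> int k * fact k"
      using fact_digit_bounds by (intro mult_right_mono) auto
    moreover have "(fact (Suc k) :: int) = fact k + int k * fact k" by (simp add: algebra_simps)
    ultimately show ?case using Suc unfolding residue_at_Suc by linarith
  qed (simp add: residue_at_def)
qed

text \<open>Compatibility of the residues, as in an inverse limit of the rings of integers modulo
  \<open>fact k\<close>.\<close>

lemma fact_dvd_residue_diff: "j \<le> k \<Longrightarrow> fact j dvd residue_at x k - residue_at x j"
proof (induction k rule: dec_induct)
  case (step k)
  have "(fact j :: int) dvd fact k" using step by (intro fact_dvd) auto
  then have "fact j dvd fact_digit x k * fact k" by simp
  with step show ?case by (simp add: residue_at_Suc) (metis add_diff_eq dvd_add add.commute)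
qed simp

text \<open>The value \<open>0\<close> marks the position equal to the profinite integer given by the residues; it
  occurs only for rational \<open>x\<close>.\<close>

definition ruler :: "real \<Rightarrow> int \<Rightarrow> nat" where
  "ruler x n = (if \<exists>k. \<not> fact k dvd n - residue_at x k
                then (LEAST k. \<not> fact k dvd n - residue_at x k) else 0)"

text \<open>By compatibility the moduli that pass the test form an initial segment. The least
  failing one is never 0, because \<open>fact 0 = 1\<close> divides everything; so the value 0 is
  free as a mark for "no failure".\<close>

lemma dvd_iff_ruler: "fact k dvd n - residue_at x k \<longleftrightarrow> ruler x n = 0 \<or> k < ruler x n"
proof (cases "\<exists>k. \<not> fact k dvd n - residue_at x k")
  case True
  define m where "m = (LEAST k. \<not> fact k dvd n - residue_at x k)"
  have m: "\<not> fact m dvd n - residue_at x m" unfolding m_def using True by (rule LeastI_ex)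
  have "m \<noteq> 0"
  proof
    assume "m = 0" then show False using m by simp
  qed
  have "fact k dvd n - residue_at x k" if "k < m" for k
    using not_less_Least[of k "\<lambda>k. \<not> fact k dvd n - residue_at x k"] that by (auto simp: m_def)
  moreover have "\<not> fact k dvd n - residue_at x k" if "m \<le> k" for k
  proof
    assume "fact k dvd n - residue_at x k"
    moreover have "(fact m :: int) dvd fact k" using that by (rule fact_dvd)
    ultimately have "fact m dvd (n - residue_at x k) + (residue_at x k - residue_at x m)"
      using fact_dvd_residue_diff[OF that] by (intro dvd_add) (auto intro: dvd_trans)
    then show False using m by simp
  qed
  ultimately have "fact k dvd n - residue_at x k \<longleftrightarrow> k < m" by (meson not_le)
  moreover have "ruler x n = m" using True by (simp add: ruler_def m_def)
  ultimately show ?thesis using \<open>m \<noteq> 0\<close> by simp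
qed (simp add: ruler_def)

text \<open>The shift makes the residues of \<open>y\<close> equal to those of \<open>x\<close> plus
  \<open>c\<close> modulo every factorial. As soon as one such sum does not overflow, none later
  does; then the congruences are equalities and the later digits agree.\<close>

lemma ruler_shift_nonneg_imp_rat:
  assumes sh: "\<And>n. ruler x n = ruler y (n + c)" and c: "0 \<le> c"
  shows "x - y \<in> \<rat>"
proof -
  \<comment> \<open>At \<open>n = residue_at x k\<close> the test for \<open>x\<close> holds
    trivially, so the test for \<open>y\<close> holds at \<open>n + c\<close>.\<close>
  have dv: "fact k dvd residue_at x k + c - residue_at y k" for k
    using dvd_iff_ruler[of k "residue_at x k" x] dvd_iff_ruler[of k "residue_at x k + c" y]
      sh[of "residue_at x k"] by simp
  have grow: "residue_at x (Suc k) + c < fact (Suc k)" if "residue_at x k + c < fact k" for k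
  proof -
    have "fact_digit x k * fact k \<le> int k * fact k"
      using fact_digit_bounds by (intro mult_right_mono) auto
    moreover have "(fact (Suc k) :: int) = fact k + int k * fact k" by (simp add: algebra_simps)
    ultimately show ?thesis using that unfolding residue_at_Suc by linarith
  qed
  have "\<exists>K. residue_at x K + c < fact K"
  proof (rule ccontr)
    assume "\<not> ?thesis"
    then have ge: "fact k \<le> residue_at x k + c" for k by (simp add: not_less)
    have "fact_digit x k = int k" if "k \<ge> nat c" for k
    proof (rule ccontr)
      assume "fact_digit x k \<noteq> int k"
      then have "fact_digit x k \<le> int k - 1" using fact_digit_bounds[of x k] by linarith
      \<comment> \<open>An overflow at \<open>k + 1\<close> despite a digit below the maximum would
        need \<open>residue_at x k + c >= 2 * fact k\<close>, which is too much for a residue below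
        \<open>fact k\<close> and \<open>c \<le> fact k\<close>.\<close>
      then have "fact_digit x k * fact k \<le> (int k - 1) * fact k" by (intro mult_right_mono) auto
      then have "2 * fact k \<le> residue_at x k + c"
        using ge[of "Suc k"] by (simp add: residue_at_Suc algebra_simps)
      moreover have "c \<le> fact k"
        using fact_ge_self[of k] that c by (metis int_nat_eq le_trans of_nat_fact of_nat_le_iff)
      ultimately show False using residue_at_bounds[of x k] by linarith
    qed
    then show False using fact_digit_not_eventually_maximal[of "nat c" x] by blast
  qed
  then obtain K where "residue_at x K + c < fact K" by blast
  have lt: "residue_at x k + c < fact k" if "k \<ge> K" for k
    using that
  proof (induction rule: dec_induct)
    case base show ?case by fact
  next
    case (step k) then show ?case using grow by blast
  qed
  have eq: "residue_at y k = residue_at x k + c" if "k \<ge> K" for k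
  proof -
    have "\<bar>residue_at x k + c - residue_at y k\<bar> < fact k"
      using lt[OF that] c residue_at_bounds[of x k] residue_at_bounds[of y k] by linarith
    then have "residue_at x k + c - residue_at y k = 0"
      using dvd_imp_le_int[OF _ dv[of k]] by (metis abs_of_nonneg fact_ge_zero not_le)
    then show ?thesis by simp
  qed
  show ?thesis
  proof (rule fact_digits_eventually_eq_imp_rat)
    fix k assume "K \<le> k"
    then show "fact_digit x k = fact_digit y k"
      using eq[of k] eq[of "Suc k"] by (simp add: residue_at_Suc)
  qed
qed

lemma ruler_shift_iff_rat: "(\<exists>c. \<forall>n. ruler x n = ruler y (n + c)) \<longleftrightarrow> x - y \<in> \<rat>"
proof
  assume "\<exists>c. \<forall>n. ruler x n = ruler y (n + c)"
  then obtain c where c: "\<And>n. ruler x n = ruler y (n + c)" by blast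
  show "x - y \<in> \<rat>"
  proof (cases "c \<ge> 0")
    case True
    then show ?thesis using ruler_shift_nonneg_imp_rat c by blast
  next
    case False
    \<comment> \<open>With a negative shift \<open>x\<close> and \<open>y\<close> exchange their
      roles.\<close>
    have "ruler y n = ruler x (n + - c)" for n using c[of "n - c"] by simp
    then have "y - x \<in> \<rat>" using False ruler_shift_nonneg_imp_rat[of y x "- c"] by simp
    then show ?thesis by (metis Rats_minus_iff minus_diff_eq)
  qed
next
  assume "x - y \<in> \<rat>"
  then obtain K where K: "\<And>k. k \<ge> K \<Longrightarrow> fact_digit x k = fact_digit y k"
    using rat_diff_imp_fact_digits_eventually_eq by blast
  \<comment> \<open>From \<open>K\<close> on equal digits are added on both sides, so the difference
    of the residues stays constant.\<close>
  define c where "c = residue_at y K - residue_at x K"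
  have eq: "residue_at y k = residue_at x k + c" if "k \<ge> K" for k
    using that by (induction k rule: dec_induct) (auto simp: c_def residue_at_Suc K)
  have "fact k dvd n - residue_at x k \<longleftrightarrow> fact k dvd n + c - residue_at y k" for k n
  proof (cases "k \<ge> K")
    case True then show ?thesis using eq by (simp add: algebra_simps)
  next
    case False
    \<comment> \<open>Below \<open>K\<close> the residues modulo \<open>fact k\<close> are replaced
      by those at \<open>K\<close>, where the shift by \<open>c\<close> is exact.\<close>
    then have "fact k dvd residue_at x K - residue_at x k" "fact k dvd residue_at y K - residue_at y k"
      by (auto intro: fact_dvd_residue_diff)
    from dvd_add_left_iff[OF this(1), of "n - residue_at x K"]
      dvd_add_left_iff[OF this(2), of "n + c - residue_at y K"]
    have "fact k dvd n - residue_at x k \<longleftrightarrow> fact k dvd n - residue_at x K"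
      "fact k dvd n + c - residue_at y k \<longleftrightarrow> fact k dvd n + c - residue_at y K"
      by (simp_all add: algebra_simps)
    then show ?thesis by (simp add: c_def algebra_simps)
  qed
  then have "ruler x n = ruler y (n + c)" for n
    by (simp add: ruler_def)
  then show "\<exists>c. \<forall>n. ruler x n = ruler y (n + c)" by blast
qed

lemma measurable_fact_digit: "(\<lambda>x. fact_digit x k) \<in> borel \<rightarrow>\<^sub>M count_space UNIV"
  unfolding fact_digit_def frac_def by measurable

lemma measurable_residue_at: "(\<lambda>x. residue_at x k) \<in> borel \<rightarrow>\<^sub>M count_space UNIV"
proof (induction k)
  case (Suc k)
  \<comment> \<open>The previous residue takes countably many values, and for each fixed value
    \<open>i\<close> only the new digit varies.\<close>
  have "(\<lambda>x. (\<lambda>i x. i + fact_digit x k * fact k) (residue_at x k) x) \<in> borel \<rightarrow>\<^sub>M count_space UNIV"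
    by (rule measurable_compose_countable[OF _ Suc])
      (rule measurable_compose[OF measurable_fact_digit], simp)
  then show ?case by (simp add: residue_at_Suc)
qed (simp add: residue_at_def)

lemma measurable_ruler: "(\<lambda>x. ruler x n) \<in> borel \<rightarrow>\<^sub>M count_space UNIV"
proof -
  have [measurable]: "Measurable.pred borel (\<lambda>x. fact k dvd n - residue_at x k)" for k
    using measurable_compose[OF measurable_residue_at[of k], of "\<lambda>r. fact k dvd n - r" "count_space UNIV"] by simp
  show ?thesis unfolding ruler_def by measurable
qed

section \<open>Compactifications of the line\<close>

lemma zig_shift:
  assumes "\<And>n. a n = b (n + c)"
  shows "zig b (x + of_int c) = zig a x + of_int c"
  using assms[of "\<lfloor>x\<rfloor>"] by (simp add: zig_def)

text \<open>A common frame for the interval and the circle: the line sits in \<open>Y\<close> as an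
  open dense set with coordinate \<open>\<kappa>\<close>. By \<open>vanish\<close>, points at
  bounded distance on the line become close in \<open>Y\<close> far out.\<close>

locale line_compactification =
  fixes Y :: "'a::metric_space set" and \<sigma> :: "real \<Rightarrow> 'a" and \<kappa> :: "'a \<Rightarrow> real"
  assumes compact_Y: "compact Y"
    and open_range: "openin (top_of_set Y) (range \<sigma>)"
    and dense_range: "Y \<subseteq> closure (range \<sigma>)"
    and \<kappa>_\<sigma> [simp]: "\<And>x. \<kappa> (\<sigma> x) = x"
    and cont_\<sigma>: "continuous_on UNIV \<sigma>"
    and cont_\<kappa>: "continuous_on (range \<sigma>) \<kappa>"
    and vanish: "\<And>C \<epsilon>. 0 < \<epsilon> \<Longrightarrow> \<exists>M. \<forall>x y. M \<le> \<bar>x\<bar> \<longrightarrow> \<bar>x - y\<bar> \<le> C \<longrightarrow> dist (\<sigma> x) (\<sigma> y) \<le> \<epsilon>"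
begin

lemma range_subset: "range \<sigma> \<subseteq> Y"
  using open_range by (rule openin_imp_subset)

lemma \<sigma>_in [simp]: "\<sigma> x \<in> Y"
  using range_subset by blast

lemma \<sigma>_eq_iff [simp]: "\<sigma> x = \<sigma> y \<longleftrightarrow> x = y"
  by (metis \<kappa>_\<sigma>)

text \<open>The end points stay fixed. The value \<open>undefined\<close> off \<open>Y\<close>
  yields the extensional representative that \<open>self_maps\<close> requires.\<close>

definition ext :: "(real \<Rightarrow> real) \<Rightarrow> 'a \<Rightarrow> 'a" where
  "ext F y = (if y \<in> range \<sigma> then \<sigma> (F (\<kappa> y)) else if y \<in> Y then y else undefined)"

lemma ext_\<sigma> [simp]: "ext F (\<sigma> x) = \<sigma> (F x)"
  by (simp add: ext_def)

lemma ext_end: "y \<in> Y \<Longrightarrow> y \<notin> range \<sigma> \<Longrightarrow> ext F y = y"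
  by (simp add: ext_def)

lemma ext_funpow_\<sigma> [simp]: "(ext F ^^ k) (\<sigma> x) = \<sigma> ((F ^^ k) x)"
  by (induction k) auto

lemma ext_in: "y \<in> Y \<Longrightarrow> ext F y \<in> Y"
  by (cases "y \<in> range \<sigma>") (auto simp: ext_end)

text \<open>On the line this is local, because the line is open in \<open>Y\<close>. Near an end
  point only coordinates outside a compact interval occur, and there \<open>vanish\<close> keeps
  each image close to its argument.\<close>

lemma continuous_on_ext:
  assumes F: "continuous_on UNIV F" and near: "\<And>x. \<bar>F x - x\<bar> \<le> C"
  shows "continuous_on Y (ext F)"
  unfolding continuous_on_eq_continuous_within
proof
  fix z assume z: "z \<in> Y"
  show "continuous (at z within Y) (ext F)"
  proof (cases "z \<in> range \<sigma>")
    case True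
    obtain W where W: "open W" "range \<sigma> = Y \<inter> W" using open_range by (auto simp: openin_open)
    have "continuous_on (range \<sigma>) (\<lambda>y. \<sigma> (F (\<kappa> y)))"
      by (intro continuous_on_compose2[OF cont_\<sigma>] continuous_on_compose2[OF F] cont_\<kappa>) auto
    then have "continuous_on (range \<sigma>) (ext F)"
      by (rule continuous_on_eq) (simp add: ext_def)
    then have "continuous (at z within (Y \<inter> W)) (ext F)"
      using True W(2) by (simp add: continuous_on_eq_continuous_within)
    moreover have "at z within (Y \<inter> W) = at z within Y"
      using W True by (intro at_within_nhd[of z W]) auto
    ultimately show ?thesis by simp
  next
    case False
    show ?thesis
      unfolding continuous_within_eps_delta
    proof (intro allI impI)
      fix \<epsilon> :: real assume "\<epsilon> > 0"
      then obtain M where M: "\<And>x y. M \<le> \<bar>x\<bar> \<Longrightarrow> \<bar>x - y\<bar> \<le> C \<Longrightarrow> dist (\<sigma> x) (\<sigma> y) \<le> \<epsilon> / 3"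
        using vanish[of "\<epsilon> / 3" C] by auto
      have "compact (\<sigma> ` {-M..M})"
        by (intro compact_continuous_image continuous_on_subset[OF cont_\<sigma>]) auto
      then have "open (- \<sigma> ` {-M..M})" by (simp add: compact_imp_closed open_Compl)
      moreover have "z \<in> - \<sigma> ` {-M..M}" using False by blast
      ultimately obtain d where d: "d > 0" "ball z d \<subseteq> - \<sigma> ` {-M..M}" by (rule openE)
      have "dist (ext F y) (ext F z) < \<epsilon>" if y: "y \<in> Y" "dist y z < min d (\<epsilon> / 3)" for y
      proof (cases "y \<in> range \<sigma>")
        case True
        then obtain x where x: "y = \<sigma> x" by blast
        have "x \<notin> {-M..M}" using d(2) y x by (auto simp: dist_commute subset_iff)
        then have "dist (\<sigma> x) (\<sigma> (F x)) \<le> \<epsilon> / 3"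
          using near[of x] by (intro M) (auto simp: abs_minus_commute)
        then have "dist (ext F y) y \<le> \<epsilon> / 3" by (simp add: x dist_commute)
        then have "dist (ext F y) z < \<epsilon>" using y \<open>\<epsilon> > 0\<close> dist_triangle[of "ext F y" z y] by auto
        then show ?thesis using False z by (simp add: ext_end)
      next
        case F: False
        then show ?thesis using False z y \<open>\<epsilon> > 0\<close> by (simp add: ext_end)
      qed
      then show "\<exists>d>0. \<forall>x'\<in>Y. dist x' z < d \<longrightarrow> dist (ext F x') (ext F z) < \<epsilon>"
        using d(1) \<open>\<epsilon> > 0\<close> by (intro exI[of _ "min d (\<epsilon> / 3)"]) auto
    qed
  qed
qed

lemma ext_in_self_maps:
  assumes "continuous_on UNIV F" "\<And>x. \<bar>F x - x\<bar> \<le> C"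
  shows "ext F \<in> mspace (self_maps Y)"
  using continuous_on_ext[OF assms] range_subset
  by (auto simp: mspace_self_maps compact_Y ext_in extensional_def) (auto simp: ext_def)

text \<open>Shrink the interval once per open set: by density the set contains a line point, some
  iterate of the current interval passes through it, and by continuity a whole subinterval is
  carried into the set.\<close>

lemma visit_all:
  fixes F :: "real \<Rightarrow> real"
  assumes F: "continuous_on UNIV F"
    and cover: "\<And>x y N. x < y \<Longrightarrow> \<exists>k>0. {-N..N} \<subseteq> (F ^^ k) ` {x..y}"
    and \<U>: "finite \<U>" "\<And>U. U \<in> \<U> \<Longrightarrow> openin (top_of_set Y) U \<and> U \<noteq> {}"
  shows "\<exists>x y. x < y \<and> (\<forall>U\<in>\<U>. \<exists>k. \<forall>z\<in>{x..y}. \<sigma> ((F ^^ k) z) \<in> U)"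
  using \<U>
proof (induction \<U> rule: finite_induct)
  case empty
  show ?case by (intro exI[of _ 0] exI[of _ 1]) auto
next
  case (insert U \<U>)
  then obtain x y where xy: "x < y" "\<forall>U\<in>\<U>. \<exists>k. \<forall>z\<in>{x..y}. \<sigma> ((F ^^ k) z) \<in> U" by blast
  obtain W where W: "open W" "U = Y \<inter> W" using insert.prems[of U] by (auto simp: openin_open)
  obtain u where "u \<in> Y" "u \<in> W" using insert.prems[of U] W by auto
  then obtain w where "\<sigma> w \<in> W"
    using dense_range open_Int_closure_eq_empty[OF W(1), of "range \<sigma>"] by blast
  obtain k where "{-\<bar>w\<bar>..\<bar>w\<bar>} \<subseteq> (F ^^ k) ` {x..y}" using cover[OF xy(1)] by blast
  moreover have "w \<in> {-\<bar>w\<bar>..\<bar>w\<bar>}" by auto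
  ultimately have "w \<in> (F ^^ k) ` {x..y}" by blast
  then obtain z where z: "z \<in> {x..y}" "(F ^^ k) z = w" by auto
  have "continuous_on UNIV (F ^^ k)"
    by (induction k) (auto intro: continuous_on_compose2[OF F] simp: id_def)
  then have "continuous_on UNIV (\<lambda>z. \<sigma> ((F ^^ k) z))"
    by (rule continuous_on_compose2[OF cont_\<sigma>]) auto
  then have "open ((\<lambda>z. \<sigma> ((F ^^ k) z)) -` W)" using W(1) by (rule open_vimage[rotated])
  moreover have "z \<in> (\<lambda>z. \<sigma> ((F ^^ k) z)) -` W" using z \<open>\<sigma> w \<in> W\<close> by simp
  ultimately obtain d where d: "d > 0" "ball z d \<subseteq> (\<lambda>z. \<sigma> ((F ^^ k) z)) -` W"
    by (meson openE)
  define x' y' where "x' = max x (z - d / 2)" and "y' = min y (z + d / 2)"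
  have sub: "{x'..y'} \<subseteq> {x..y}" "{x'..y'} \<subseteq> ball z d" "x' < y'"
    using z xy(1) d(1) by (auto simp: x'_def y'_def dist_real_def)
  have "\<exists>k. \<forall>z\<in>{x'..y'}. \<sigma> ((F ^^ k) z) \<in> V" if "V \<in> insert U \<U>" for V
  proof (cases "V = U")
    case True
    then show ?thesis using sub(2) d(2) W(2) by (intro exI[of _ k]) auto
  next
    case False
    then show ?thesis using that xy(2) sub(1) by (meson insertE subsetD)
  qed
  then show ?case using sub(3) by blast
qed

text \<open>All points of one short interval visit every member of the cover. Some iterate maps this
  interval over itself, and the intermediate value theorem gives a fixed point of that iterate in
  it.\<close>

lemma ext_chaotic:
  fixes F :: "real \<Rightarrow> real"
  assumes F: "continuous_on UNIV F" and near: "\<And>x. \<bar>F x - x\<bar> \<le> C"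
    and cover: "\<And>x y N. x < y \<Longrightarrow> \<exists>k>0. {-N..N} \<subseteq> (F ^^ k) ` {x..y}"
  shows "ext F \<in> chaotic_maps Y"
proof -
  have "dynamical_system (top_of_set Y) (ext F)"
    unfolding dynamical_system_def
    using compact_Y continuous_on_ext[OF F near] ext_in
    by (auto simp: compact_space_subtopology metrizable_space_subtopology metrizable_space_euclidean)
  moreover have "\<exists>x. periodic_point (top_of_set Y) (ext F) x \<and> (\<forall>U\<in>\<U>. \<exists>n. (ext F ^^ n) x \<in> U)"
    if fin: "finite \<U>" and op: "\<forall>U\<in>\<U>. openin (top_of_set Y) U \<and> U \<noteq> {}" for \<U>
  proof -
    obtain x y where xy: "x < y" "\<And>U. U\<in>\<U> \<Longrightarrow> \<exists>k. \<forall>z\<in>{x..y}. \<sigma> ((F ^^ k) z) \<in> U"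
      using visit_all[OF F cover fin] op by blast
    define N where "N = \<bar>x\<bar> + \<bar>y\<bar>"
    obtain k where k: "k > 0" "{-N..N} \<subseteq> (F ^^ k) ` {x..y}" using cover[OF xy(1)] by blast
    have "x \<in> {-N..N}" "y \<in> {-N..N}" by (auto simp: N_def)
    then have "x \<in> (F ^^ k) ` {x..y}" "y \<in> (F ^^ k) ` {x..y}" using k(2) by blast+
    \<comment> \<open>At these two points, which the iterate sends to the two ends, the displacement
      has opposite signs.\<close>
    then obtain u v where uv: "u \<in> {x..y}" "v \<in> {x..y}" "(F ^^ k) u = x" "(F ^^ k) v = y"
      unfolding image_iff by metis
    have "continuous_on UNIV (F ^^ k)"
      by (induction k) (auto intro: continuous_on_compose2[OF F] simp: id_def)
    then have "continuous_on {x..y} (\<lambda>w. (F ^^ k) w - w)"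
      by (intro continuous_intros) (rule continuous_on_subset, auto)
    then have "connected ((\<lambda>w. (F ^^ k) w - w) ` {x..y})"
      by (intro connected_continuous_image) auto
    then have "{(F ^^ k) u - u..(F ^^ k) v - v} \<subseteq> (\<lambda>w. (F ^^ k) w - w) ` {x..y}"
      by (rule connected_contains_Icc) (use uv in auto)
    moreover have "0 \<in> {(F ^^ k) u - u..(F ^^ k) v - v}" using uv by auto
    ultimately have "0 \<in> (\<lambda>w. (F ^^ k) w - w) ` {x..y}" by blast
    then obtain z where z: "z \<in> {x..y}" "(F ^^ k) z = z" by auto
    have "periodic_point (top_of_set Y) (ext F) (\<sigma> z)"
      using z k(1) by (auto simp: periodic_point_def)
    moreover have "\<exists>n. (ext F ^^ n) (\<sigma> z) \<in> U" if "U \<in> \<U>" for U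
      using xy(2)[OF that] z(1) by auto
    ultimately show ?thesis by blast
  qed
  ultimately have "chaotic (top_of_set Y) (ext F)" unfolding chaotic_def by blast
  then show ?thesis using ext_in_self_maps[OF F near] by (simp add: chaotic_maps_def)
qed

section \<open>Zigzag maps on the compactification\<close>

lemma ext_zig_chaotic: "\<forall>n. 1 \<le> a n \<Longrightarrow> ext (zig a) \<in> chaotic_maps Y"
  by (rule ext_chaotic[OF continuous_zig zig_near]) (rule zig_eventually_covers)

lemma ext_zig_conj_if_shift:
  assumes "\<And>n. a n = b (n + c)"
  shows "conjugate (top_of_set Y) (ext (zig a)) (top_of_set Y) (ext (zig b))"
proof -
  let ?h = "ext (\<lambda>x. x + of_int c)" and ?k = "ext (\<lambda>x. x - of_int c)"
  have "continuous_on Y ?h" "continuous_on Y ?k"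
    by (rule continuous_on_ext[of _ "\<bar>of_int c\<bar>"]; auto intro: continuous_intros)+
  moreover have "?k (?h y) = y" "?h (?k y) = y" if "y \<in> Y" for y
    using that by (cases "y \<in> range \<sigma>"; auto simp: ext_end)+
  ultimately have "homeomorphic_maps (top_of_set Y) (top_of_set Y) ?h ?k"
    by (auto simp: homeomorphic_maps_def ext_in)
  then have "homeomorphic_map (top_of_set Y) (top_of_set Y) ?h"
    by (rule homeomorphic_maps_imp_map)
  moreover have "?h (ext (zig a) y) = ext (zig b) (?h y)" if "y \<in> Y" for y
    using that zig_shift[of a b c, OF assms] by (cases "y \<in> range \<sigma>") (auto simp: ext_end)
  ultimately show ?thesis unfolding conjugate_def by (intro exI[of _ ?h]) simp
qed

text \<open>Describes the line inside \<open>Y\<close> by the dynamics alone, so that every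
  conjugacy must respect it. An end point has no preimage but itself.\<close>

lemma range_iff_two_preimages:
  assumes "\<forall>n. 1 \<le> a n" "y \<in> Y"
  shows "y \<in> range \<sigma> \<longleftrightarrow> (\<exists>u\<in>Y. \<exists>v\<in>Y. u \<noteq> v \<and> ext (zig a) u = y \<and> ext (zig a) v = y)"
proof
  assume "y \<in> range \<sigma>"
  then obtain x where x: "y = \<sigma> x" by blast
  define n where "n = \<lfloor>x\<rfloor>"
  have n: "of_int n \<le> x" "x \<le> of_int n + 1" unfolding n_def by linarith+
  \<comment> \<open>The cells \<open>n - 1\<close> and \<open>n + 1\<close> are disjoint, and the
    images of both contain \<open>[n, n + 1]\<close>.\<close>
  have "x \<in> zig a ` {of_int (n - 1)..of_int (n - 1) + 1}"
    using zig_cell_image[of a "n - 1"] assms(1) n by auto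
  then obtain u where u: "u \<le> of_int n" "zig a u = x" by auto
  have "x \<in> zig a ` {of_int (n + 1)..of_int (n + 1) + 1}"
    using zig_cell_image[of a "n + 1"] assms(1) n by auto
  then obtain v where v: "of_int n + 1 \<le> v" "zig a v = x" by auto
  have "\<sigma> u \<noteq> \<sigma> v" using u v by simp
  moreover have "ext (zig a) (\<sigma> u) = y" "ext (zig a) (\<sigma> v) = y" using u v x by simp_all
  ultimately show "\<exists>u\<in>Y. \<exists>v\<in>Y. u \<noteq> v \<and> ext (zig a) u = y \<and> ext (zig a) v = y"
    using \<sigma>_in by blast
next
  assume "\<exists>u\<in>Y. \<exists>v\<in>Y. u \<noteq> v \<and> ext (zig a) u = y \<and> ext (zig a) v = y"
  then obtain u v where uv: "u \<in> Y" "v \<in> Y" "u \<noteq> v" "ext (zig a) u = y" "ext (zig a) v = y" by blast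
  show "y \<in> range \<sigma>"
  proof (rule ccontr)
    assume no: "y \<notin> range \<sigma>"
    have "w = y" if "w \<in> Y" "ext (zig a) w = y" for w
      using that no by (cases "w \<in> range \<sigma>") (auto simp: ext_end)
    then show False using uv by blast
  qed
qed

text \<open>Counting preimages shows that \<open>h\<close> maps the line onto itself; in the
  coordinate \<open>\<kappa>\<close> it becomes a conjugacy of the two zigzags.\<close>

lemma ext_zig_conj_imp_shift:
  assumes pos: "\<forall>n. 1 \<le> a n" "\<forall>n. 1 \<le> b n"
    and conj: "conjugate (top_of_set Y) (ext (zig a)) (top_of_set Y) (ext (zig b))"
  shows "\<exists>c. \<forall>n. a n = b (n + c)"
proof -
  obtain h where h: "homeomorphic_map (top_of_set Y) (top_of_set Y) h"
    and hT: "\<And>y. y \<in> Y \<Longrightarrow> h (ext (zig a) y) = ext (zig b) (h y)"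
    using conj by (auto simp: conjugate_def)
  have inj: "inj_on h Y" and im: "h ` Y = Y" and cont: "continuous_on Y h"
    using h homeomorphic_imp_injective_map homeomorphic_imp_surjective_map homeomorphic_imp_continuous_map
    by fastforce+
  have hin: "h y \<in> Y" if "y \<in> Y" for y using im that by blast
  have iff: "h y \<in> range \<sigma> \<longleftrightarrow> y \<in> range \<sigma>" if y: "y \<in> Y" for y
  proof
    assume "y \<in> range \<sigma>"
    then obtain u v where "u \<in> Y" "v \<in> Y" "u \<noteq> v" "ext (zig a) u = y" "ext (zig a) v = y"
      using range_iff_two_preimages[OF pos(1) y] by blast
    then show "h y \<in> range \<sigma>"
      unfolding range_iff_two_preimages[OF pos(2) hin[OF y]] using hT[of u] hT[of v] hin inj_onD[OF inj, of u v]
      by metis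
  next
    assume "h y \<in> range \<sigma>"
    then obtain u v where uv: "u \<in> Y" "v \<in> Y" "u \<noteq> v" "ext (zig b) u = h y" "ext (zig b) v = h y"
      using range_iff_two_preimages[OF pos(2) hin[OF y]] by blast
    obtain u' v' where "u' \<in> Y" "v' \<in> Y" "h u' = u" "h v' = v" using uv im by (metis imageE)
    note uv' = this
    have "h (ext (zig a) u') = h y" "h (ext (zig a) v') = h y"
      using uv(4,5) hT[OF uv'(1)] hT[OF uv'(2)] uv'(3,4) by simp_all
    then have "ext (zig a) u' = y" "ext (zig a) v' = y"
      by (auto intro: inj_onD[OF inj _ ext_in[OF uv'(1)] y] inj_onD[OF inj _ ext_in[OF uv'(2)] y])
    moreover have "u' \<noteq> v'" using uv(3) uv'(3,4) by blast
    ultimately show "y \<in> range \<sigma>"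
      unfolding range_iff_two_preimages[OF pos(1) y]
      by - (rule bexI[OF _ uv'(1)], rule bexI[OF _ uv'(2)], simp)
  qed
  define g where "g x = \<kappa> (h (\<sigma> x))" for x
  have \<sigma>g: "\<sigma> (g x) = h (\<sigma> x)" for x
    using iff[of "\<sigma> x"] by (auto simp: g_def)
  have "continuous_on UNIV (\<lambda>x. h (\<sigma> x))"
    by (rule continuous_on_compose2[OF cont cont_\<sigma>]) auto
  then have "continuous_on UNIV g"
    unfolding g_def by (rule continuous_on_compose2[OF cont_\<kappa>]) (auto simp flip: \<sigma>g)
  moreover have "bij g"
  proof (rule bijI)
    show "inj g"
    proof (rule injI)
      fix x y assume "g x = g y"
      then have "h (\<sigma> x) = h (\<sigma> y)" using \<sigma>g by metis
      then show "x = y" using inj by (auto dest: inj_onD)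
    qed
    show "surj g"
      unfolding surj_def
    proof
      fix z
      obtain y where y: "y \<in> Y" "h y = \<sigma> z" using im \<sigma>_in by (metis imageE)
      then have "y \<in> range \<sigma>" using iff by auto
      then obtain x where "y = \<sigma> x" by blast
      then have "z = g x" using y by (simp add: g_def)
      then show "\<exists>x. z = g x" by blast
    qed
  qed
  moreover have "g (zig a x) = zig b (g x)" for x
  proof -
    have "\<sigma> (g (zig a x)) = h (ext (zig a) (\<sigma> x))" by (simp add: \<sigma>g)
    also have "\<dots> = ext (zig b) (\<sigma> (g x))" by (simp only: hT \<sigma>_in \<sigma>g)
    finally have "\<sigma> (g (zig a x)) = \<sigma> (zig b (g x))" by simp
    then show ?thesis by simp
  qed
  ultimately show ?thesis by (rule zig_conj_shift)
qed

text \<open>Far out both maps stay within 2 of the identity, so they differ by at most 4 on the line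
  and by little in \<open>Y\<close>, whatever the sequences are.\<close>

lemma ext_zig_dist_small:
  assumes "\<epsilon> > 0"
  shows "\<exists>N::int. \<forall>a b. (\<forall>n\<in>{-N..N}. a n = b n) \<longrightarrow> (\<forall>y\<in>Y. dist (ext (zig a) y) (ext (zig b) y) \<le> \<epsilon>)"
proof -
  obtain M where M: "\<And>x y. M \<le> \<bar>x\<bar> \<Longrightarrow> \<bar>x - y\<bar> \<le> 4 \<Longrightarrow> dist (\<sigma> x) (\<sigma> y) \<le> \<epsilon>"
    using vanish[OF assms, of 4] by auto
  \<comment> \<open>The margin 3 makes \<open>\<bar>x\<bar> >= M + 2\<close> outside the listed
    cells, so that the value of the zigzag still satisfies the bound \<open>M\<close>.\<close>
  define N where "N = \<lceil>\<bar>M\<bar> + 3\<rceil>"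
  have "dist (ext (zig a) y) (ext (zig b) y) \<le> \<epsilon>" if ab: "\<forall>n\<in>{-N..N}. a n = b n" and "y \<in> Y" for a b y
  proof (cases "y \<in> range \<sigma>")
    case True
    then obtain x where x: "y = \<sigma> x" by blast
    show ?thesis
    proof (cases "\<lfloor>x\<rfloor> \<in> {-N..N}")
      case True
      then have "zig a x = zig b x" using ab by (simp add: zig_def)
      then show ?thesis using assms x by simp
    next
      case False
      then have "\<bar>x\<bar> \<ge> M + 2" unfolding N_def by auto linarith+
      then have "M \<le> \<bar>zig a x\<bar>" "\<bar>zig a x - zig b x\<bar> \<le> 4"
        using zig_near[of a x] zig_near[of b x] by linarith+
      then show ?thesis using M x by simp
    qed
  next
    case False
    then show ?thesis using \<open>y \<in> Y\<close> assms by (simp add: ext_end)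
  qed
  then show ?thesis by blast
qed

text \<open>A map in an open set is kept there by finitely many entries of its sequence. Hence the
  preimage of the set is a countable union of events that prescribe a finite pattern.\<close>

lemma measurable_ext_zig:
  fixes \<alpha> :: "'b \<Rightarrow> int \<Rightarrow> nat"
  assumes \<alpha>: "\<And>n. (\<lambda>x. \<alpha> x n) \<in> M \<rightarrow>\<^sub>M count_space UNIV" and pos: "\<And>x. \<forall>n. 1 \<le> \<alpha> x n"
  shows "(\<lambda>x. ext (zig (\<alpha> x))) \<in> M \<rightarrow>\<^sub>M chaotic_maps_borel Y"
  unfolding chaotic_maps_borel_def
proof (rule measurable_restrict_space2)
  show "(\<lambda>x. ext (zig (\<alpha> x))) \<in> space M \<rightarrow> chaotic_maps Y" using ext_zig_chaotic[OF pos] by auto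
  have Y: "Y \<noteq> {}" using \<sigma>_in by blast
  have pattern: "{x \<in> space M. map (\<alpha> x) ns = l} \<in> sets M" for ns l
  proof (induction ns arbitrary: l)
    case (Cons n ns)
    show ?case
    proof (cases l)
      case (Cons m l')
      have "{x \<in> space M. map (\<alpha> x) (n # ns) = l} =
          ((\<lambda>x. \<alpha> x n) -` {m} \<inter> space M) \<inter> {x \<in> space M. map (\<alpha> x) ns = l'}"
        using Cons by auto
      also have "\<dots> \<in> sets M" by (intro sets.Int Cons.IH measurable_sets[OF \<alpha>]) auto
      finally show ?thesis .
    qed simp
  qed (cases "l = []", auto)
  show "(\<lambda>x. ext (zig (\<alpha> x))) \<in> M \<rightarrow>\<^sub>M sigma (mspace (self_maps Y)) {U. openin (mtopology_of (self_maps Y)) U}"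
  proof (rule measurable_measure_of)
    show "{U. openin (mtopology_of (self_maps Y)) U} \<subseteq> Pow (mspace (self_maps Y))"
      using openin_subset by fastforce
    have mem: "ext (zig a) \<in> mspace (self_maps Y)" for a
      by (rule ext_in_self_maps[OF continuous_zig zig_near])
    then show "(\<lambda>x. ext (zig (\<alpha> x))) \<in> space M \<rightarrow> mspace (self_maps Y)" by auto
    fix U assume "U \<in> {U. openin (mtopology_of (self_maps Y)) U}"
    then have U: "openin (Metric_space.mtopology (mspace (self_maps Y)) (mdist (self_maps Y))) U"
      by (simp add: mtopology_of_def)
    interpret D: Metric_space "mspace (self_maps Y)" "mdist (self_maps Y)" by simp
    define pat where "pat N x = map (\<alpha> x) [-N..N]" for N x
    \<comment> \<open>A pattern is good if it alone forces membership in \<open>U\<close>.\<close>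
    define good where "good N l \<longleftrightarrow> (\<forall>x. pat N x = l \<longrightarrow> ext (zig (\<alpha> x)) \<in> U)" for N l
    have "\<exists>N. good N (pat N x)" if inU: "ext (zig (\<alpha> x)) \<in> U" for x
    proof -
      obtain r where r: "r > 0" "D.mball (ext (zig (\<alpha> x))) r \<subseteq> U"
        using U inU unfolding D.openin_mtopology by blast
      obtain N where N: "\<And>a b y. (\<forall>n\<in>{-N..N}. a n = b n) \<Longrightarrow> y \<in> Y \<Longrightarrow> dist (ext (zig a) y) (ext (zig b) y) \<le> r / 2"
        using ext_zig_dist_small[of "r / 2"] r(1) half_gt_zero by blast
      have "ext (zig (\<alpha> x')) \<in> U" if "pat N x' = pat N x" for x'
      proof -
        have "\<forall>n\<in>{-N..N}. \<alpha> x n = \<alpha> x' n" using that by (auto simp: pat_def)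
        then have "mdist (self_maps Y) (ext (zig (\<alpha> x))) (ext (zig (\<alpha> x'))) \<le> r / 2"
          unfolding mdist_self_maps_le[OF Y mem mem] using N by blast
        then have "ext (zig (\<alpha> x')) \<in> D.mball (ext (zig (\<alpha> x))) r"
          using r(1) mem by (simp add: D.in_mball)
        then show ?thesis using r(2) by blast
      qed
      then show ?thesis unfolding good_def by blast
    qed
    note ex_good = this
    have "(\<lambda>x. ext (zig (\<alpha> x))) -` U \<inter> space M =
        (\<Union>N. \<Union>l\<in>{l. good N l}. {x \<in> space M. pat N x = l})" (is "?L = ?R")
    proof
      show "?L \<subseteq> ?R"
      proof
        fix x assume "x \<in> ?L"
        then obtain N where "good N (pat N x)" "x \<in> space M" using ex_good[of x] by auto
        then show "x \<in> ?R" by blast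
      qed
      show "?R \<subseteq> ?L"
      proof
        fix x assume "x \<in> ?R"
        then obtain N where "good N (pat N x)" "x \<in> space M" by blast
        then show "x \<in> ?L" unfolding good_def by simp
      qed
    qed
    also have "\<dots> \<in> sets M"
      unfolding pat_def by (intro sets.countable_UN'' countableI_type pattern)
    finally show "(\<lambda>x. ext (zig (\<alpha> x))) -` U \<inter> space M \<in> sets M" .
  qed
qed

theorem vitali_reducible:
  "borel_reducible borel vitali_rel (chaotic_maps_borel Y) (chaotic_conjugacy Y)"
  unfolding borel_reducible_def
proof (rule bexI, intro ballI)
  \<comment> \<open>\<open>ruler\<close> may take the value 0, whereas the zigzag must have at least
    one bottom in each cell.\<close>
  define \<alpha> where "\<alpha> x n = Suc (ruler x n)" for x n
  have pos: "\<forall>n. 1 \<le> \<alpha> x n" for x by (simp add: \<alpha>_def)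
  have "(\<lambda>x. \<alpha> x n) \<in> borel \<rightarrow>\<^sub>M count_space UNIV" for n
    unfolding \<alpha>_def by (rule measurable_compose[OF measurable_ruler]) simp
  then show "(\<lambda>x. ext (zig (\<alpha> x))) \<in> borel \<rightarrow>\<^sub>M chaotic_maps_borel Y"
    using pos by (rule measurable_ext_zig)
  fix x y :: real
  have "(x, y) \<in> vitali_rel \<longleftrightarrow> (\<exists>c. \<forall>n. \<alpha> x n = \<alpha> y (n + c))"
    by (simp add: vitali_rel_def \<alpha>_def ruler_shift_iff_rat)
  also have "\<dots> \<longleftrightarrow> conjugate (top_of_set Y) (ext (zig (\<alpha> x))) (top_of_set Y) (ext (zig (\<alpha> y)))"
  proof
    assume "\<exists>c. \<forall>n. \<alpha> x n = \<alpha> y (n + c)"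
    then obtain c where "\<And>n. \<alpha> x n = \<alpha> y (n + c)" by blast
    then show "conjugate (top_of_set Y) (ext (zig (\<alpha> x))) (top_of_set Y) (ext (zig (\<alpha> y)))"
      by (rule ext_zig_conj_if_shift)
  qed (rule ext_zig_conj_imp_shift[OF pos pos])
  finally show "(x, y) \<in> vitali_rel \<longleftrightarrow> (ext (zig (\<alpha> x)), ext (zig (\<alpha> y))) \<in> chaotic_conjugacy Y"
    using ext_zig_chaotic[OF pos] unfolding chaotic_conjugacy_def by simp
qed

end

section \<open>The interval and the circle as compactified lines\<close>

lemma squash_Lipschitz:
  fixes x y :: real
  shows "\<bar>x / (1 + \<bar>x\<bar>) - y / (1 + \<bar>y\<bar>)\<bar> \<le> 2 * \<bar>x - y\<bar> / (1 + \<bar>x\<bar>)"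
proof -
  have p: "1 + \<bar>x\<bar> > 0" "1 + \<bar>y\<bar> > 0" by auto
  have "x / (1 + \<bar>x\<bar>) - y / (1 + \<bar>y\<bar>) = (x - y + (x - y) * \<bar>y\<bar> + y * (\<bar>y\<bar> - \<bar>x\<bar>)) / ((1 + \<bar>x\<bar>) * (1 + \<bar>y\<bar>))"
    using p by (simp add: field_simps)
  also have "\<bar>\<dots>\<bar> = \<bar>x - y + (x - y) * \<bar>y\<bar> + y * (\<bar>y\<bar> - \<bar>x\<bar>)\<bar> / ((1 + \<bar>x\<bar>) * (1 + \<bar>y\<bar>))"
    using p by (simp add: abs_mult)
  also have "\<dots> \<le> (\<bar>x - y\<bar> + \<bar>x - y\<bar> * \<bar>y\<bar> + \<bar>y\<bar> * \<bar>x - y\<bar>) / ((1 + \<bar>x\<bar>) * (1 + \<bar>y\<bar>))"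
  proof (rule divide_right_mono)
    have "\<bar>y * (\<bar>y\<bar> - \<bar>x\<bar>)\<bar> \<le> \<bar>y\<bar> * \<bar>x - y\<bar>"
      unfolding abs_mult by (intro mult_left_mono) auto
    then show "\<bar>x - y + (x - y) * \<bar>y\<bar> + y * (\<bar>y\<bar> - \<bar>x\<bar>)\<bar> \<le> \<bar>x - y\<bar> + \<bar>x - y\<bar> * \<bar>y\<bar> + \<bar>y\<bar> * \<bar>x - y\<bar>"
      using abs_triangle_ineq[of "x - y + (x - y) * \<bar>y\<bar>" "y * (\<bar>y\<bar> - \<bar>x\<bar>)"]
        abs_triangle_ineq[of "x - y" "(x - y) * \<bar>y\<bar>"] abs_mult[of "x - y" "\<bar>y\<bar>"]
      unfolding abs_abs by linarith
  qed (use p in auto)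
  also have "\<dots> \<le> (2 * \<bar>x - y\<bar> * (1 + \<bar>y\<bar>)) / ((1 + \<bar>x\<bar>) * (1 + \<bar>y\<bar>))"
    using p by (intro divide_right_mono) (auto simp: algebra_simps)
  also have "\<dots> = 2 * \<bar>x - y\<bar> / (1 + \<bar>x\<bar>)" using p by simp
  finally show ?thesis .
qed

text \<open>Common last step for \<open>vanish\<close>: in both cases the distance in
  \<open>Y\<close> is bounded by \<open>K * \<bar>x - y\<bar> / t\<close> with \<open>t\<close> at
  least \<open>\<bar>x\<bar>\<close>.\<close>

lemma large_denominator:
  fixes \<epsilon> C K :: real assumes "\<epsilon> > 0" "K \<ge> 0"
  shows "\<exists>M. \<forall>x y t. M \<le> \<bar>x\<bar> \<longrightarrow> \<bar>x - y\<bar> \<le> C \<longrightarrow> \<bar>x\<bar> \<le> t \<longrightarrow> 0 < t \<longrightarrow> K * \<bar>x - y\<bar> / t \<le> \<epsilon>"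
proof -
  have "K * \<bar>x - y\<bar> / t \<le> \<epsilon>" if "K * \<bar>C\<bar> / \<epsilon> \<le> \<bar>x\<bar>" "\<bar>x - y\<bar> \<le> C" "\<bar>x\<bar> \<le> t" "0 < t" for x y t :: real
  proof -
    have "K * \<bar>x - y\<bar> \<le> K * \<bar>C\<bar>" using that assms by (intro mult_left_mono) auto
    also have "\<dots> \<le> t * \<epsilon>"
    proof -
      have "K * \<bar>C\<bar> / \<epsilon> \<le> t" using that by linarith
      then show ?thesis using assms(1) by (simp add: field_simps)
    qed
    finally show ?thesis using that(4) by (simp add: field_simps)
  qed
  then show ?thesis by blast
qed

lemma line_compactification_interval:
  "line_compactification {0..1::real} (\<lambda>x. (1 + x / (1 + \<bar>x\<bar>)) / 2) (\<lambda>s. (2 * s - 1) / (1 - \<bar>2 * s - 1\<bar>))"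
    (is "line_compactification _ ?\<sigma> ?\<kappa>")
proof
  have p: "1 + \<bar>x\<bar> > 0" for x :: real by auto
  have range: "range ?\<sigma> = {0<..<1}"
  proof (intro set_eqI iffI)
    fix s assume "s \<in> range ?\<sigma>"
    then obtain x where x: "s = ?\<sigma> x" by blast
    have "\<bar>x / (1 + \<bar>x\<bar>)\<bar> < 1" using p[of x] by (simp add: abs_divide)
    then have "-1 < x / (1 + \<bar>x\<bar>)" "x / (1 + \<bar>x\<bar>) < 1" by linarith+
    then show "s \<in> {0<..<1}" unfolding x by simp
  next
    fix s :: real assume s: "s \<in> {0<..<1}"
    define u where "u = 2 * s - 1"
    have u: "\<bar>u\<bar> < 1" using s by (auto simp: u_def)
    define v where "v = u / (1 - \<bar>u\<bar>)"
    have "\<bar>v\<bar> = \<bar>u\<bar> / (1 - \<bar>u\<bar>)" using u by (simp add: v_def abs_divide)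
    then have "1 + \<bar>v\<bar> = 1 / (1 - \<bar>u\<bar>)"
      using u add_divide_distrib[of "1 - \<bar>u\<bar>" "\<bar>u\<bar>" "1 - \<bar>u\<bar>"] by simp
    moreover have "v / (1 / (1 - \<bar>u\<bar>)) = u" using u by (simp add: v_def)
    ultimately have "v / (1 + \<bar>v\<bar>) = u" by (simp only:)
    then have "?\<sigma> v = (1 + u) / 2" by (simp only:)
    also have "\<dots> = s" by (simp add: u_def)
    finally have "s = ?\<sigma> v" by simp
    then show "s \<in> range ?\<sigma>" by (rule image_eqI) simp
  qed
  show "compact {0..1::real}" by simp
  show "openin (top_of_set {0..1}) (range ?\<sigma>)"
    unfolding range by (rule open_subset) auto
  show "{0..1} \<subseteq> closure (range ?\<sigma>)" unfolding range by simp
  show "?\<kappa> (?\<sigma> x) = x" for x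
  proof -
    define q where "q = x / (1 + \<bar>x\<bar>)"
    have "2 * ((1 + q) / 2) - 1 = q" by (simp add: add_divide_distrib)
    moreover have "\<bar>q\<bar> = \<bar>x\<bar> / (1 + \<bar>x\<bar>)" by (simp add: q_def abs_divide)
    then have "1 - \<bar>q\<bar> = 1 / (1 + \<bar>x\<bar>)"
      using p[of x] diff_divide_distrib[of "1 + \<bar>x\<bar>" "\<bar>x\<bar>" "1 + \<bar>x\<bar>"] by simp
    moreover have "q / (1 / (1 + \<bar>x\<bar>)) = x" using p[of x] by (simp add: q_def)
    ultimately show ?thesis by (simp only: flip: q_def)
  qed
  show "continuous_on UNIV ?\<sigma>"
    by (intro continuous_intros) (use p in \<open>auto simp: less_imp_neq[symmetric] add_nonneg_eq_0_iff\<close>)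
  show "continuous_on (range ?\<sigma>) ?\<kappa>"
    unfolding range by (intro continuous_intros) auto
  fix C \<epsilon> :: real assume "\<epsilon> > 0"
  then obtain M where M: "\<And>x y t. M \<le> \<bar>x\<bar> \<Longrightarrow> \<bar>x - y\<bar> \<le> C \<Longrightarrow> \<bar>x\<bar> \<le> t \<Longrightarrow> 0 < t \<Longrightarrow> 1 * \<bar>x - y\<bar> / t \<le> \<epsilon>"
    using large_denominator[of \<epsilon> 1 C] by auto
  have "dist (?\<sigma> x) (?\<sigma> y) \<le> \<epsilon>" if "M \<le> \<bar>x\<bar>" "\<bar>x - y\<bar> \<le> C" for x y
  proof -
    have "(1 + q) / 2 - (1 + r) / 2 = (q - r) / 2" for q r :: real by (simp add: field_simps)
    then have "dist (?\<sigma> x) (?\<sigma> y) = \<bar>x / (1 + \<bar>x\<bar>) - y / (1 + \<bar>y\<bar>)\<bar> / 2"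
      by (simp only: dist_real_def abs_divide)
    also have "\<dots> \<le> \<bar>x - y\<bar> / (1 + \<bar>x\<bar>)"
      using squash_Lipschitz[of x y] times_divide_eq_right[of 2 "\<bar>x - y\<bar>" "1 + \<bar>x\<bar>"] by linarith
    also have "\<dots> \<le> \<epsilon>" using M[OF that, of "1 + \<bar>x\<bar>"] p by simp
    finally show ?thesis .
  qed
  then show "\<exists>M. \<forall>x y. M \<le> \<bar>x\<bar> \<longrightarrow> \<bar>x - y\<bar> \<le> C \<longrightarrow> dist (?\<sigma> x) (?\<sigma> y) \<le> \<epsilon>" by blast
qed

text \<open>The Cayley transform and its inverse; the added point is 1. \<open>Re\<close> only turns
  a complex number that is real on the circle into a value of type \<open>real\<close>.\<close>

lemma line_compactification_circle:
  "line_compactification (sphere (0::complex) 1) (\<lambda>x. (of_real x + \<i>) / (of_real x - \<i>)) (\<lambda>w. Re (\<i> * (w + 1) / (w - 1)))"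
    (is "line_compactification _ ?\<sigma> ?\<kappa>")
proof
  have nz: "of_real x - \<i> \<noteq> 0" "of_real x + \<i> \<noteq> 0" for x :: real by (auto simp: complex_eq_iff)
  have \<sigma>1: "?\<sigma> x - 1 = 2 * \<i> / (of_real x - \<i>)" for x using nz(1)[of x] by (simp add: field_simps)
  have inv: "\<i> * (?\<sigma> x + 1) / (?\<sigma> x - 1) = of_real x" for x
  proof -
    have "?\<sigma> x + 1 = 2 * of_real x / (of_real x - \<i>)" using nz(1)[of x] by (simp add: field_simps)
    then show ?thesis unfolding \<sigma>1 using nz(1)[of x] by simp
  qed
  have norm_eq: "norm (of_real x + \<i>) = norm (of_real x - \<i>)" for x :: real
    by (simp add: cmod_def)
  have range: "range ?\<sigma> = sphere 0 1 - {1}"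
  proof (intro set_eqI iffI)
    fix w assume "w \<in> range ?\<sigma>"
    then obtain x where x: "w = ?\<sigma> x" by blast
    have "norm w = 1" using norm_eq[of x] nz(1)[of x] by (simp add: x norm_divide)
    moreover have "w \<noteq> 1" using \<sigma>1[of x] nz(1)[of x] unfolding x by auto
    ultimately show "w \<in> sphere 0 1 - {1}" by simp
  next
    fix w :: complex assume w: "w \<in> sphere 0 1 - {1}"
    define z where "z = \<i> * (w + 1) / (w - 1)"
    have w01: "w \<noteq> 0" "w \<noteq> 1" using w by auto
    \<comment> \<open>On the circle conjugation is inversion, and this turns the formula for
      \<open>z\<close> into \<open>cnj z = z\<close>.\<close>
    have "w * cnj w = 1" using w complex_norm_square[of w] by simp
    then have "cnj w = 1 / w" using w01 by (simp add: field_simps)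
    then have "cnj z = - \<i> * (1 / w + 1) / (1 / w - 1)" by (simp add: z_def)
    moreover have "1 / w + 1 = (1 + w) / w" "1 / w - 1 = (1 - w) / w"
      using w01 by (simp_all add: field_simps)
    ultimately have "cnj z * (1 - w) = - \<i> * (1 + w)" using w01 by simp
    then have "cnj z * (w - 1) = \<i> * (w + 1)" by (simp add: algebra_simps)
    also have "\<dots> = z * (w - 1)" using w01 by (simp add: z_def)
    finally have "cnj z = z" using w01 by simp
    then have z: "z = of_real (Re z)" by (simp add: complex_eq_iff)
    have "?\<sigma> (Re z) = (z + \<i>) / (z - \<i>)" using z by simp
    also have "z + \<i> = 2 * \<i> * w / (w - 1)" using w01 unfolding z_def by (simp add: field_simps)
    also have "z - \<i> = 2 * \<i> / (w - 1)" using w01 unfolding z_def by (simp add: field_simps)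
    also have "2 * \<i> * w / (w - 1) / (2 * \<i> / (w - 1)) = w" using w01 by simp
    finally have "w = ?\<sigma> (Re z)" by simp
    then show "w \<in> range ?\<sigma>" by (rule image_eqI) simp
  qed
  show "compact (sphere (0::complex) 1)" by simp
  show "openin (top_of_set (sphere 0 1)) (range ?\<sigma>)"
    unfolding range Diff_eq by (rule openin_open_Int) (simp add: open_Compl)
  show "sphere 0 1 \<subseteq> closure (range ?\<sigma>)"
  proof
    fix w :: complex assume w: "w \<in> sphere 0 1"
    show "w \<in> closure (range ?\<sigma>)"
    proof (cases "w = 1")
      case True
      have "(\<lambda>n. ?\<sigma> (real n)) \<longlonglongrightarrow> 1"
      proof (rule Lim_null[THEN iffD2], rule Lim_null_comparison)
        show "(\<lambda>n. 2 / real n) \<longlonglongrightarrow> 0" by (rule lim_const_over_n)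
        have "norm (?\<sigma> (real n) - 1) \<le> 2 / real n" if "n \<ge> 1" for n
        proof -
          have "real n \<le> norm (of_real (real n) - \<i>)"
            using abs_Re_le_cmod[of "of_real (real n) - \<i>"] by simp
          then show ?thesis unfolding \<sigma>1 norm_divide norm_mult using that
            by (simp add: frac_le)
        qed
        then show "\<forall>\<^sub>F n in sequentially. norm (?\<sigma> (real n) - 1) \<le> 2 / real n"
          by (auto simp: eventually_sequentially)
      qed
      then show ?thesis
        unfolding True closure_sequential by (intro exI[of _ "\<lambda>n. ?\<sigma> (real n)"] conjI allI rangeI)
    next
      case False
      then show ?thesis using w closure_subset[of "range ?\<sigma>"] unfolding range by blast
    qed
  qed
  show "?\<kappa> (?\<sigma> x) = x" for x unfolding inv by simp
  show "continuous_on UNIV ?\<sigma>" by (intro continuous_intros) (use nz in auto)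
  show "continuous_on (range ?\<sigma>) ?\<kappa>"
    unfolding range by (intro continuous_intros) auto
  fix C \<epsilon> :: real assume "\<epsilon> > 0"
  then obtain M where M: "\<And>x y t. M \<le> \<bar>x\<bar> \<Longrightarrow> \<bar>x - y\<bar> \<le> C \<Longrightarrow> \<bar>x\<bar> \<le> t \<Longrightarrow> 0 < t \<Longrightarrow> 2 * \<bar>x - y\<bar> / t \<le> \<epsilon>"
    using large_denominator[of \<epsilon> 2 C] by auto
  have "dist (?\<sigma> x) (?\<sigma> y) \<le> \<epsilon>" if "M \<le> \<bar>x\<bar>" "\<bar>x - y\<bar> \<le> C" for x y
  proof -
    have "?\<sigma> x - ?\<sigma> y = 2 * \<i> * of_real (y - x) / ((of_real x - \<i>) * (of_real y - \<i>))"
      using nz(1)[of x] nz(1)[of y] by (simp add: field_simps)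
    then have "dist (?\<sigma> x) (?\<sigma> y) = 2 * \<bar>x - y\<bar> / (norm (of_real x - \<i>) * norm (of_real y - \<i>))"
      by (simp only: dist_norm norm_divide norm_mult norm_of_real) (simp add: abs_minus_commute)
    also have "\<dots> \<le> 2 * \<bar>x - y\<bar> / (norm (of_real x - \<i>) * 1)"
    proof (rule divide_left_mono)
      have "norm (of_real y - \<i>) \<ge> \<bar>Im (of_real y - \<i>)\<bar>" by (rule abs_Im_le_cmod)
      then show "norm (of_real x - \<i>) * 1 \<le> norm (of_real x - \<i>) * norm (of_real y - \<i>)"
        by (intro mult_left_mono) auto
    qed (use nz in auto)
    also have "\<dots> \<le> \<epsilon>"
      using M[OF that, of "norm (of_real x - \<i>)"] nz(1)[of x] abs_Re_le_cmod[of "of_real x - \<i>"] by simp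
    finally show ?thesis .
  qed
  then show "\<exists>M. \<forall>x y. M \<le> \<bar>x\<bar> \<longrightarrow> \<bar>x - y\<bar> \<le> C \<longrightarrow> dist (?\<sigma> x) (?\<sigma> y) \<le> \<epsilon>" by blast
qed

section \<open>Charts and conjugacies\<close>

text \<open>The orientation preserving homeomorphisms of \<open>[0, 1]\<close>, described by order
  alone so that they can be built from order patterns; \<open>continuous\<close> recovers
  continuity.\<close>

locale interval_auto =
  fixes h :: "real \<Rightarrow> real"
  assumes strict_mono_h: "strict_mono_on {0..1} h" and image_h: "h ` {0..1} = {0..1}"
begin

lemma less_iff: "x \<in> {0..1} \<Longrightarrow> y \<in> {0..1} \<Longrightarrow> h x < h y \<longleftrightarrow> x < y"
  using strict_mono_on_less[OF strict_mono_h] by simp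

lemma le_iff: "x \<in> {0..1} \<Longrightarrow> y \<in> {0..1} \<Longrightarrow> h x \<le> h y \<longleftrightarrow> x \<le> y"
  using strict_mono_on_less_eq[OF strict_mono_h] by simp

lemma eq_iff: "x \<in> {0..1} \<Longrightarrow> y \<in> {0..1} \<Longrightarrow> h x = h y \<longleftrightarrow> x = y"
  using strict_mono_on_eq[OF strict_mono_h] by simp

lemma in_range: "x \<in> {0..1} \<Longrightarrow> h x \<in> {0..1}"
  using image_h by blast

lemma surjE: assumes "z \<in> {0..1}" obtains x where "x \<in> {0..1}" "h x = z"
  using assms image_h by (metis imageE)

lemma at_0 [simp]: "h 0 = 0"
proof -
  obtain x where x: "x \<in> {0..1}" "h x = 0" using surjE[of 0] by auto
  then have "h 0 \<le> h x" using le_iff[of 0 x] by auto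
  then show ?thesis using x in_range[of 0] by auto
qed

lemma at_1 [simp]: "h 1 = 1"
proof -
  obtain x where x: "x \<in> {0..1}" "h x = 1" using surjE[of 1] by auto
  then have "h x \<le> h 1" using le_iff[of x 1] by auto
  then show ?thesis using x in_range[of 1] by auto
qed

lemma image_Icc: assumes "x \<in> {0..1}" "y \<in> {0..1}" shows "h ` {x..y} = {h x..h y}"
proof (intro equalityI subsetI)
  fix z assume "z \<in> h ` {x..y}"
  then show "z \<in> {h x..h y}" using assms le_iff by auto
next
  fix z assume z: "z \<in> {h x..h y}"
  have "h x \<ge> 0" "h y \<le> 1" using in_range[OF assms(1)] in_range[OF assms(2)] by auto
  then obtain w where w: "w \<in> {0..1}" "h w = z" using surjE[of z] z by auto
  then have "w \<in> {x..y}" using z assms le_iff by auto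
  then show "z \<in> h ` {x..y}" using w by blast
qed

text \<open>An order isomorphism preserves infima. This is why notions defined by an infimum can be
  transported.\<close>

lemma Inf_image: assumes "A \<subseteq> {0..1}" "A \<noteq> {}" shows "h (Inf A) = Inf (h ` A)"
proof -
  have bdd: "bdd_below A" using assms(1) by (meson bdd_below_Icc bdd_below_mono)
  have bdd': "bdd_below (h ` A)"
    using assms(1) image_h by (metis bdd_below_Icc bdd_below_mono image_mono)
  obtain a where a: "a \<in> A" using assms(2) by blast
  have Inf: "Inf A \<in> {0..1}"
    using assms cInf_lower[OF a bdd] cInf_greatest[OF assms(2), of 0] a by fastforce
  have "h (Inf A) \<le> Inf (h ` A)"
  proof (rule cInf_greatest)
    fix z assume "z \<in> h ` A"
    then obtain b where b: "b \<in> A" "z = h b" by blast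
    then have "Inf A \<le> b" using bdd cInf_lower by blast
    then show "h (Inf A) \<le> z" using b assms(1) Inf le_iff by auto
  qed (use assms in simp)
  moreover have "\<not> h (Inf A) < Inf (h ` A)"
  proof
    assume less: "h (Inf A) < Inf (h ` A)"
    have "Inf (h ` A) \<le> h a" using a bdd' by (intro cInf_lower) auto
    then have "Inf (h ` A) \<in> {0..1}" using less in_range[OF Inf] in_range[of a] a assms(1) by fastforce
    then obtain w where w: "w \<in> {0..1}" "h w = Inf (h ` A)" by (rule surjE)
    then have "Inf A < w" using less Inf less_iff by metis
    then obtain b where b: "b \<in> A" "b < w" using assms(2) bdd cInf_lessD by blast
    then have "h b < h w" using less_iff w assms(1) by blast
    moreover have "Inf (h ` A) \<le> h b" using b bdd' by (intro cInf_lower) auto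
    ultimately show False using w by simp
  qed
  ultimately show ?thesis by simp
qed

lemma continuous: "continuous_on {0..1} h"
proof -
  \<comment> \<open>Extended by the identity the map is monotone onto the whole line, an open set,
    as \<open>continuous_onI_mono\<close> requires.\<close>
  define k where "k x = (if x \<in> {0..1} then h x else x)" for x
  have "k ` UNIV = UNIV"
  proof -
    have "z \<in> range k" for z
    proof (cases "z \<in> {0..1}")
      case True
      then obtain x where "x \<in> {0..1}" "h x = z" by (rule surjE)
      then show ?thesis by (intro image_eqI[of _ _ x]) (auto simp: k_def)
    next
      case False
      then show ?thesis by (intro image_eqI[of _ _ z]) (auto simp: k_def)
    qed
    then show ?thesis by blast
  qed
  moreover have "k x \<le> k y" if "x \<le> y" for x y
    using that in_range[of x] in_range[of y] le_iff[of x y] by (auto simp: k_def)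
  ultimately have "continuous_on UNIV k" by (intro continuous_onI_mono) auto
  then have "continuous_on {0..1} k" using continuous_on_subset by blast
  then show ?thesis by (rule continuous_on_eq) (simp add: k_def)
qed

end

text \<open>Covers arcs and loops at once: at most the two ends of the parameter interval may have
  the same image.\<close>

definition chart :: "'a::metric_space set \<Rightarrow> (real \<Rightarrow> 'a) \<Rightarrow> bool" where
  "chart Y \<phi> \<longleftrightarrow> continuous_on {0..1} \<phi> \<and> \<phi> ` {0..1} = Y \<and>
     (\<forall>s\<in>{0..1}. \<forall>t\<in>{0..1}. \<phi> s = \<phi> t \<longrightarrow> s = t \<or> {s, t} = {0, 1})"

lemma chart_in: "chart Y \<phi> \<Longrightarrow> s \<in> {0..1} \<Longrightarrow> \<phi> s \<in> Y"
  by (auto simp: chart_def)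

lemma chartE: assumes "chart Y \<phi>" "y \<in> Y" obtains s where "s \<in> {0..1}" "\<phi> s = y"
  using assms by (auto simp: chart_def)

lemma chart_eqD:
  "chart Y \<phi> \<Longrightarrow> s \<in> {0..1} \<Longrightarrow> t \<in> {0..1} \<Longrightarrow> \<phi> s = \<phi> t \<Longrightarrow> s = t \<or> {s, t} = {0, 1}"
  by (simp add: chart_def)

lemma chart_continuous: "chart Y \<phi> \<Longrightarrow> continuous_on {0..1} \<phi>"
  by (simp add: chart_def)

lemma chart_compact: "chart Y \<phi> \<Longrightarrow> compact Y"
  by (metis chart_def compact_Icc compact_continuous_image)

lemma chart_least_preimage:
  assumes "chart Y \<phi>" "y \<in> Y"
  obtains a where "a \<in> {0..1}" "\<phi> a = y" "\<And>u. u \<in> {0..1} \<Longrightarrow> y \<in> \<phi> ` {0..u} \<longleftrightarrow> a \<le> u"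
proof -
  obtain a0 where a0: "a0 \<in> {0..1}" "\<phi> a0 = y" using assms by (rule chartE)
  define a where "a = (if a0 = 1 \<and> \<phi> 0 = \<phi> 1 then 0 else a0)"
  have a: "a \<in> {0..1}" "\<phi> a = y" using a0 by (auto simp: a_def)
  have na: "a = 1 \<Longrightarrow> \<phi> 0 \<noteq> \<phi> 1" by (auto simp: a_def split: if_splits)
  have "y \<in> \<phi> ` {0..u} \<longleftrightarrow> a \<le> u" if u: "u \<in> {0..1}" for u
  proof
    assume "y \<in> \<phi> ` {0..u}"
    then obtain w where w: "w \<in> {0..u}" "\<phi> w = y" by blast
    then have "a = w \<or> {a, w} = {0, 1}" using chart_eqD[OF assms(1), of a w] a u by auto
    then show "a \<le> u" using w na a by (auto simp: doubleton_eq_iff)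
  next
    assume "a \<le> u"
    then show "y \<in> \<phi> ` {0..u}" using a by (intro image_eqI[of _ _ a]) auto
  qed
  with a show ?thesis by (rule that)
qed

text \<open>\<open>h\<close> fixes 0 and 1, hence respects the only possible identification and
  induces a bijection \<open>g\<close>. Preimages of closed sets under \<open>g\<close> are images
  of compact parameter sets, which gives continuity.\<close>

lemma chart_descend:
  assumes \<phi>: "chart Y \<phi>" and \<phi>': "chart Y \<phi>'" and h: "interval_auto h"
    and ends: "\<phi> 0 = \<phi> 1 \<longleftrightarrow> \<phi>' 0 = \<phi>' 1"
  obtains g where "homeomorphic_map (top_of_set Y) (top_of_set Y) g"
    "\<And>u. u \<in> {0..1} \<Longrightarrow> g (\<phi> u) = \<phi>' (h u)"
proof -
  interpret interval_auto h by fact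
  have fib: "\<phi>' (h u) = \<phi>' (h v) \<longleftrightarrow> \<phi> u = \<phi> v" if "u \<in> {0..1}" "v \<in> {0..1}" for u v
  proof
    assume "\<phi>' (h u) = \<phi>' (h v)"
    then have "h u = h v \<or> {h u, h v} = {0, 1}"
      using chart_eqD[OF \<phi>'] in_range that by blast
    then have "h u = h v \<or> (h u = h 0 \<and> h v = h 1) \<or> (h u = h 1 \<and> h v = h 0)"
      by (auto simp: doubleton_eq_iff)
    then have "u = v \<or> (u = 0 \<and> v = 1) \<or> (u = 1 \<and> v = 0)"
      using eq_iff[of u v] eq_iff[of u 0] eq_iff[of v 1] eq_iff[of u 1] eq_iff[of v 0] that by auto
    then show "\<phi> u = \<phi> v"
      using ends \<open>\<phi>' (h u) = \<phi>' (h v)\<close> by auto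
  next
    assume "\<phi> u = \<phi> v"
    then have "u = v \<or> {u, v} = {0, 1}" using chart_eqD[OF \<phi>] that by blast
    then show "\<phi>' (h u) = \<phi>' (h v)" using ends \<open>\<phi> u = \<phi> v\<close> by (auto simp: doubleton_eq_iff)
  qed
  define \<psi> where "\<psi> y = (SOME u. u \<in> {0..1} \<and> \<phi> u = y)" for y
  have \<psi>: "\<psi> y \<in> {0..1}" "\<phi> (\<psi> y) = y" if "y \<in> Y" for y
    using someI_ex[of "\<lambda>u. u \<in> {0..1} \<and> \<phi> u = y"] chartE[OF \<phi> that] by (auto simp: \<psi>_def)
  define g where "g y = \<phi>' (h (\<psi> y))" for y
  have g: "g (\<phi> u) = \<phi>' (h u)" if "u \<in> {0..1}" for u
    unfolding g_def using fib[of "\<psi> (\<phi> u)" u] \<psi>[OF chart_in[OF \<phi> that]] that by simp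
  have cont: "continuous_on {0..1} (\<lambda>u. \<phi>' (h u))"
    by (rule continuous_on_compose2[OF chart_continuous[OF \<phi>'] continuous]) (use in_range in auto)
  have "continuous_on Y g"
    unfolding continuous_on_closed_vimage[OF compact_imp_closed[OF chart_compact[OF \<phi>]]]
  proof (intro allI impI)
    fix B :: "'a set" assume "closed B"
    have "g -` B \<inter> Y = \<phi> ` ({0..1} \<inter> (\<lambda>u. \<phi>' (h u)) -` B)"
    proof (intro equalityI subsetI)
      fix y assume y: "y \<in> g -` B \<inter> Y"
      then obtain u where "u \<in> {0..1}" "\<phi> u = y" using chartE[OF \<phi>] by blast
      then show "y \<in> \<phi> ` ({0..1} \<inter> (\<lambda>u. \<phi>' (h u)) -` B)" using y g[of u] by auto
    next
      fix y assume "y \<in> \<phi> ` ({0..1} \<inter> (\<lambda>u. \<phi>' (h u)) -` B)"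
      then show "y \<in> g -` B \<inter> Y" using g chart_in[OF \<phi>] by auto
    qed
    moreover have "compact ({0..1} \<inter> (\<lambda>u. \<phi>' (h u)) -` B)"
      using continuous_closed_preimage[OF cont _ \<open>closed B\<close>]
      by (metis bounded_Int bounded_closed_interval closed_atLeastAtMost compact_eq_bounded_closed cbox_interval)
    then have "compact (\<phi> ` ({0..1} \<inter> (\<lambda>u. \<phi>' (h u)) -` B))"
      by (rule compact_continuous_image[rotated])
        (rule continuous_on_subset[OF chart_continuous[OF \<phi>]], auto)
    ultimately show "closed (g -` B \<inter> Y)" by (simp add: compact_imp_closed)
  qed
  moreover have "g ` Y = Y"
  proof (intro equalityI subsetI)
    fix z assume "z \<in> g ` Y"
    then show "z \<in> Y" unfolding g_def using \<psi> in_range chart_in[OF \<phi>'] by auto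
  next
    fix z assume "z \<in> Y"
    then obtain w where w: "w \<in> {0..1}" "\<phi>' w = z" using chartE[OF \<phi>'] by blast
    obtain u where "u \<in> {0..1}" "h u = w" using w(1) by (rule surjE)
    then show "z \<in> g ` Y" using w g[of u] chart_in[OF \<phi>] by (intro image_eqI[of _ _ "\<phi> u"]) auto
  qed
  moreover have "inj_on g Y"
  proof (rule inj_onI)
    fix y z assume yz: "y \<in> Y" "z \<in> Y" "g y = g z"
    then have "\<phi> (\<psi> y) = \<phi> (\<psi> z)" using fib[of "\<psi> y" "\<psi> z"] \<psi> by (simp add: g_def)
    then show "y = z" using \<psi> yz by simp
  qed
  ultimately have "homeomorphic_map (top_of_set Y) (top_of_set Y) g"
    using chart_compact[OF \<phi>]
    by (intro continuous_imp_homeomorphic_map)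
      (auto simp: compact_space_subtopology Hausdorff_space_subtopology)
  then show ?thesis using g by (rule that)
qed

section \<open>From equal order patterns to a conjugacy\<close>

lemma Icc_subset_closure_if_dense:
  fixes s :: "nat \<Rightarrow> real"
  assumes "\<And>u v. 0 \<le> u \<Longrightarrow> u < v \<Longrightarrow> v \<le> 1 \<Longrightarrow> \<exists>i. u < s i \<and> s i < v"
  shows "{0..1} \<subseteq> closure (range s)"
proof
  fix x :: real assume x: "x \<in> {0..1}"
  show "x \<in> closure (range s)"
    unfolding closure_approachable
  proof (intro allI impI)
    fix e :: real assume e: "e > 0"
    define u v where "u = max 0 (x - e)" and "v = min 1 (x + e)"
    have "0 \<le> u" "u < v" "v \<le> 1" using x e by (auto simp: u_def v_def)
    then obtain i where "u < s i" "s i < v" using assms by blast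
    then have "dist (s i) x < e" unfolding u_def v_def dist_real_def by auto
    then show "\<exists>y\<in>range s. dist y x < e" by blast
  qed
qed

text \<open>An order isomorphism between dense sequences extends by suprema. The same supremum with
  the sequences exchanged provides preimages.\<close>

lemma interval_auto_of_dense:
  fixes s t :: "nat \<Rightarrow> real"
  assumes st: "range s \<subseteq> {0..1}" "range t \<subseteq> {0..1}"
    and ds: "\<And>u v. 0 \<le> u \<Longrightarrow> u < v \<Longrightarrow> v \<le> 1 \<Longrightarrow> \<exists>i. u < s i \<and> s i < v"
    and dt: "\<And>u v. 0 \<le> u \<Longrightarrow> u < v \<Longrightarrow> v \<le> 1 \<Longrightarrow> \<exists>i. u < t i \<and> t i < v"
    and ord: "\<And>i j. s i \<le> s j \<longleftrightarrow> t i \<le> t j"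
  obtains h where "interval_auto h" "\<And>i. h (s i) = t i"
proof -
  \<comment> \<open>The sequences are arguments because the construction is used in both directions;
    the element 0 keeps the set nonempty.\<close>
  define H where "H s t x = Sup (insert 0 {t i |i. s i \<le> x})" for s t :: "nat \<Rightarrow> real" and x
  have H1: "t i \<le> H s t x" if "s i \<le> x" "range t \<subseteq> {0..1}" for s t :: "nat \<Rightarrow> real" and x i
  proof -
    have "t j \<le> 1" for j using that(2) by (meson atLeastAtMost_iff rangeI subsetD)
    then have "bdd_above (insert 0 {t i |i. s i \<le> x})" by (auto intro!: bdd_aboveI[of _ 1])
    then show ?thesis unfolding H_def using that(1) by (intro cSup_upper) auto
  qed
  have H2: "H s t x \<le> t i"
    if "x \<le> s i" "range t \<subseteq> {0..1}" "\<And>i j. s i \<le> s j \<longleftrightarrow> t i \<le> t j" for s t :: "nat \<Rightarrow> real" and x i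
    unfolding H_def
  proof (rule cSup_least)
    fix z assume "z \<in> insert 0 {t i |i. s i \<le> x}"
    then consider "z = 0" | j where "z = t j" "s j \<le> x" by blast
    then show "z \<le> t i"
    proof cases
      case 2
      then have "s j \<le> s i" using that(1) by simp
      then show ?thesis using 2 that(3) by simp
    qed (use that(2) in \<open>meson atLeastAtMost_iff rangeI subsetD\<close>)
  qed simp
  have H3: "H s t x \<in> {0..1}" if "range t \<subseteq> {0..1}" for s t :: "nat \<Rightarrow> real" and x
  proof -
    have t1: "t j \<le> 1" for j using that by (meson atLeastAtMost_iff rangeI subsetD)
    then have "bdd_above (insert 0 {t i |i. s i \<le> x})" by (auto intro!: bdd_aboveI[of _ 1])
    then have "0 \<le> H s t x" unfolding H_def by (intro cSup_upper) auto
    moreover have "H s t x \<le> 1" unfolding H_def using t1 by (intro cSup_least) auto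
    ultimately show ?thesis by simp
  qed
  let ?h = "H s t" and ?k = "H t s"
  have "strict_mono_on {0..1} ?h"
  proof (rule strict_mono_onI)
    fix x y :: real assume xy: "x \<in> {0..1}" "y \<in> {0..1}" "x < y"
    \<comment> \<open>Two terms between \<open>x\<close> and \<open>y\<close>: the first bounds
      \<open>?h x\<close> from above, the second bounds \<open>?h y\<close> from below, and their
      images are strictly ordered.\<close>
    then obtain i where i: "x < s i" "s i < y" using ds[of x y] by auto
    then obtain j where j: "s i < s j" "s j < y" using ds[of "s i" y] xy by auto
    have "?h x \<le> t i" using i st ord by - (rule H2, auto)
    also have "t i < t j" using j ord[of j i] by simp
    also have "t j \<le> ?h y" using j st by - (rule H1, auto)
    finally show "?h x < ?h y" .
  qed
  moreover have "?h ` {0..1} = {0..1}"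
  proof (intro equalityI subsetI)
    fix z :: real assume z: "z \<in> {0..1}"
    have k: "?k z \<in> {0..1}" using st by (rule_tac H3)
    have "\<not> ?h (?k z) < z"
    proof
      assume "?h (?k z) < z"
      then obtain i where i: "?h (?k z) < t i" "t i < z" using dt[of "?h (?k z)" z] H3[OF st(2), of s] z by auto
      then have "s i \<le> ?k z" using st by - (rule H1, auto)
      then have "t i \<le> ?h (?k z)" using st by - (rule H1, auto)
      then show False using i by simp
    qed
    moreover have "\<not> z < ?h (?k z)"
    proof
      assume "z < ?h (?k z)"
      then obtain i where i: "z < t i" "t i < ?h (?k z)" using dt[of z "?h (?k z)"] H3[OF st(2), of s] z by auto
      then have "?k z \<le> s i" using st ord by - (rule H2, auto)
      then have "?h (?k z) \<le> t i" using st ord by - (rule H2, auto)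
      then show False using i by simp
    qed
    ultimately have "z = ?h (?k z)" by simp
    then show "z \<in> ?h ` {0..1}" using k by blast
  qed (use H3 st in blast)
  ultimately have "interval_auto ?h" by (rule interval_auto.intro)
  moreover have "?h (s i) = t i" for i
    using H1[of s i "s i" t] H2[of "s i" s i t] st ord by (simp add: order_antisym)
  ultimately show ?thesis by (rule that)
qed

text \<open>The order of the marks yields \<open>h\<close>. The relations with the images say that
  the images of corresponding marks define the same cut, so \<open>h\<close> matches them too; the
  equation then holds on a dense set and extends by continuity.\<close>

lemma conjugate_of_equal_pattern:
  fixes s t :: "nat \<Rightarrow> real"
  assumes \<phi>: "chart Y \<phi>" and \<phi>': "chart Y \<phi>'" and ends: "\<phi> 0 = \<phi> 1 \<longleftrightarrow> \<phi>' 0 = \<phi>' 1"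
    and T: "continuous_on Y T" "T \<in> Y \<rightarrow> Y" and S: "continuous_on Y S" "S \<in> Y \<rightarrow> Y"
    and st: "range s \<subseteq> {0..1}" "range t \<subseteq> {0..1}"
    and ds: "\<And>u v. 0 \<le> u \<Longrightarrow> u < v \<Longrightarrow> v \<le> 1 \<Longrightarrow> \<exists>i. u < s i \<and> s i < v"
    and dt: "\<And>u v. 0 \<le> u \<Longrightarrow> u < v \<Longrightarrow> v \<le> 1 \<Longrightarrow> \<exists>i. u < t i \<and> t i < v"
    and ord: "\<And>i j. s i \<le> s j \<longleftrightarrow> t i \<le> t j"
    and img: "\<And>i j. T (\<phi> (s i)) \<in> \<phi> ` {0..s j} \<longleftrightarrow> S (\<phi>' (t i)) \<in> \<phi>' ` {0..t j}"
  shows "conjugate (top_of_set Y) T (top_of_set Y) S"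
proof -
  obtain h where h: "interval_auto h" and hs: "\<And>i. h (s i) = t i"
    using interval_auto_of_dense[OF st ds dt ord] by blast
  interpret interval_auto h by fact
  obtain g where g: "homeomorphic_map (top_of_set Y) (top_of_set Y) g"
    and g\<phi>: "\<And>u. u \<in> {0..1} \<Longrightarrow> g (\<phi> u) = \<phi>' (h u)"
    using chart_descend[OF \<phi> \<phi>' h ends] by blast
  have s01: "s i \<in> {0..1}" and t01: "t i \<in> {0..1}" for i using st by blast+
  have on_s: "g (T (\<phi> (s i))) = S (g (\<phi> (s i)))" for i
  proof -
    have "T (\<phi> (s i)) \<in> Y" using T(2) chart_in[OF \<phi> s01] by blast
    then obtain a where a: "a \<in> {0..1}" "\<phi> a = T (\<phi> (s i))"
      "\<And>u. u \<in> {0..1} \<Longrightarrow> T (\<phi> (s i)) \<in> \<phi> ` {0..u} \<longleftrightarrow> a \<le> u"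
      using chart_least_preimage[OF \<phi>] by metis
    have "S (\<phi>' (t i)) \<in> Y" using S(2) chart_in[OF \<phi>' t01] by blast
    then obtain b where b: "b \<in> {0..1}" "\<phi>' b = S (\<phi>' (t i))"
      "\<And>u. u \<in> {0..1} \<Longrightarrow> S (\<phi>' (t i)) \<in> \<phi>' ` {0..u} \<longleftrightarrow> b \<le> u"
      using chart_least_preimage[OF \<phi>'] by metis
    \<comment> \<open>The coordinates \<open>a\<close> and \<open>b\<close> of the two images define
      the same cut among the marks, and density forces \<open>h a = b\<close>.\<close>
    have ab: "a \<le> s j \<longleftrightarrow> b \<le> t j" for j using img[of i j] a(3)[OF s01] b(3)[OF t01] by simp
    have ha: "h a \<in> {0..1}" using a(1) by (rule in_range)
    have "\<not> h a < b"
    proof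
      assume "h a < b"
      then obtain j where j: "h a < t j" "t j < b" using dt[of "h a" b] ha b(1) by auto
      then have "s j < a" using ab[of j] by simp
      then have "h (s j) < h a" using less_iff s01 a(1) by blast
      then show False using j hs by simp
    qed
    moreover have "\<not> b < h a"
    proof
      assume "b < h a"
      then obtain j where j: "b < t j" "t j < h a" using dt[of b "h a"] ha b(1) by auto
      then have "a \<le> s j" using ab[of j] by simp
      then have "h a \<le> h (s j)" using le_iff s01 a(1) by blast
      then show False using j hs by simp
    qed
    ultimately have "h a = b" by simp
    then show ?thesis using g\<phi>[OF a(1)] g\<phi>[OF s01] a(2) b(2) hs by metis
  qed
  have gc: "continuous_on Y g" "g ` Y = Y"
    using g homeomorphic_imp_continuous_map homeomorphic_imp_surjective_map by fastforce+
  have cl: "closure (range s) = {0..1}"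
    using Icc_subset_closure_if_dense[OF ds] closure_minimal[OF st(1)] by auto
  have c\<phi>: "continuous_on {0..1} \<phi>" "\<phi> ` {0..1} \<subseteq> Y" using \<phi> by (auto simp: chart_def)
  have "continuous_on {0..1} (\<lambda>u. g (T (\<phi> u)))"
    by (rule continuous_on_compose2[OF gc(1)], rule continuous_on_compose2[OF T(1) c\<phi>])
      (use T(2) c\<phi> in auto)
  moreover have "continuous_on {0..1} (\<lambda>u. S (g (\<phi> u)))"
    by (rule continuous_on_compose2[OF S(1)], rule continuous_on_compose2[OF gc(1) c\<phi>])
      (use gc(2) c\<phi> in auto)
  ultimately have "continuous_on (closure (range s)) (\<lambda>u. dist (g (T (\<phi> u))) (S (g (\<phi> u))))"
    unfolding cl by (rule continuous_on_dist)
  then have "dist (g (T (\<phi> u))) (S (g (\<phi> u))) = 0" if "u \<in> {0..1}" for u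
    by (rule continuous_constant_on_closure) (use on_s that cl in auto)
  then have "g (T y) = S (g y)" if "y \<in> Y" for y
    using chartE[OF \<phi> that] by (metis dist_eq_0_iff)
  then show ?thesis unfolding conjugate_def using g by auto
qed

section \<open>Greedy marks\<close>

definition hits :: "(real \<Rightarrow> 'a) \<Rightarrow> ('a \<Rightarrow> 'a) \<Rightarrow> nat \<Rightarrow> real \<Rightarrow> real \<Rightarrow> real \<Rightarrow> real \<Rightarrow> bool" where
  "hits \<phi> T j x t a b \<longleftrightarrow> (\<exists>u\<in>{x..t}. \<exists>v\<in>{a..b}. (T ^^ j) (\<phi> u) = \<phi> v)"

text \<open>On a loop, an arc starting at 0 and another ending at 1 would meet at the seam; the last
  clause rules this out.\<close>

definition apart :: "(real \<Rightarrow> 'a) \<Rightarrow> real \<Rightarrow> real \<Rightarrow> real \<Rightarrow> real \<Rightarrow> bool" where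
  "apart \<phi> a b c d \<longleftrightarrow> a \<le> b \<and> b < c \<and> c \<le> d \<and> (\<phi> 0 = \<phi> 1 \<longrightarrow> 0 < a \<or> d < 1)"

text \<open>An interval is large if one of the first \<open>n\<close> iterates meets two disjoint arcs with end points in
  \<open>Q\<close>. By uniform continuity large intervals are not short, so that the greedy cutting stops.\<close>

definition large :: "(real \<Rightarrow> 'a) \<Rightarrow> ('a \<Rightarrow> 'a) \<Rightarrow> real set \<Rightarrow> nat \<Rightarrow> real \<Rightarrow> real \<Rightarrow> bool" where
  "large \<phi> T Q n x t \<longleftrightarrow> (\<exists>j\<in>{..n}. \<exists>a\<in>Q. \<exists>b\<in>Q. \<exists>c\<in>Q. \<exists>d\<in>Q. apart \<phi> a b c d \<and>
     hits \<phi> T j x t a b \<and> hits \<phi> T j x t c d)"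

text \<open>The inserted 1 ends the greedy cutting when no large interval is left.\<close>

definition next_mark :: "(real \<Rightarrow> 'a) \<Rightarrow> ('a \<Rightarrow> 'a) \<Rightarrow> real set \<Rightarrow> nat \<Rightarrow> real \<Rightarrow> real" where
  "next_mark \<phi> T Q n x = Inf (insert 1 {t \<in> {x..1}. large \<phi> T Q n x t})"

definition mark :: "(real \<Rightarrow> 'a) \<Rightarrow> ('a \<Rightarrow> 'a) \<Rightarrow> real set \<Rightarrow> nat \<Rightarrow> nat \<Rightarrow> real" where
  "mark \<phi> T Q n k = (next_mark \<phi> T Q n ^^ k) 0"

definition separating :: "(real \<Rightarrow> 'a) \<Rightarrow> ('a \<Rightarrow> 'a) \<Rightarrow> real set \<Rightarrow> bool" where
  "separating \<phi> T Q \<longleftrightarrow> (\<forall>x y. 0 \<le> x \<longrightarrow> x < y \<longrightarrow> y \<le> 1 \<longrightarrow> (\<exists>n. large \<phi> T Q n x y))"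

section \<open>Gaps and density of the marks\<close>

lemma hits_mono: "hits \<phi> T j x t a b \<Longrightarrow> x' \<le> x \<Longrightarrow> t \<le> t' \<Longrightarrow> hits \<phi> T j x' t' a b"
  unfolding hits_def by fastforce

lemma large_mono: "large \<phi> T Q n x t \<Longrightarrow> x' \<le> x \<Longrightarrow> t \<le> t' \<Longrightarrow> large \<phi> T Q n x' t'"
  unfolding large_def using hits_mono by meson

lemma next_mark_in:
  assumes "x \<in> {0..1}" shows "next_mark \<phi> T Q n x \<in> {x..1}"
proof -
  let ?A = "insert 1 {t \<in> {x..1}. large \<phi> T Q n x t}"
  have "bdd_below ?A" using assms by (auto intro!: bdd_belowI[of _ x])
  then have "Inf ?A \<le> 1" by (intro cInf_lower) auto
  moreover have "x \<le> Inf ?A" using assms by (intro cInf_greatest) auto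
  ultimately show ?thesis by (simp add: next_mark_def)
qed

lemma mark_in: "mark \<phi> T Q n k \<in> {0..1}"
proof (induction k)
  case (Suc k)
  then show ?case using next_mark_in[of "mark \<phi> T Q n k" \<phi> T Q n] by (simp add: mark_def)
qed (simp add: mark_def)

lemma funpow_in: "T \<in> Y \<rightarrow> Y \<Longrightarrow> y \<in> Y \<Longrightarrow> (T ^^ j) y \<in> Y"
  by (induction j) auto

lemma continuous_on_funpow:
  assumes "continuous_on Y T" "T \<in> Y \<rightarrow> Y" shows "continuous_on Y (T ^^ j)"
proof (induction j)
  case (Suc j)
  have "continuous_on Y (\<lambda>y. T ((T ^^ j) y))"
    by (rule continuous_on_compose2[OF assms(1) Suc]) (use funpow_in[OF assms(2)] in auto)
  then show ?case by (simp add: comp_def)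
qed (simp add: id_def)

lemma apart_disjoint:
  assumes \<phi>: "chart Y \<phi>" and "a \<in> {0..1}" "d \<in> {0..1}" "apart \<phi> a b c d"
  shows "\<phi> ` {a..b} \<inter> \<phi> ` {c..d} = {}"
proof -
  have "\<phi> u \<noteq> \<phi> v" if "u \<in> {a..b}" "v \<in> {c..d}" for u v
  proof
    assume eq: "\<phi> u = \<phi> v"
    have uv: "u \<in> {0..1}" "v \<in> {0..1}" "u < v" using that assms by (auto simp: apart_def)
    then have "u = 0" "v = 1" using chart_eqD[OF \<phi> _ _ eq] by (auto simp: doubleton_eq_iff)
    then show False using eq that assms by (auto simp: apart_def)
  qed
  then show ?thesis by blast
qed

text \<open>The two arcs are disjoint and compact, hence at positive distance \<open>e\<close>;
  uniform continuity of the iterate then keeps the two witnesses at least \<open>\<delta>\<close>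
  apart.\<close>

lemma hits_apart_gap:
  assumes \<phi>: "chart Y \<phi>" and T: "continuous_on Y T" "T \<in> Y \<rightarrow> Y"
    and abcd: "a \<in> {0..1}" "d \<in> {0..1}" "apart \<phi> a b c d"
  shows "\<exists>\<delta>>0. \<forall>x t. 0 \<le> x \<longrightarrow> t \<le> 1 \<longrightarrow> hits \<phi> T j x t a b \<and> hits \<phi> T j x t c d \<longrightarrow> \<delta> \<le> t - x"
proof -
  have sub: "{a..b} \<subseteq> {0..1}" "{c..d} \<subseteq> {0..1}" using abcd by (auto simp: apart_def)
  have "continuous_on {a..b} \<phi>" "continuous_on {c..d} \<phi>"
    using continuous_on_subset[OF chart_continuous[OF \<phi>]] sub by blast+
  then have cpt: "compact (\<phi> ` {a..b})" "compact (\<phi> ` {c..d})"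
    using compact_continuous_image[OF _ compact_Icc] by metis+
  have "compact (\<phi> ` {a..b} \<times> \<phi> ` {c..d})" using cpt by (rule compact_Times)
  moreover have "\<phi> ` {a..b} \<times> \<phi> ` {c..d} \<noteq> {}" using abcd by (auto simp: apart_def)
  moreover have "continuous_on (\<phi> ` {a..b} \<times> \<phi> ` {c..d}) (\<lambda>p. dist (fst p) (snd p))"
    by (intro continuous_intros)
  ultimately have "\<exists>p\<in>\<phi> ` {a..b} \<times> \<phi> ` {c..d}. \<forall>q\<in>\<phi> ` {a..b} \<times> \<phi> ` {c..d}.
      dist (fst p) (snd p) \<le> dist (fst q) (snd q)"
    by (rule continuous_attains_inf)
  then obtain p where p: "p \<in> \<phi> ` {a..b} \<times> \<phi> ` {c..d}"
    "\<And>q. q \<in> \<phi> ` {a..b} \<times> \<phi> ` {c..d} \<Longrightarrow> dist (fst p) (snd p) \<le> dist (fst q) (snd q)"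
    by (elim bexE) (blast intro: that)
  define e where "e = dist (fst p) (snd p)"
  have "fst p \<noteq> snd p" using p(1) apart_disjoint[OF \<phi> abcd] by (metis IntI empty_iff mem_Times_iff)
  then have e: "e > 0" "\<And>y z. y \<in> \<phi> ` {a..b} \<Longrightarrow> z \<in> \<phi> ` {c..d} \<Longrightarrow> e \<le> dist y z"
    using p(2)[of "(y, z)" for y z] by (simp_all add: e_def)
  have "continuous_on {0..1} (\<lambda>u. (T ^^ j) (\<phi> u))"
    by (rule continuous_on_compose2[OF continuous_on_funpow[OF T] chart_continuous[OF \<phi>]])
      (use chart_in[OF \<phi>] in auto)
  then have "uniformly_continuous_on {0..1} (\<lambda>u. (T ^^ j) (\<phi> u))"
    by (rule compact_uniformly_continuous) simp
  then obtain \<delta> where \<delta>: "\<delta> > 0" "\<And>u v. u \<in> {0..1} \<Longrightarrow> v \<in> {0..1} \<Longrightarrow> dist u v < \<delta> \<Longrightarrow>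
      dist ((T ^^ j) (\<phi> u)) ((T ^^ j) (\<phi> v)) < e"
    using e(1) unfolding uniformly_continuous_on_def by metis
  have "\<delta> \<le> t - x" if "0 \<le> x" "t \<le> 1" and hit: "hits \<phi> T j x t a b" "hits \<phi> T j x t c d" for x t
  proof (rule ccontr)
    assume "\<not> \<delta> \<le> t - x"
    moreover obtain u where u: "u \<in> {x..t}" "(T ^^ j) (\<phi> u) \<in> \<phi> ` {a..b}"
      using hit(1) unfolding hits_def by auto
    moreover obtain v where v: "v \<in> {x..t}" "(T ^^ j) (\<phi> v) \<in> \<phi> ` {c..d}"
      using hit(2) unfolding hits_def by auto
    ultimately have "dist ((T ^^ j) (\<phi> u)) ((T ^^ j) (\<phi> v)) < e"
      using that by (intro \<delta>(2)) (auto simp: dist_real_def)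
    then show False using e(2)[OF u(2) v(2)] by simp
  qed
  then show ?thesis using \<delta>(1) by blast
qed

lemma uniform_gap:
  fixes P :: "'i \<Rightarrow> real \<Rightarrow> real \<Rightarrow> bool"
  assumes "finite I" "\<And>i. i \<in> I \<Longrightarrow> \<exists>\<delta>>0. \<forall>x t. P i x t \<longrightarrow> \<delta> \<le> t - x"
  shows "\<exists>\<delta>>0. \<forall>i\<in>I. \<forall>x t. P i x t \<longrightarrow> \<delta> \<le> t - x"
  using assms
proof (induction I rule: finite_induct)
  case empty
  show ?case by (intro exI[of _ 1]) auto
next
  case (insert i I)
  obtain \<delta>1 where \<delta>1: "\<delta>1 > 0" "\<forall>x t. P i x t \<longrightarrow> \<delta>1 \<le> t - x" using insert.prems by blast
  obtain \<delta>2 where \<delta>2: "\<delta>2 > 0" "\<forall>i\<in>I. \<forall>x t. P i x t \<longrightarrow> \<delta>2 \<le> t - x" using insert by blast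
  show ?case using \<delta>1 \<delta>2 by (intro exI[of _ "min \<delta>1 \<delta>2"]) (auto simp: min_le_iff_disj)
qed

text \<open>Only finitely many times and quadruples of grid points occur, so the least of their gaps
  serves.\<close>

lemma large_gap:
  assumes \<phi>: "chart Y \<phi>" and T: "continuous_on Y T" "T \<in> Y \<rightarrow> Y"
    and Q: "finite Q" "Q \<subseteq> {0..1}"
  shows "\<exists>\<delta>>0. \<forall>x t. 0 \<le> x \<longrightarrow> t \<le> 1 \<longrightarrow> large \<phi> T Q n x t \<longrightarrow> \<delta> \<le> t - x"
proof -
  define P where "P = (\<lambda>(j, a, b, c, d) x t. 0 \<le> x \<and> t \<le> 1 \<and> apart \<phi> a b c d \<and>
    hits \<phi> T j x t a b \<and> hits \<phi> T j x t c d)"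
  have "\<exists>\<delta>>0. \<forall>i\<in>{..n} \<times> Q \<times> Q \<times> Q \<times> Q. \<forall>x t. P i x t \<longrightarrow> \<delta> \<le> t - x"
  proof (rule uniform_gap)
    fix i assume i: "i \<in> {..n} \<times> Q \<times> Q \<times> Q \<times> Q"
    obtain j a b c d where ij: "i = (j, a, b, c, d)" by (cases i) auto
    show "\<exists>\<delta>>0. \<forall>x t. P i x t \<longrightarrow> \<delta> \<le> t - x"
    proof (cases "apart \<phi> a b c d")
      case True
      have "a \<in> {0..1}" "d \<in> {0..1}" using i ij Q by auto
      then show ?thesis using hits_apart_gap[OF \<phi> T _ _ True, of j] by (simp add: P_def ij) metis
    next
      case False
      then show ?thesis by (intro exI[of _ 1]) (simp add: P_def ij)
    qed
  qed (use Q in simp)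
  then obtain \<delta> where \<delta>: "\<delta> > 0" "\<And>i x t. i\<in>{..n} \<times> Q \<times> Q \<times> Q \<times> Q \<Longrightarrow> P i x t \<Longrightarrow> \<delta> \<le> t - x" by blast
  have "\<delta> \<le> t - x" if xt: "0 \<le> x" "t \<le> 1" "large \<phi> T Q n x t" for x t
  proof -
    obtain j a b c d where "j \<in> {..n}" "a \<in> Q" "b \<in> Q" "c \<in> Q" "d \<in> Q"
      "apart \<phi> a b c d \<and> hits \<phi> T j x t a b \<and> hits \<phi> T j x t c d"
      using xt(3) unfolding large_def by (elim bexE)
    then show ?thesis using xt by (intro \<delta>(2)[of "(j, a, b, c, d)"]) (simp_all add: P_def)
  qed
  then show ?thesis using \<delta>(1) by blast
qed

text \<open>Take \<open>n\<close> for which a piece of \<open>[u, v]\<close> starting at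
  \<open>u\<close> is large. The marks for this \<open>n\<close> advance by at least
  \<open>\<delta>\<close> and pass \<open>u\<close>; the first one beyond \<open>u\<close> cannot
  overshoot that piece.\<close>

lemma mark_dense:
  assumes \<phi>: "chart Y \<phi>" and T: "continuous_on Y T" "T \<in> Y \<rightarrow> Y"
    and Q: "finite Q" "Q \<subseteq> {0..1}" and sep: "separating \<phi> T Q"
    and uv: "0 \<le> u" "u < v" "v \<le> 1"
  shows "\<exists>n k. u < mark \<phi> T Q n k \<and> mark \<phi> T Q n k < v"
proof -
  \<comment> \<open>The next mark is only bounded by \<open>\<le>\<close>; the midpoint leaves room
    for a strict inequality with \<open>v\<close>.\<close>
  define v' where "v' = (u + v) / 2"
  have v': "u < v'" "v' < v" "v' \<le> 1" using uv by (auto simp: v'_def)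
  obtain n where n: "large \<phi> T Q n u v'" using sep uv v' unfolding separating_def by blast
  obtain \<delta> where \<delta>: "\<delta> > 0" "\<And>x t. 0 \<le> x \<Longrightarrow> t \<le> 1 \<Longrightarrow> large \<phi> T Q n x t \<Longrightarrow> \<delta> \<le> t - x"
    using large_gap[OF \<phi> T Q] by blast
  define s where "s k = mark \<phi> T Q n k" for k
  have s01: "s k \<in> {0..1}" for k unfolding s_def by (rule mark_in)
  have sSuc: "s (Suc k) = Inf (insert 1 {t \<in> {s k..1}. large \<phi> T Q n (s k) t})" for k
    by (simp add: s_def mark_def next_mark_def)
  have "\<exists>k. u < s k"
  proof (rule ccontr)
    assume "\<not> ?thesis"
    then have le: "s k \<le> u" for k by (simp add: not_less)
    have "real k * \<delta> \<le> s k" for k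
    proof (induction k)
      case (Suc k)
      have "min 1 (s k + \<delta>) \<le> s (Suc k)"
        unfolding sSuc
      proof (rule cInf_greatest)
        fix t assume "t \<in> insert 1 {t \<in> {s k..1}. large \<phi> T Q n (s k) t}"
        then consider "t = 1" | "t \<le> 1" "large \<phi> T Q n (s k) t" by auto
        then show "min 1 (s k + \<delta>) \<le> t"
        proof cases
          case 2
          then have "\<delta> \<le> t - s k" using s01[of k] by (intro \<delta>(2)) auto
          then show ?thesis by simp
        qed simp
      qed simp
      then have "s k + \<delta> \<le> s (Suc k)" using le[of "Suc k"] uv by simp
      then show ?case using Suc by (simp add: algebra_simps)
    qed (simp add: s_def mark_def)
    moreover obtain k where "1 / \<delta> < real k" using reals_Archimedean2 by blast
    then have "1 < real k * \<delta>" using \<delta>(1) by (simp add: field_simps)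
    ultimately show False using s01[of k] by (meson atLeastAtMost_iff leD order_trans)
  qed
  then obtain k where k: "u < s k" "\<And>i. i < k \<Longrightarrow> s i \<le> u"
    using exists_least_iff[of "\<lambda>k. u < s k"] by (meson not_less)
  have "k \<noteq> 0" using k(1) uv by (cases k) (auto simp: s_def mark_def)
  then obtain i where i: "k = Suc i" using not0_implies_Suc by blast
  then have si: "s i \<le> u" using k(2) by simp
  have "bdd_below (insert 1 {t \<in> {s i..1}. large \<phi> T Q n (s i) t})"
    using s01[of i] by (auto intro!: bdd_belowI[of _ "s i"])
  \<comment> \<open>\<open>[s i, v']\<close> contains \<open>[u, v']\<close> and is therefore large,
    so the greedy cut stops at \<open>v'\<close> at the latest.\<close>
  then have "s k \<le> v'"
    unfolding i sSuc using large_mono[OF n si order_refl] si v' by (intro cInf_lower) auto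
  then show ?thesis using k(1) v' unfolding s_def by (intro exI[of _ n] exI[of _ k]) simp
qed

text \<open>All the relations \<open>s i \<le> s j\<close> and \<open>T (\<phi> (s i)) \<in> \<phi> ` {0..s j}\<close> between the marks \<open>s\<close>, in one
  Boolean sequence.\<close>

definition pattern :: "(real \<Rightarrow> 'a) \<Rightarrow> ('a \<Rightarrow> 'a) \<Rightarrow> real set \<Rightarrow> nat \<Rightarrow> bool" where
  "pattern \<phi> T Q m = (case prod_decode m of (e, l) \<Rightarrow> case prod_decode l of (i, j) \<Rightarrow>
     let s = (\<lambda>i. case prod_decode i of (n, k) \<Rightarrow> mark \<phi> T Q n k)
     in if e = 0 then s i \<le> s j else T (\<phi> (s i)) \<in> \<phi> ` {0..s j})"

lemma conjugate_of_pattern_eq: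
  assumes \<phi>: "chart Y \<phi>" and \<phi>': "chart Y \<phi>'" and ends: "\<phi> 0 = \<phi> 1 \<longleftrightarrow> \<phi>' 0 = \<phi>' 1"
    and T: "continuous_on Y T" "T \<in> Y \<rightarrow> Y" and S: "continuous_on Y S" "S \<in> Y \<rightarrow> Y"
    and Q: "finite Q" "Q \<subseteq> {0..1}" and sep: "separating \<phi> T Q"
    and Q': "finite Q'" "Q' \<subseteq> {0..1}" and sep': "separating \<phi>' S Q'"
    and eq: "pattern \<phi> T Q = pattern \<phi>' S Q'"
  shows "conjugate (top_of_set Y) T (top_of_set Y) S"
proof -
  define s where "s i = (case prod_decode i of (n, k) \<Rightarrow> mark \<phi> T Q n k)" for i
  define t where "t i = (case prod_decode i of (n, k) \<Rightarrow> mark \<phi>' S Q' n k)" for i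
  have pat: "pattern \<phi> T Q (prod_encode (e, prod_encode (i, j))) =
      (if e = 0 then s i \<le> s j else T (\<phi> (s i)) \<in> \<phi> ` {0..s j})"
    "pattern \<phi>' S Q' (prod_encode (e, prod_encode (i, j))) =
      (if e = 0 then t i \<le> t j else S (\<phi>' (t i)) \<in> \<phi>' ` {0..t j})" for e i j
    by (simp_all add: pattern_def s_def[abs_def] t_def[abs_def])
  have enc: "s (prod_encode (n, k)) = mark \<phi> T Q n k" "t (prod_encode (n, k)) = mark \<phi>' S Q' n k" for n k
    by (simp_all add: s_def t_def)
  show ?thesis
  proof (rule conjugate_of_equal_pattern[OF \<phi> \<phi>' ends T S, of s t])
    show "range s \<subseteq> {0..1}" "range t \<subseteq> {0..1}"
      using mark_in unfolding s_def t_def by (auto split: prod.splits simp del: atLeastAtMost_iff)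
    fix u v :: real assume uv: "0 \<le> u" "u < v" "v \<le> 1"
    show "\<exists>i. u < s i \<and> s i < v" using mark_dense[OF \<phi> T Q sep uv] enc by metis
    show "\<exists>i. u < t i \<and> t i < v" using mark_dense[OF \<phi>' S Q' sep' uv] enc by metis
  next
    fix i j
    show "s i \<le> s j \<longleftrightarrow> t i \<le> t j"
      using pat(1)[of 0 i j] pat(2)[of 0 i j] eq by simp
    show "T (\<phi> (s i)) \<in> \<phi> ` {0..s j} \<longleftrightarrow> S (\<phi>' (t i)) \<in> \<phi>' ` {0..t j}"
      using pat(1)[of 1 i j] pat(2)[of 1 i j] eq by simp
  qed
qed

text \<open>A conjugacy \<open>g\<close> that becomes \<open>h\<close> when read in two charts. All
  notions used for the marks involve only the order, the map and the chart, and are carried along by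
  \<open>h\<close>.\<close>

locale chart_conjugacy = interval_auto h for h +
  fixes Y :: "'a::metric_space set" and \<phi> \<phi>' T S g
  assumes \<phi>: "chart Y \<phi>" and \<phi>': "chart Y \<phi>'"
    and g_inj: "inj_on g Y" and g_\<phi>: "\<And>u. u \<in> {0..1} \<Longrightarrow> g (\<phi> u) = \<phi>' (h u)"
    and T_in: "T \<in> Y \<rightarrow> Y" and g_T: "\<And>y. y \<in> Y \<Longrightarrow> g (T y) = S (g y)"
begin

lemma \<phi>_in: "u \<in> {0..1} \<Longrightarrow> \<phi> u \<in> Y"
  using chart_in[OF \<phi>] .

lemma S_funpow: "y \<in> Y \<Longrightarrow> (S ^^ j) (g y) = g ((T ^^ j) y)"
  by (induction j) (auto simp: g_T funpow_in[OF T_in])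

lemma eq_transfer:
  assumes "u \<in> {0..1}" "v \<in> {0..1}"
  shows "(S ^^ j) (\<phi>' (h u)) = \<phi>' (h v) \<longleftrightarrow> (T ^^ j) (\<phi> u) = \<phi> v"
proof -
  have "(S ^^ j) (\<phi>' (h u)) = g ((T ^^ j) (\<phi> u))"
    using S_funpow[OF \<phi>_in[OF assms(1)], of j] g_\<phi>[OF assms(1)] by simp
  moreover have "\<phi>' (h v) = g (\<phi> v)" using g_\<phi>[OF assms(2)] by simp
  ultimately show ?thesis
    using inj_on_eq_iff[OF g_inj funpow_in[OF T_in \<phi>_in[OF assms(1)]] \<phi>_in[OF assms(2)]] by simp
qed

lemma ends_transfer: "\<phi>' 0 = \<phi>' 1 \<longleftrightarrow> \<phi> 0 = \<phi> 1"
  using eq_transfer[of 0 1 0] by simp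

lemma hits_transfer:
  assumes "x \<in> {0..1}" "t \<in> {0..1}" "a \<in> {0..1}" "b \<in> {0..1}"
  shows "hits \<phi>' S j (h x) (h t) (h a) (h b) \<longleftrightarrow> hits \<phi> T j x t a b"
proof -
  have "u \<in> {0..1}" if "u \<in> {x..t} \<or> u \<in> {a..b}" for u using that assms by auto
  then show ?thesis
    unfolding hits_def image_Icc[OF assms(1,2), symmetric] image_Icc[OF assms(3,4), symmetric]
    using eq_transfer by (simp add: bex_simps del: atLeastAtMost_iff)
qed

lemma apart_transfer:
  assumes "a \<in> {0..1}" "b \<in> {0..1}" "c \<in> {0..1}" "d \<in> {0..1}"
  shows "apart \<phi>' (h a) (h b) (h c) (h d) \<longleftrightarrow> apart \<phi> a b c d"
  unfolding apart_def ends_transfer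
  using assms le_iff[of a b] less_iff[of b c] le_iff[of c d] less_iff[of 0 a] less_iff[of d 1] by auto

lemma large_transfer:
  assumes "Q \<subseteq> {0..1}" "x \<in> {0..1}" "t \<in> {0..1}"
  shows "large \<phi>' S (h ` Q) n (h x) (h t) \<longleftrightarrow> large \<phi> T Q n x t"
proof -
  have "apart \<phi>' (h a) (h b) (h c) (h d) \<and> hits \<phi>' S j (h x) (h t) (h a) (h b) \<and> hits \<phi>' S j (h x) (h t) (h c) (h d) \<longleftrightarrow>
      apart \<phi> a b c d \<and> hits \<phi> T j x t a b \<and> hits \<phi> T j x t c d"
    if "a \<in> Q" "b \<in> Q" "c \<in> Q" "d \<in> Q" for a b c d j
  proof -
    have "a \<in> {0..1}" "b \<in> {0..1}" "c \<in> {0..1}" "d \<in> {0..1}" using that assms(1) by blast+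
    then show ?thesis using apart_transfer hits_transfer assms(2,3) by metis
  qed
  then show ?thesis unfolding large_def by simp
qed

lemma next_mark_transfer:
  assumes "Q \<subseteq> {0..1}" "x \<in> {0..1}"
  shows "next_mark \<phi>' S (h ` Q) n (h x) = h (next_mark \<phi> T Q n x)"
proof -
  have "{t \<in> {h x..1}. large \<phi>' S (h ` Q) n (h x) t} = h ` {t \<in> {x..1}. large \<phi> T Q n x t}"
  proof (intro equalityI subsetI)
    fix z assume z: "z \<in> {t \<in> {h x..1}. large \<phi>' S (h ` Q) n (h x) t}"
    then have "z \<in> h ` {x..1}" using image_Icc[OF assms(2), of 1] by simp
    then obtain t where "t \<in> {x..1}" "z = h t" by blast
    then show "z \<in> h ` {t \<in> {x..1}. large \<phi> T Q n x t}"
      using z large_transfer[OF assms, of t n] assms(2) by auto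
  next
    fix z assume "z \<in> h ` {t \<in> {x..1}. large \<phi> T Q n x t}"
    then obtain t where t: "t \<in> {x..1}" "large \<phi> T Q n x t" "z = h t" by auto
    then have "t \<in> {0..1}" using assms(2) by auto
    then show "z \<in> {t \<in> {h x..1}. large \<phi>' S (h ` Q) n (h x) t}"
      using t large_transfer[OF assms, of t n] le_iff[OF assms(2), of t] in_range[of t] by auto
  qed
  then have "insert 1 {t \<in> {h x..1}. large \<phi>' S (h ` Q) n (h x) t} =
      h ` insert 1 {t \<in> {x..1}. large \<phi> T Q n x t}" by simp
  moreover have "insert 1 {t \<in> {x..1}. large \<phi> T Q n x t} \<subseteq> {0..1}" using assms(2) by auto
  ultimately show ?thesis
    unfolding next_mark_def using Inf_image[of "insert 1 {t \<in> {x..1}. large \<phi> T Q n x t}"] by simp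
qed

lemma mark_transfer:
  assumes "Q \<subseteq> {0..1}" shows "mark \<phi>' S (h ` Q) n k = h (mark \<phi> T Q n k)"
proof (induction k)
  case (Suc k)
  then show ?case
    using next_mark_transfer[OF assms mark_in[of \<phi> T Q n k], of n] by (simp add: mark_def)
qed (simp add: mark_def)

lemma separating_transfer:
  assumes Q: "Q \<subseteq> {0..1}" and sep: "separating \<phi> T Q"
  shows "separating \<phi>' S (h ` Q)"
  unfolding separating_def
proof (intro allI impI)
  fix x' y' :: real assume xy: "0 \<le> x'" "x' < y'" "y' \<le> 1"
  obtain x where x: "x \<in> {0..1}" "h x = x'" using surjE[of x'] xy by auto
  obtain y where y: "y \<in> {0..1}" "h y = y'" using surjE[of y'] xy by auto
  have "x < y" using less_iff[OF x(1) y(1)] x y xy by simp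
  then obtain n where "large \<phi> T Q n x y" using sep x y unfolding separating_def by auto
  then show "\<exists>n. large \<phi>' S (h ` Q) n x' y'" using large_transfer[OF Q x(1) y(1)] x y by auto
qed

lemma pattern_transfer:
  assumes Q: "Q \<subseteq> {0..1}" shows "pattern \<phi>' S (h ` Q) = pattern \<phi> T Q"
proof
  fix m
  obtain e l where el: "prod_decode m = (e, l)" by fastforce
  obtain i j where ij: "prod_decode l = (i, j)" by fastforce
  define s where "s i = (case prod_decode i of (n, k) \<Rightarrow> mark \<phi> T Q n k)" for i
  have s': "(\<lambda>i. case prod_decode i of (n, k) \<Rightarrow> mark \<phi>' S (h ` Q) n k) = (\<lambda>i. h (s i))"
    by (auto simp: s_def mark_transfer[OF Q] split: prod.splits)
  have s01: "s i \<in> {0..1}" for i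
    using mark_in unfolding s_def by (auto split: prod.splits simp del: atLeastAtMost_iff)
  have "S (\<phi>' (h (s i))) \<in> \<phi>' ` {0..h (s j)} \<longleftrightarrow> T (\<phi> (s i)) \<in> \<phi> ` {0..s j}"
  proof -
    have "{0..h (s j)} = h ` {0..s j}" using image_Icc[of 0 "s j"] s01 by simp
    moreover have "S (\<phi>' (h (s i))) = \<phi>' (h v) \<longleftrightarrow> T (\<phi> (s i)) = \<phi> v" if "v \<in> {0..s j}" for v
      using eq_transfer[of "s i" v 1] s01[of i] s01[of j] that by auto
    ultimately show ?thesis by (auto simp: image_iff)
  qed
  then show "pattern \<phi>' S (h ` Q) m = pattern \<phi> T Q m"
    unfolding pattern_def el ij prod.case s' Let_def
    using le_iff[OF s01 s01, of i j] by (simp add: s_def[symmetric])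
qed

end

section \<open>Sensitivity and separating grids\<close>

lemma chaotic_mapsD:
  assumes "compact Y" "T \<in> chaotic_maps Y"
  shows "continuous_on Y T" "T \<in> Y \<rightarrow> Y"
  using assms by (auto simp: chaotic_maps_def mspace_self_maps)

lemma funpow_mult_fixed: "(T ^^ n) x = x \<Longrightarrow> (T ^^ (m * n)) x = x"
  by (induction m) (auto simp: funpow_add)

lemma funpow_periodic_mod:
  assumes "(T ^^ n) x = x" shows "(T ^^ i) x = (T ^^ (i mod n)) x"
proof -
  have "(T ^^ i) x = (T ^^ (i mod n + i div n * n)) x" by simp
  also have "\<dots> = (T ^^ (i mod n)) ((T ^^ (i div n * n)) x)" by (simp only: funpow_add comp_apply)
  finally show ?thesis by (simp only: funpow_mult_fixed[OF assms])
qed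

text \<open>Transitivity and density of periodic points in one: a periodic point starts in
  \<open>U\<close> and visits \<open>V\<close>.\<close>

lemma chaotic_periodic_visit:
  assumes "compact Y" and T: "T \<in> chaotic_maps Y"
    and U: "openin (top_of_set Y) U" "U \<noteq> {}" and V: "openin (top_of_set Y) V" "V \<noteq> {}"
  obtains z n k where "z \<in> U" "0 < n" "(T ^^ n) z = z" "(T ^^ k) z \<in> V"
proof -
  have sub: "U \<subseteq> Y" "V \<subseteq> Y" using U V openin_imp_subset by blast+
  \<comment> \<open>Adding \<open>Y\<close> turns the two sets into a cover, to which the definition
    of chaos applies.\<close>
  have "finite {U, V, Y} \<and> (\<forall>W\<in>{U, V, Y}. openin (top_of_set Y) W \<and> W \<noteq> {}) \<and> \<Union>{U, V, Y} = topspace (top_of_set Y)"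
    using U V sub by auto
  moreover have "chaotic (top_of_set Y) T" using T by (simp add: chaotic_maps_def)
  ultimately obtain x where x: "periodic_point (top_of_set Y) T x"
    "\<forall>W\<in>{U, V, Y}. \<exists>n. (T ^^ n) x \<in> W" unfolding chaotic_def by metis
  obtain m l where ml: "(T ^^ m) x \<in> U" "(T ^^ l) x \<in> V" using x(2) by auto
  obtain N where N: "N > 0" "(T ^^ N) x = x" using x(1) by (auto simp: periodic_point_def)
  have "(T ^^ N) ((T ^^ m) x) = (T ^^ m) x"
    using N(2) by (metis add.commute comp_apply funpow_add)
  \<comment> \<open>The visit to \<open>V\<close> may precede the one to \<open>U\<close>; the
    detour completes \<open>m\<close> whole periods, counted from \<open>x\<close>, and then makes
    \<open>l\<close> steps.\<close>
  moreover have "(T ^^ (l + m * (N - 1))) ((T ^^ m) x) = (T ^^ l) x"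
  proof -
    have "l + m * (N - 1) + m = l + m * N" using N(1) by (cases N) auto
    then have "(T ^^ (l + m * (N - 1))) ((T ^^ m) x) = (T ^^ l) ((T ^^ (m * N)) x)"
      by (metis comp_apply funpow_add)
    then show ?thesis using funpow_mult_fixed[OF N(2)] by simp
  qed
  ultimately show ?thesis using that[of "(T ^^ m) x" N] ml N(1) by metis
qed

lemma periodic_orbit_finite:
  assumes "0 < n" "(T ^^ n) x = x" shows "finite (range (\<lambda>i. (T ^^ i) x))"
proof -
  note funpow_periodic_mod[OF assms(2)]
  moreover have "i mod n \<in> {..<n}" for i using assms(1) by simp
  ultimately have "range (\<lambda>i. (T ^^ i) x) \<subseteq> (\<lambda>i. (T ^^ i) x) ` {..<n}" by blast
  then show ?thesis using finite_surj by blast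
qed

lemma openin_dist_lt:
  fixes f :: "'a::metric_space \<Rightarrow> real"
  assumes "continuous_on Y f" shows "openin (top_of_set Y) {y \<in> Y. f y < c}"
proof -
  have "{y \<in> Y. f y < c} = Y \<inter> f -` {..<c}" by auto
  then show ?thesis using continuous_openin_preimage_gen[OF assms open_lessThan[of c]] by (simp only:)
qed

text \<open>The classical proof that transitivity and dense periodic points imply sensitivity. Every
  point is at least \<open>e / 2\<close> away from one of two disjoint periodic orbits. Near a point
  of \<open>U\<close> a periodic point returns to itself while another point of \<open>U\<close>
  follows the distant orbit.\<close>

lemma chaotic_sensitive:
  fixes Y :: "'a::metric_space set"
  assumes cpt: "compact Y" and T: "T \<in> chaotic_maps Y" and inf: "infinite Y"
  obtains \<delta> where "0 < \<delta>"
    "\<And>U. openin (top_of_set Y) U \<Longrightarrow> U \<noteq> {} \<Longrightarrow> \<exists>j. \<exists>y\<in>U. \<exists>z\<in>U. \<delta> \<le> dist ((T ^^ j) y) ((T ^^ j) z)"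
proof -
  note Tc = chaotic_mapsD[OF cpt T]
  have Y: "openin (top_of_set Y) Y" by (rule openin_subtopology_self)
  have Y0: "Y \<noteq> {}" using inf by blast
  obtain q1 n1 k1 where q1: "q1 \<in> Y" "0 < n1" "(T ^^ n1) q1 = q1" "(T ^^ k1) q1 \<in> Y"
    by (rule chaotic_periodic_visit[OF cpt T Y Y0 Y Y0])
  define O1 where "O1 = range (\<lambda>i. (T ^^ i) q1)"
  have O1: "finite O1" unfolding O1_def by (rule periodic_orbit_finite[OF q1(2,3)])
  have "openin (top_of_set Y) (Y - O1)"
    using finite_imp_closed[OF O1] by (metis Diff_eq open_Compl openin_open_Int)
  moreover have "Y - O1 \<noteq> {}" using O1 inf by (metis Diff_eq_empty_iff finite_subset)
  ultimately obtain q2 n2 k2 where q2: "q2 \<in> Y - O1" "0 < n2" "(T ^^ n2) q2 = q2" "(T ^^ k2) q2 \<in> Y"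
    by (rule chaotic_periodic_visit[OF cpt T _ _ Y Y0])
  define O2 where "O2 = range (\<lambda>i. (T ^^ i) q2)"
  have O2: "finite O2" unfolding O2_def by (rule periodic_orbit_finite[OF q2(2,3)])
  \<comment> \<open>A periodic orbit through a common point would bring \<open>q2\<close> back onto
    the orbit of \<open>q1\<close>.\<close>
  have disj: "O1 \<inter> O2 = {}"
  proof (rule ccontr)
    assume "O1 \<inter> O2 \<noteq> {}"
    then obtain x where "x \<in> O1" "x \<in> O2" by blast
    then obtain b a where "x = (T ^^ b) q1" "x = (T ^^ a) q2" unfolding O1_def O2_def by (elim rangeE)
    then have "(T ^^ a) q2 = (T ^^ b) q1" by simp
    then have "(T ^^ (a * (n2 - 1) + a)) q2 = (T ^^ (a * (n2 - 1) + b)) q1"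
      by (simp only: funpow_add comp_apply)
    moreover have "a * (n2 - 1) + a = a * n2" using q2(2) by (cases n2) auto
    ultimately have "q2 = (T ^^ (a * (n2 - 1) + b)) q1"
      using funpow_mult_fixed[OF q2(3), of a] by simp
    then have "q2 \<in> O1" unfolding O1_def by (rule range_eqI)
    then show False using q2(1) by simp
  qed
  define e where "e = Min ((\<lambda>(x, y). dist x y) ` (O1 \<times> O2))"
  have "q1 \<in> O1" "q2 \<in> O2" unfolding O1_def O2_def by (rule range_eqI[of _ _ 0], simp)+
  then have ne: "(\<lambda>(x, y). dist x y) ` (O1 \<times> O2) \<noteq> {}" by blast
  have fin: "finite ((\<lambda>(x, y). dist x y) ` (O1 \<times> O2))" using O1 O2 by simp
  have e: "e \<le> dist x y" if "x \<in> O1" "y \<in> O2" for x y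
    unfolding e_def using that fin by (intro Min_le) auto
  have "e \<in> (\<lambda>(x, y). dist x y) ` (O1 \<times> O2)" unfolding e_def by (rule Min_in[OF fin ne])
  then have e0: "e > 0" using disj by auto
  have "\<exists>j. \<exists>y\<in>U. \<exists>z\<in>U. e / 4 \<le> dist ((T ^^ j) y) ((T ^^ j) z)"
    if U: "openin (top_of_set Y) U" "U \<noteq> {}" for U
  proof -
    obtain p n k0 where p: "p \<in> U" "0 < n" "(T ^^ n) p = p" "(T ^^ k0) p \<in> U"
      by (rule chaotic_periodic_visit[OF cpt T U U])
    have "(\<forall>x\<in>O1. e / 2 \<le> dist p x) \<or> (\<forall>x\<in>O2. e / 2 \<le> dist p x)"
    proof (rule ccontr)
      assume "\<not> ?thesis"
      then obtain x y where "x \<in> O1" "y \<in> O2" "dist p x < e / 2" "dist p y < e / 2"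
        by (meson not_le)
      then show False using e[of x y] dist_triangle2[of x y p] by (simp add: dist_commute)
    qed
    then have "\<exists>q\<in>Y. \<forall>i. e / 2 \<le> dist p ((T ^^ i) q)"
      using q1(1) q2(1) unfolding O1_def O2_def by auto
    then obtain q where q: "q \<in> Y" "\<And>i. e / 2 \<le> dist p ((T ^^ i) q)" by auto
    \<comment> \<open>One continuous sum controls the distances at all times up to \<open>n\<close>,
      so openness needs a single function.\<close>
    define V where "V = {y \<in> Y. (\<Sum>i\<le>n. dist ((T ^^ i) y) ((T ^^ i) q)) < e / 4}"
    have oV: "openin (top_of_set Y) V"
      unfolding V_def
      by (intro openin_dist_lt continuous_on_sum continuous_on_dist continuous_on_funpow[OF Tc] continuous_on_const)
    have "q \<in> V" using q e0 by (simp add: V_def)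
    then have V: "V \<noteq> {}" by blast
    obtain z n' k where z: "z \<in> U" "0 < n'" "(T ^^ n') z = z" "(T ^^ k) z \<in> V"
      by (rule chaotic_periodic_visit[OF cpt T U oV V])
    \<comment> \<open>Waiting \<open>i\<close> more steps completes a multiple of the period
      \<open>n\<close>: \<open>p\<close> is back at its place, while \<open>z\<close> has followed
      \<open>q\<close> for only \<open>i \<le> n\<close> steps.\<close>
    define i where "i = n - k mod n"
    have "(k + i) mod n = 0" "i \<le> n"
    proof -
      have "k + i = n * (k div n) + n"
        using mod_less_divisor[OF p(2), of k] mult_div_mod_eq[of n k] unfolding i_def by linarith
      then show "(k + i) mod n = 0" by simp
    qed (simp add: i_def)
    then obtain m where m: "k + i = m * n" by (metis mod_0_imp_dvd dvdE mult.commute)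
    have "(T ^^ (k + i)) p = p" using funpow_mult_fixed[OF p(3)] m by simp
    moreover have "dist ((T ^^ (k + i)) z) ((T ^^ i) q) < e / 4"
    proof -
      have "dist ((T ^^ i) ((T ^^ k) z)) ((T ^^ i) q) \<le> (\<Sum>i\<le>n. dist ((T ^^ i) ((T ^^ k) z)) ((T ^^ i) q))"
        using \<open>i \<le> n\<close> by (intro member_le_sum) auto
      also have "\<dots> < e / 4" using z(4) by (simp add: V_def)
      finally show ?thesis by (simp add: funpow_add add.commute[of k i])
    qed
    ultimately have "e / 4 \<le> dist ((T ^^ (k + i)) p) ((T ^^ (k + i)) z)"
      using q(2)[of i] dist_triangle[of p "(T ^^ i) q" "(T ^^ (k + i)) z"] by (simp add: dist_commute)
    then show ?thesis using p(1) z(1) by blast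
  qed
  then show ?thesis using e0 by (intro that[of "e / 4"]) auto
qed

section \<open>Points that are not periodic, and fine grids\<close>

lemma chart_openin:
  assumes \<phi>: "chart Y \<phi>" and "0 \<le> u" "v \<le> 1"
  shows "openin (top_of_set Y) (\<phi> ` {u<..<v})"
proof -
  have "\<phi> ` {u<..<v} = Y - \<phi> ` ({0..1} - {u<..<v})"
  proof (intro equalityI subsetI)
    fix y assume "y \<in> \<phi> ` {u<..<v}"
    then obtain s where s: "s \<in> {u<..<v}" "y = \<phi> s" by blast
    have "\<phi> s \<noteq> \<phi> t" if t: "t \<in> {0..1} - {u<..<v}" for t
    proof
      assume eq: "\<phi> s = \<phi> t"
      have "s \<in> {0..1}" "t \<in> {0..1}" using s t assms by auto
      then have "s = t \<or> {s, t} = {0, 1}" using chart_eqD[OF \<phi> _ _ eq] by blast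
      then show False using s t assms by (auto simp: doubleton_eq_iff)
    qed
    note neq = this
    have "y \<notin> \<phi> ` ({0..1} - {u<..<v})"
    proof
      assume "y \<in> \<phi> ` ({0..1} - {u<..<v})"
      then obtain t where "y = \<phi> t" "t \<in> {0..1} - {u<..<v}" by (rule imageE)
      then show False using neq[of t] s(2) by simp
    qed
    moreover have "y \<in> Y" using s chart_in[OF \<phi>, of s] assms by simp
    ultimately show "y \<in> Y - \<phi> ` ({0..1} - {u<..<v})" by blast
  next
    fix y assume y: "y \<in> Y - \<phi> ` ({0..1} - {u<..<v})"
    then obtain s where "s \<in> {0..1}" "\<phi> s = y" using chartE[OF \<phi>] by blast
    then show "y \<in> \<phi> ` {u<..<v}" using y by blast
  qed
  moreover have "compact ({0..1} - {u<..<v})" by (intro compact_diff) auto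
  then have "compact (\<phi> ` ({0..1} - {u<..<v}))"
    by (rule compact_continuous_image[rotated])
      (rule continuous_on_subset[OF chart_continuous[OF \<phi>]], simp)
  then have "closed (\<phi> ` ({0..1} - {u<..<v}))" by (rule compact_imp_closed)
  ultimately show ?thesis by (metis Diff_eq open_Compl openin_open_Int)
qed

lemma chart_infinite: assumes "chart Y \<phi>" shows "infinite Y"
proof -
  have "inj_on \<phi> {0<..<1}"
  proof (rule inj_onI)
    fix x y :: real assume xy: "x \<in> {0<..<1}" "y \<in> {0<..<1}" "\<phi> x = \<phi> y"
    then have "x = y \<or> {x, y} = {0, 1}" using chart_eqD[OF assms, of x y] by simp
    then show "x = y" using xy by (auto simp: doubleton_eq_iff)
  qed
  then have "infinite (\<phi> ` {0<..<1})" using finite_imageD infinite_Ioo by (metis zero_less_one)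
  moreover have "\<phi> ` {0<..<1} \<subseteq> Y" using chart_in[OF assms] by auto
  ultimately show ?thesis using finite_subset by blast
qed

text \<open>If \<open>r\<close> is itself a fixed point, the value is \<open>1\<close> and not \<open>r\<close>: conjugacies move points that are
  isolated from the left in the fixed point set to such points, but not rationals to rationals.\<close>

definition first_fixed :: "(real \<Rightarrow> 'a) \<Rightarrow> ('a \<Rightarrow> 'a) \<Rightarrow> nat \<Rightarrow> real \<Rightarrow> real" where
  "first_fixed \<phi> T n r = (if r \<in> {0..1} \<and> (T ^^ n) (\<phi> r) \<noteq> \<phi> r
     then Inf (insert 1 {t \<in> {r..1}. (T ^^ n) (\<phi> t) = \<phi> t}) else 1)"

definition grid :: "(real \<Rightarrow> 'a) \<Rightarrow> ('a \<Rightarrow> 'a) \<Rightarrow> (nat \<times> rat) list \<Rightarrow> real set" where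
  "grid \<phi> T ps = {0, 1} \<union> (\<lambda>(n, r). first_fixed \<phi> T n (of_rat r)) ` set ps"

lemma first_fixed_in: "first_fixed \<phi> T n r \<in> {0..1}"
proof (cases "r \<in> {0..1} \<and> (T ^^ n) (\<phi> r) \<noteq> \<phi> r")
  case True
  let ?A = "insert 1 {t \<in> {r..1}. (T ^^ n) (\<phi> t) = \<phi> t}"
  have "bdd_below ?A" using True by (auto intro!: bdd_belowI[of _ r])
  then have "Inf ?A \<le> 1" by (intro cInf_lower) auto
  moreover have "0 \<le> Inf ?A" using True by (intro cInf_greatest) auto
  ultimately show ?thesis unfolding first_fixed_def if_P[OF True] by simp
next
  case False
  show ?thesis unfolding first_fixed_def if_not_P[OF False] by simp
qed

lemma finite_grid: "finite (grid \<phi> T ps)"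
  by (simp add: grid_def)

lemma grid_subset: "grid \<phi> T ps \<subseteq> {0..1}"
  using first_fixed_in by (force simp: grid_def)

lemma continuous_on_chart_funpow:
  assumes "chart Y \<phi>" "continuous_on Y T" "T \<in> Y \<rightarrow> Y"
  shows "continuous_on {0..1} (\<lambda>t. (T ^^ n) (\<phi> t))"
  by (rule continuous_on_compose2[OF continuous_on_funpow[OF assms(2,3)] chart_continuous[OF assms(1)]])
    (use chart_in[OF assms(1)] in auto)

text \<open>If \<open>T ^^ n\<close> were the identity on \<open>W\<close>, only \<open>n\<close>
  different iterates would act there, and finitely many continuous maps keep a small set small at
  all times, against sensitivity.\<close>

lemma chaotic_nowhere_periodic:
  fixes Y :: "'a::metric_space set"
  assumes cpt: "compact Y" and T: "T \<in> chaotic_maps Y" and inf: "infinite Y"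
    and W: "openin (top_of_set Y) W" "W \<noteq> {}" and n: "0 < n"
  shows "\<exists>y\<in>W. (T ^^ n) y \<noteq> y"
proof (rule ccontr)
  assume "\<not> ?thesis"
  then have fx: "(T ^^ n) y = y" if "y \<in> W" for y using that by blast
  note Tc = chaotic_mapsD[OF cpt T]
  obtain \<delta> where \<delta>: "0 < \<delta>"
    "\<And>U. openin (top_of_set Y) U \<Longrightarrow> U \<noteq> {} \<Longrightarrow> \<exists>j. \<exists>y\<in>U. \<exists>z\<in>U. \<delta> \<le> dist ((T ^^ j) y) ((T ^^ j) z)"
    using chaotic_sensitive[OF cpt T inf] by metis
  obtain w where w: "w \<in> W" using W(2) by blast
  define V where "V = {y \<in> Y. (\<Sum>i<n. dist ((T ^^ i) y) ((T ^^ i) w)) < \<delta> / 2}"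
  have "openin (top_of_set Y) V"
    unfolding V_def
    by (intro openin_dist_lt continuous_on_sum continuous_on_dist continuous_on_funpow[OF Tc] continuous_on_const)
  then have oWV: "openin (top_of_set Y) (W \<inter> V)" using W(1) by blast
  have "w \<in> W \<inter> V" using w \<delta>(1) W(1) openin_imp_subset by (fastforce simp: V_def)
  then have "W \<inter> V \<noteq> {}" by blast
  with oWV have "\<exists>j. \<exists>y\<in>W \<inter> V. \<exists>z\<in>W \<inter> V. \<delta> \<le> dist ((T ^^ j) y) ((T ^^ j) z)" by (rule \<delta>(2))
  then obtain j y z where jyz: "y \<in> W \<inter> V" "z \<in> W \<inter> V" "\<delta> \<le> dist ((T ^^ j) y) ((T ^^ j) z)"
    by (elim exE bexE)
  have *: "(T ^^ j) y = (T ^^ (j mod n)) y \<and> dist ((T ^^ (j mod n)) y) ((T ^^ (j mod n)) w) < \<delta> / 2"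
    if "y \<in> W \<inter> V" for y
  proof
    show "(T ^^ j) y = (T ^^ (j mod n)) y" by (rule funpow_periodic_mod[OF fx]) (use that in simp)
    have "dist ((T ^^ (j mod n)) y) ((T ^^ (j mod n)) w) \<le> (\<Sum>i<n. dist ((T ^^ i) y) ((T ^^ i) w))"
      using n by (intro member_le_sum) auto
    also have "\<dots> < \<delta> / 2" using that by (simp add: V_def)
    finally show "dist ((T ^^ (j mod n)) y) ((T ^^ (j mod n)) w) < \<delta> / 2" .
  qed
  have "dist ((T ^^ j) y) ((T ^^ j) z) < \<delta>"
    using *[OF jyz(1)] *[OF jyz(2)] dist_triangle2[of "(T ^^ (j mod n)) y" "(T ^^ (j mod n)) z" "(T ^^ (j mod n)) w"]
    by simp
  then show False using jyz(3) by simp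
qed

text \<open>Take a periodic coordinate \<open>t\<close> in the interval. To its left some coordinate
  is not fixed by the same iterate, and by continuity a rational one exists; the first fixed
  coordinate after it is at most \<open>t\<close>.\<close>

lemma first_fixed_dense:
  assumes \<phi>: "chart Y \<phi>" and T: "T \<in> chaotic_maps Y" and uv: "0 \<le> u" "u < v" "v \<le> 1"
  obtains n r t where "u < of_rat r" "of_rat r < t" "t < v" "(T ^^ n) (\<phi> (of_rat r)) \<noteq> \<phi> (of_rat r)"
    "(T ^^ n) (\<phi> t) = \<phi> t" "u < first_fixed \<phi> T n (of_rat r)" "first_fixed \<phi> T n (of_rat r) < v"
proof -
  note cpt = chart_compact[OF \<phi>]
  note Tc = chaotic_mapsD[OF cpt T]
  have "openin (top_of_set Y) (\<phi> ` {u<..<v})" "\<phi> ` {u<..<v} \<noteq> {}"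
    using chart_openin[OF \<phi> uv(1,3)] uv by auto
  note W = this
  obtain z n k where z: "z \<in> \<phi> ` {u<..<v}" "0 < n" "(T ^^ n) z = z" "(T ^^ k) z \<in> \<phi> ` {u<..<v}"
    by (rule chaotic_periodic_visit[OF cpt T W W])
  then obtain t where t: "u < t" "t < v" "z = \<phi> t" by auto
  have "openin (top_of_set Y) (\<phi> ` {u<..<t})" "\<phi> ` {u<..<t} \<noteq> {}"
    using chart_openin[OF \<phi> uv(1), of t] uv t by auto
  then obtain r0 where r0: "r0 \<in> {u<..<t}" "(T ^^ n) (\<phi> r0) \<noteq> \<phi> r0"
    using chaotic_nowhere_periodic[OF cpt T chart_infinite[OF \<phi>] _ _ z(2)] by blast
  define G where "G s = dist ((T ^^ n) (\<phi> s)) (\<phi> s)" for s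
  have "continuous_on {0..1} G" unfolding G_def
    by (intro continuous_on_dist continuous_on_chart_funpow[OF \<phi> Tc] chart_continuous[OF \<phi>])
  then have "continuous_on {u<..<t} G" by (rule continuous_on_subset) (use uv t in auto)
  then have "open ({u<..<t} \<inter> G -` {0<..})" by (intro continuous_open_preimage) auto
  moreover have "r0 \<in> {u<..<t} \<inter> G -` {0<..}" using r0 by (simp add: G_def)
  ultimately obtain d where d: "d > 0" "ball r0 d \<subseteq> {u<..<t} \<inter> G -` {0<..}" by (rule openE)
  obtain r where r: "r0 < of_rat r" "of_rat r < r0 + d" using of_rat_dense[of r0 "r0 + d"] d(1) by auto
  have "of_rat r \<in> ball r0 d" using r by (simp add: dist_real_def)
  then have r': "u < of_rat r" "of_rat r < t" "(T ^^ n) (\<phi> (of_rat r)) \<noteq> \<phi> (of_rat r)"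
    using d(2) by (auto simp: G_def)
  have r01: "0 \<le> real_of_rat r" "real_of_rat r \<le> 1" using r'(1,2) t(2) uv by linarith+
  let ?A = "insert 1 {s \<in> {of_rat r..1}. (T ^^ n) (\<phi> s) = \<phi> s}"
  have ff: "first_fixed \<phi> T n (of_rat r) = Inf ?A"
  proof -
    have "real_of_rat r \<in> {0..1}" unfolding atLeastAtMost_iff using r'(1,2) t(2) uv by linarith
    then have "real_of_rat r \<in> {0..1} \<and> (T ^^ n) (\<phi> (of_rat r)) \<noteq> \<phi> (of_rat r)" using r'(3) by blast
    then show ?thesis unfolding first_fixed_def by (rule if_P)
  qed
  have "bdd_below ?A" using r01 by (auto intro!: bdd_belowI[of _ "of_rat r"])
  then have "Inf ?A \<le> t" using z t r' uv by (intro cInf_lower) auto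
  moreover have "of_rat r \<le> Inf ?A" using r01 by (intro cInf_greatest) auto
  ultimately show ?thesis using that[of r t n] r' t z unfolding ff by auto
qed

text \<open>One grid point in each of \<open>N\<close> equal strips. The grid points around
  \<open>x\<close> lie in its own strip or an adjacent one, hence the bound
  \<open>3 / N\<close>.\<close>

lemma fine_grid:
  assumes \<phi>: "chart Y \<phi>" and T: "T \<in> chaotic_maps Y" and \<eta>: "0 < \<eta>"
  obtains ps where "\<And>x. x \<in> {0..1} \<Longrightarrow> \<exists>a\<in>grid \<phi> T ps. \<exists>b\<in>grid \<phi> T ps. a \<le> x \<and> x \<le> b \<and> b - a < \<eta>"
proof -
  obtain N where "3 / \<eta> < real N" using reals_Archimedean2 by blast
  moreover have "0 < 3 / \<eta>" using \<eta> by simp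
  ultimately have N0: "0 < real N" "3 / \<eta> < real N" by linarith+
  then have N: "0 < real N" "3 / real N < \<eta>" using \<eta> by (simp_all add: field_simps)
  have "\<exists>p. real i / real N < first_fixed \<phi> T (fst p) (of_rat (snd p)) \<and>
      first_fixed \<phi> T (fst p) (of_rat (snd p)) < real (Suc i) / real N" if "i < N" for i
  proof -
    have "0 \<le> real i / real N" "real i / real N < real (Suc i) / real N" "real (Suc i) / real N \<le> 1"
      using that N(1) by (auto simp: divide_simps)
    from first_fixed_dense[OF \<phi> T this] show ?thesis by (metis fst_conv snd_conv)
  qed
  then obtain p where p: "\<And>i. i < N \<Longrightarrow> real i / real N < first_fixed \<phi> T (fst (p i)) (of_rat (snd (p i)))"
    "\<And>i. i < N \<Longrightarrow> first_fixed \<phi> T (fst (p i)) (of_rat (snd (p i))) < real (Suc i) / real N"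
    by metis
  define c where "c i = first_fixed \<phi> T (fst (p i)) (of_rat (snd (p i)))" for i
  define ps where "ps = map p [0..<N]"
  have cg: "c i \<in> grid \<phi> T ps" if "i < N" for i
    using that by (auto simp: grid_def ps_def c_def case_prod_beta)
  have "\<exists>a\<in>grid \<phi> T ps. \<exists>b\<in>grid \<phi> T ps. a \<le> x \<and> x \<le> b \<and> b - a < \<eta>" if x: "x \<in> {0..1}" for x
  proof -
    define i where "i = nat \<lfloor>x * real N\<rfloor>"
    have i: "real i \<le> x * real N" "x * real N < real i + 1"
      using x N(1) by (auto simp: i_def)
    have xi: "real i / real N \<le> x" "x < (real i + 1) / real N" using i N(1) by (auto simp: field_simps)
    have "x * real N \<le> real N" using x N(1) by simp
    then have iN: "i \<le> N" using i(1) by linarith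
    have "\<exists>a\<in>grid \<phi> T ps. a \<le> x \<and> (real i - 1) / real N \<le> a"
    proof (cases i)
      case 0
      then show ?thesis using x N(1) by (intro bexI[of _ 0]) (auto simp: grid_def)
    next
      case (Suc k)
      then show ?thesis using p[of k] cg[of k] iN xi by (intro bexI[of _ "c k"]) (auto simp: c_def)
    qed
    moreover have "\<exists>b\<in>grid \<phi> T ps. x \<le> b \<and> b \<le> (real i + 2) / real N"
    proof (cases "Suc i < N")
      case True
      then show ?thesis using p[of "Suc i"] cg[of "Suc i"] xi
        by (intro bexI[of _ "c (Suc i)"]) (auto simp: c_def add_ac)
    next
      case False
      then have "real N \<le> real i + 2" by linarith
      then have "1 \<le> (real i + 2) / real N" using N(1) by (simp add: field_simps)
      then show ?thesis using x by (intro bexI[of _ 1]) (auto simp: grid_def)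
    qed
    moreover have "(real i + 2) / real N - (real i - 1) / real N = 3 / real N"
      by (simp add: diff_divide_distrib[symmetric])
    ultimately show ?thesis using N(2) by fastforce
  qed
  then show ?thesis by (rule that)
qed

text \<open>Sensitivity separates two iterates by \<open>\<delta>\<close>. Grid arcs over which the
  chart varies by less than \<open>\<delta> / 2\<close> must then be disjoint, since a common point
  would bring the iterates together.\<close>

lemma separating_grid_exists:
  assumes \<phi>: "chart Y \<phi>" and T: "T \<in> chaotic_maps Y"
  obtains ps where "separating \<phi> T (grid \<phi> T ps)"
proof -
  note cpt = chart_compact[OF \<phi>]
  note Tc = chaotic_mapsD[OF cpt T]
  obtain \<delta> where \<delta>: "0 < \<delta>"
    "\<And>U. openin (top_of_set Y) U \<Longrightarrow> U \<noteq> {} \<Longrightarrow> \<exists>j. \<exists>y\<in>U. \<exists>z\<in>U. \<delta> \<le> dist ((T ^^ j) y) ((T ^^ j) z)"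
    using chaotic_sensitive[OF cpt T chart_infinite[OF \<phi>]] by metis
  have "uniformly_continuous_on {0..1} \<phi>"
    by (rule compact_uniformly_continuous[OF chart_continuous[OF \<phi>]]) simp
  then obtain \<eta> where \<eta>: "0 < \<eta>"
    "\<And>s t. s \<in> {0..1} \<Longrightarrow> t \<in> {0..1} \<Longrightarrow> \<bar>s - t\<bar> < \<eta> \<Longrightarrow> dist (\<phi> s) (\<phi> t) < \<delta> / 2"
    using \<delta>(1) unfolding uniformly_continuous_on_def dist_real_def by (metis half_gt_zero)
  obtain ps where ps: "\<And>x. x \<in> {0..1} \<Longrightarrow> \<exists>a\<in>grid \<phi> T ps. \<exists>b\<in>grid \<phi> T ps. a \<le> x \<and> x \<le> b \<and> b - a < \<eta>"
    using fine_grid[OF \<phi> T \<eta>(1)] by metis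
  have key: "\<exists>a\<in>grid \<phi> T ps. \<exists>b\<in>grid \<phi> T ps. \<exists>c\<in>grid \<phi> T ps. \<exists>d\<in>grid \<phi> T ps. apart \<phi> a b c d \<and> \<alpha> \<in> {a..b} \<and> \<beta> \<in> {c..d}"
    if \<alpha>\<beta>: "\<alpha> \<in> {0..1}" "\<beta> \<in> {0..1}" "\<alpha> < \<beta>" and far: "\<delta> \<le> dist (\<phi> \<alpha>) (\<phi> \<beta>)" for \<alpha> \<beta>
  proof -
    obtain a b where ab: "a \<in> grid \<phi> T ps" "b \<in> grid \<phi> T ps" "a \<le> \<alpha>" "\<alpha> \<le> b" "b - a < \<eta>"
      using ps[OF \<alpha>\<beta>(1)] by blast
    obtain c d where cd: "c \<in> grid \<phi> T ps" "d \<in> grid \<phi> T ps" "c \<le> \<beta>" "\<beta> \<le> d" "d - c < \<eta>"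
      using ps[OF \<alpha>\<beta>(2)] by blast
    have in01: "a \<in> {0..1}" "b \<in> {0..1}" "c \<in> {0..1}" "d \<in> {0..1}"
      using ab cd grid_subset by blast+
    have "b < c"
    proof (rule ccontr)
      assume "\<not> b < c"
      then have "\<bar>\<alpha> - b\<bar> < \<eta>" "\<bar>\<beta> - b\<bar> < \<eta>" using ab cd \<alpha>\<beta>(3) by linarith+
      then have "dist (\<phi> \<alpha>) (\<phi> b) < \<delta> / 2" "dist (\<phi> \<beta>) (\<phi> b) < \<delta> / 2"
        using \<eta>(2) \<alpha>\<beta> in01 by blast+
      then show False using far dist_triangle2[of "\<phi> \<alpha>" "\<phi> \<beta>" "\<phi> b"] by simp
    qed
    \<comment> \<open>Otherwise both points would be within \<open>\<delta> / 2\<close> of the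
      seam.\<close>
    moreover have "0 < a \<or> d < 1" if "\<phi> 0 = \<phi> 1"
    proof (rule ccontr)
      assume "\<not> ?thesis"
      then have "a = 0" "d = 1" using in01 by auto
      then have "\<bar>\<alpha> - 0\<bar> < \<eta>" "\<bar>\<beta> - 1\<bar> < \<eta>" using ab cd \<alpha>\<beta> by auto
      then have "dist (\<phi> \<alpha>) (\<phi> 0) < \<delta> / 2" "dist (\<phi> \<beta>) (\<phi> 1) < \<delta> / 2"
        using \<eta>(2)[of \<alpha> 0] \<eta>(2)[of \<beta> 1] \<alpha>\<beta> by auto
      then show False using far that dist_triangle2[of "\<phi> \<alpha>" "\<phi> \<beta>" "\<phi> 0"] by simp
    qed
    ultimately have "apart \<phi> a b c d" using ab cd by (auto simp: apart_def)
    then show ?thesis using ab cd by (meson atLeastAtMost_iff)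
  qed
  have "\<exists>n. large \<phi> T (grid \<phi> T ps) n x y" if xy: "0 \<le> x" "x < y" "y \<le> 1" for x y
  proof -
    have "openin (top_of_set Y) (\<phi> ` {x<..<y})" "\<phi> ` {x<..<y} \<noteq> {}"
      using chart_openin[OF \<phi> xy(1,3)] xy by auto
    then obtain j u v where uv: "u \<in> {x<..<y}" "v \<in> {x<..<y}" "\<delta> \<le> dist ((T ^^ j) (\<phi> u)) ((T ^^ j) (\<phi> v))"
      using \<delta>(2) by blast
    have "(T ^^ j) (\<phi> u) \<in> Y" "(T ^^ j) (\<phi> v) \<in> Y"
      using funpow_in[OF Tc(2)] chart_in[OF \<phi>] uv xy by auto
    then obtain \<alpha> \<beta> where \<alpha>: "\<alpha> \<in> {0..1}" "(T ^^ j) (\<phi> u) = \<phi> \<alpha>" and \<beta>: "\<beta> \<in> {0..1}" "(T ^^ j) (\<phi> v) = \<phi> \<beta>"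
      using chartE[OF \<phi>] by metis
    have far: "\<delta> \<le> dist (\<phi> \<alpha>) (\<phi> \<beta>)" using uv(3) \<alpha> \<beta> by simp
    have hit: "hits \<phi> T j x y a b" if "\<alpha> \<in> {a..b} \<or> \<beta> \<in> {a..b}" for a b
    proof -
      have "u \<in> {x..y}" "v \<in> {x..y}" using uv(1,2) by auto
      then show ?thesis unfolding hits_def using that \<alpha>(2) \<beta>(2) by blast
    qed
    consider "\<alpha> < \<beta>" | "\<beta> < \<alpha>" using far \<delta>(1) by fastforce
    then have "\<exists>a\<in>grid \<phi> T ps. \<exists>b\<in>grid \<phi> T ps. \<exists>c\<in>grid \<phi> T ps. \<exists>d\<in>grid \<phi> T ps. apart \<phi> a b c d \<and>
       hits \<phi> T j x y a b \<and> hits \<phi> T j x y c d"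
    proof cases
      case 1
      from key[OF \<alpha>(1) \<beta>(1) 1 far] hit show ?thesis by meson
    next
      case 2
      have "\<delta> \<le> dist (\<phi> \<beta>) (\<phi> \<alpha>)" using far by (simp add: dist_commute)
      from key[OF \<beta>(1) \<alpha>(1) 2 this] hit show ?thesis by meson
    qed
    then show ?thesis unfolding large_def by (intro exI[of _ j] bexI[of _ j]) auto
  qed
  then show ?thesis using that[of ps] unfolding separating_def by blast
qed

section \<open>Transport of first fixed coordinates\<close>

lemma closed_fixed_coordinates:
  assumes "chart Y \<phi>" "continuous_on Y T" "T \<in> Y \<rightarrow> Y" "r \<in> {0..1}"
  shows "closed {t \<in> {r..1}. (T ^^ n) (\<phi> t) = \<phi> t}"
proof -
  have "continuous_on {0..1} (\<lambda>t. dist ((T ^^ n) (\<phi> t)) (\<phi> t))"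
    by (intro continuous_on_dist continuous_on_chart_funpow[OF assms(1-3)] chart_continuous[OF assms(1)])
  then have "continuous_on {r..1} (\<lambda>t. dist ((T ^^ n) (\<phi> t)) (\<phi> t))"
    by (rule continuous_on_subset) (use assms in auto)
  then have "closed ({r..1} \<inter> (\<lambda>t. dist ((T ^^ n) (\<phi> t)) (\<phi> t)) -` {0})"
    by (intro continuous_closed_preimage) auto
  moreover have "{t \<in> {r..1}. (T ^^ n) (\<phi> t) = \<phi> t} = {r..1} \<inter> (\<lambda>t. dist ((T ^^ n) (\<phi> t)) (\<phi> t)) -` {0}"
    by auto
  ultimately show ?thesis by (simp only:)
qed

text \<open>The fixed coordinates form a closed set, so the infimum is attained and is isolated from
  the left.\<close>

lemma first_fixed_cases:
  assumes "chart Y \<phi>" "continuous_on Y T" "T \<in> Y \<rightarrow> Y"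
  obtains "first_fixed \<phi> T n r = 1"
  | p where "first_fixed \<phi> T n r = p" "0 \<le> r" "r < p" "p < 1" "(T ^^ n) (\<phi> p) = \<phi> p"
      "\<And>t. r \<le> t \<Longrightarrow> t < p \<Longrightarrow> (T ^^ n) (\<phi> t) \<noteq> \<phi> t"
proof (cases "first_fixed \<phi> T n r = 1")
  case False
  define p where "p = first_fixed \<phi> T n r"
  define A where "A = insert 1 {t \<in> {r..1}. (T ^^ n) (\<phi> t) = \<phi> t}"
  have r: "r \<in> {0..1}" "(T ^^ n) (\<phi> r) \<noteq> \<phi> r" and p: "p = Inf A"
    using False by (auto simp: p_def first_fixed_def A_def split: if_splits)
  have bdd: "bdd_below A" using r by (auto simp: A_def intro!: bdd_belowI[of _ r])
  have "closed A" unfolding A_def using closed_fixed_coordinates[OF assms r(1)] by (rule closed_insert)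
  then have "p \<in> A" unfolding p using bdd by (intro closed_contains_Inf) (auto simp: A_def)
  moreover have "p \<noteq> 1" using False by (simp add: p_def)
  ultimately have pA: "r \<le> p" "p \<le> 1" "(T ^^ n) (\<phi> p) = \<phi> p" by (auto simp: A_def)
  then have "r \<noteq> p" using r by auto
  moreover have "(T ^^ n) (\<phi> t) \<noteq> \<phi> t" if "r \<le> t" "t < p" for t
  proof
    assume "(T ^^ n) (\<phi> t) = \<phi> t"
    then have "p \<le> t" unfolding p using bdd that pA by (intro cInf_lower) (auto simp: A_def)
    then show False using that by simp
  qed
  ultimately show ?thesis using that(2)[of p] pA r \<open>p \<noteq> 1\<close> by (auto simp: p_def)
qed (rule that)

lemma first_fixedI:
  assumes "0 \<le> r" "r < p" "p \<le> 1" "(T ^^ n) (\<phi> p) = \<phi> p"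
    and no: "\<And>t. r \<le> t \<Longrightarrow> t < p \<Longrightarrow> (T ^^ n) (\<phi> t) \<noteq> \<phi> t"
  shows "first_fixed \<phi> T n r = p"
proof -
  have "Inf (insert 1 {t \<in> {r..1}. (T ^^ n) (\<phi> t) = \<phi> t}) = p"
  proof (rule cInf_eq_minimum)
    show "p \<in> insert 1 {t \<in> {r..1}. (T ^^ n) (\<phi> t) = \<phi> t}" using assms by auto
    fix t assume "t \<in> insert 1 {t \<in> {r..1}. (T ^^ n) (\<phi> t) = \<phi> t}"
    then show "p \<le> t" using no[of t] assms(3) by (auto simp: not_less[symmetric])
  qed
  then show ?thesis using assms no[of r] by (simp add: first_fixed_def)
qed

text \<open>Supplies a rational index for the default value, for the transfer of a default.\<close>

lemma first_fixed_at_1: "first_fixed \<phi> T n 1 = 1"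
proof -
  have "insert 1 {t \<in> {1..1}. (T ^^ n) (\<phi> t) = \<phi> t} = {1}" by auto
  then show ?thesis unfolding first_fixed_def by (simp only: cInf_singleton if_cancel)
qed

text \<open>\<open>h r\<close> need not be rational, but there is no fixed coordinate between it and
  \<open>h p\<close>, so any rational strictly between them has \<open>h p\<close> as its first
  fixed coordinate.\<close>

lemma (in chart_conjugacy) first_fixed_transfer:
  assumes T: "continuous_on Y T"
  shows "\<exists>r'::rat. first_fixed \<phi>' S n (of_rat r') = h (first_fixed \<phi> T n r)"
proof (rule first_fixed_cases[OF \<phi> T T_in, of n r])
  assume "first_fixed \<phi> T n r = 1"
  then show ?thesis by (intro exI[of _ 1]) (simp add: first_fixed_at_1)
next
  fix p assume p: "first_fixed \<phi> T n r = p" "0 \<le> r" "r < p" "p < 1" "(T ^^ n) (\<phi> p) = \<phi> p"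
      "\<And>t. r \<le> t \<Longrightarrow> t < p \<Longrightarrow> (T ^^ n) (\<phi> t) \<noteq> \<phi> t"
  have in01: "r \<in> {0..1}" "p \<in> {0..1}" using p by auto
  then have "h r < h p" using less_iff p by blast
  then obtain r' where r': "h r < of_rat r'" "of_rat r' < h p" using of_rat_dense by blast
  have "first_fixed \<phi>' S n (of_rat r') = h p"
  proof (rule first_fixedI)
    have "0 \<le> h r" using in_range[OF in01(1)] by simp
    then show "0 \<le> real_of_rat r'" using r'(1) by linarith
    show "h p \<le> 1" using in_range[OF in01(2)] by auto
    show "(S ^^ n) (\<phi>' (h p)) = \<phi>' (h p)" using eq_transfer in01 p by blast
    fix t' assume t': "of_rat r' \<le> t'" "t' < h p"
    have "t' \<in> {0..1}" using t' r' in_range[OF in01(1)] in_range[OF in01(2)] by auto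
    then obtain t where t: "t \<in> {0..1}" "h t = t'" by (rule surjE)
    have "h r < h t" "h t < h p" using t t' r' by auto
    then have "r < t" "t < p" using less_iff in01 t(1) by blast+
    then show "(S ^^ n) (\<phi>' t') \<noteq> \<phi>' t'" using p(6)[of t] eq_transfer[OF t(1) t(1)] t(2) by simp
  qed (use r' in simp)
  then show ?thesis using p(1) by blast
qed

lemma (in chart_conjugacy) grid_transfer:
  assumes T: "continuous_on Y T"
  obtains ps' where "grid \<phi>' S ps' = h ` grid \<phi> T ps"
proof -
  have "\<exists>R :: nat \<times> rat \<Rightarrow> rat. \<forall>p. first_fixed \<phi>' S (fst p) (of_rat (R p)) = h (first_fixed \<phi> T (fst p) (of_rat (snd p)))"
    by (intro choice allI first_fixed_transfer[OF T])
  then obtain R :: "nat \<times> rat \<Rightarrow> rat" where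
    R: "\<And>p. first_fixed \<phi>' S (fst p) (of_rat (R p)) = h (first_fixed \<phi> T (fst p) (of_rat (snd p)))" by blast
  have "grid \<phi>' S (map (\<lambda>p. (fst p, R p)) ps) = h ` grid \<phi> T ps"
    by (simp add: grid_def R image_Un image_image case_prod_beta)
  then show ?thesis by (rule that)
qed

section \<open>Borel dependence on the map\<close>

text \<open>Evaluation at a point is 1-Lipschitz for the uniform metric, hence continuous.\<close>

lemma measurable_eval_point:
  assumes cpt: "compact Y" and x: "x \<in> Y"
  shows "(\<lambda>T. T x) \<in> borel_measurable (chaotic_maps_borel Y)"
  unfolding chaotic_maps_borel_def
proof (rule measurable_restrict_space1, rule borel_measurableI)
  let ?G = "{U. openin (mtopology_of (self_maps Y)) U}"
  have G: "?G \<subseteq> Pow (mspace (self_maps Y))" using openin_subset by fastforce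
  have Y: "Y \<noteq> {}" using x by blast
  interpret D: Metric_space "mspace (self_maps Y)" "mdist (self_maps Y)" by simp
  fix S :: "'a set" assume S: "open S"
  have "openin D.mtopology ((\<lambda>T. T x) -` S \<inter> mspace (self_maps Y))"
    unfolding D.openin_mtopology
  proof (intro conjI allI impI)
    fix T assume T: "T \<in> (\<lambda>T. T x) -` S \<inter> mspace (self_maps Y)"
    then obtain e where e: "e > 0" "ball (T x) e \<subseteq> S" using S openE[of S "T x"] by auto
    have "D.mball T e \<subseteq> (\<lambda>T. T x) -` S \<inter> mspace (self_maps Y)"
    proof
      fix T' assume T': "T' \<in> D.mball T e"
      have "dist (T x) (T' x) \<le> mdist (self_maps Y) T T'"
        using mdist_self_maps_le[OF Y, of T T' "mdist (self_maps Y) T T'"] T' x by (simp add: D.in_mball)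
      then have "T' x \<in> ball (T x) e" using T' by (simp add: D.in_mball)
      then show "T' \<in> (\<lambda>T. T x) -` S \<inter> mspace (self_maps Y)" using e(2) T' by (auto simp: D.in_mball)
    qed
    then show "\<exists>r>0. D.mball T r \<subseteq> (\<lambda>T. T x) -` S \<inter> mspace (self_maps Y)" using e(1) by blast
  qed auto
  then have "(\<lambda>T. T x) -` S \<inter> mspace (self_maps Y) \<in> ?G" by (simp add: mtopology_of_def)
  then show "(\<lambda>T. T x) -` S \<inter> space (sigma (mspace (self_maps Y)) ?G) \<in> sets (sigma (mspace (self_maps Y)) ?G)"
    using G by (simp add: space_measure_of sets_measure_of sigma_sets.Basic)
qed

lemma compact_dense_sequence:
  fixes Y :: "'a::metric_space set"
  assumes "compact Y" "Y \<noteq> {}"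
  shows "\<exists>d :: nat \<Rightarrow> 'a. range d \<subseteq> Y \<and> (\<forall>y\<in>Y. \<forall>e>0. \<exists>i. dist y (d i) < e)"
proof -
  have "\<exists>D. finite D \<and> D \<subseteq> Y \<and> Y \<subseteq> (\<Union>x\<in>D. ball x (1 / real (Suc k)))" for k
    using seq_compact_imp_totally_bounded[OF compact_imp_seq_compact[OF assms(1)]] by simp
  then obtain D where D: "\<And>k. finite (D k) \<and> D k \<subseteq> Y \<and> Y \<subseteq> (\<Union>x\<in>D k. ball x (1 / real (Suc k)))"
    by metis
  define d where "d = from_nat_into (\<Union>k. D k)"
  have cnt: "countable (\<Union>k. D k)" using D by (intro countable_UN) (auto intro: countable_finite)
  have ne: "(\<Union>k. D k) \<noteq> {}" using D[of 0] assms(2) by fastforce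
  have "range d = (\<Union>k. D k)" unfolding d_def using range_from_nat_into[OF ne cnt] .
  moreover have "\<exists>i. dist y (d i) < e" if "y \<in> Y" "0 < e" for y e
  proof -
    obtain k where k: "1 / real (Suc k) < e" using nat_approx_posE[OF \<open>0 < e\<close>] by blast
    obtain x where x: "x \<in> D k" "dist x y < 1 / real (Suc k)" using D[of k] \<open>y \<in> Y\<close> by auto
    have "x \<in> range d" using x(1) \<open>range d = (\<Union>k. D k)\<close> by blast
    then obtain i where "x = d i" by (rule rangeE)
    then show ?thesis using x(2) k by (intro exI[of _ i]) (simp add: dist_commute)
  qed
  moreover have "(\<Union>k. D k) \<subseteq> Y" using D by blast
  ultimately show ?thesis by (intro exI[of _ d]) simp
qed

text \<open>Stated for an indexed family of maps; in the applications \<open>N\<close> is the space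
  of chaotic maps or a part of it, and \<open>T\<close> is the identity.\<close>

locale map_space =
  fixes N :: "'b measure" and Y :: "'a::{metric_space, second_countable_topology} set"
    and T :: "'b \<Rightarrow> 'a \<Rightarrow> 'a"
  assumes compact_Y: "compact Y"
    and maps: "\<And>w. w \<in> space N \<Longrightarrow> continuous_on Y (T w) \<and> T w \<in> Y \<rightarrow> Y"
    and eval_point: "\<And>x. x \<in> Y \<Longrightarrow> (\<lambda>w. T w x) \<in> borel_measurable N"
begin

text \<open>The argument is replaced by the first close point of a countable dense sequence, which
  reduces evaluation to fixed points; continuity of each map allows the limit.\<close>

lemma measurable_eval:
  assumes y [measurable]: "y \<in> borel_measurable N" and yY: "\<And>w. w \<in> space N \<Longrightarrow> y w \<in> Y"
  shows "(\<lambda>w. T w (y w)) \<in> borel_measurable N"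
proof (cases "Y = {}")
  case True
  then have "space N = {}" using yY by auto
  then show ?thesis by (simp add: measurable_def)
next
  case False
  obtain d :: "nat \<Rightarrow> 'a" where d: "range d \<subseteq> Y" "\<forall>y\<in>Y. \<forall>e>0. \<exists>i. dist y (d i) < e"
    using compact_dense_sequence[OF compact_Y False] by (elim exE conjE)
  define ix where "ix k w = (LEAST i. dist (y w) (d i) < 1 / real (Suc k))" for k w
  have ix: "dist (y w) (d (ix k w)) < 1 / real (Suc k)" if "w \<in> space N" for k w
    unfolding ix_def by (rule LeastI_ex) (rule d(2)[rule_format, OF yY[OF that]], simp)
  have [measurable]: "ix k \<in> N \<rightarrow>\<^sub>M count_space UNIV" for k
    unfolding ix_def by measurable
  show ?thesis
  proof (rule borel_measurable_LIMSEQ_metric)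
    show "(\<lambda>w. T w (d (ix k w))) \<in> borel_measurable N" for k
      by (rule measurable_compose_countable[of "\<lambda>i w. T w (d i)"])
        (use d(1) in \<open>auto intro: eval_point\<close>)
    fix w assume T: "w \<in> space N"
    have "(\<lambda>k. d (ix k w)) \<longlonglongrightarrow> y w"
    proof (rule metric_tendsto_imp_tendsto[where f = "\<lambda>k. 1 / real (Suc k)" and a = 0])
      show "(\<lambda>k. 1 / real (Suc k)) \<longlonglongrightarrow> 0" by (rule LIMSEQ_inverse_real_of_nat[unfolded inverse_eq_divide])
      show "\<forall>\<^sub>F k in sequentially. dist (d (ix k w)) (y w) \<le> dist (1 / real (Suc k)) 0"
        using ix[OF T] by (intro always_eventually allI) (simp add: dist_commute less_imp_le)
    qed
    moreover have "continuous_on Y (T w)" using maps[OF T] by simp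
    ultimately show "(\<lambda>k. T w (d (ix k w))) \<longlonglongrightarrow> T w (y w)"
      using continuous_on_tendsto_compose[of Y "T w" "\<lambda>k. d (ix k w)" "y w" sequentially] yY[OF T] d(1)
      by (simp add: image_subset_iff)
  qed
qed

lemma measurable_funpow_eval:
  assumes "y \<in> borel_measurable N" "\<And>w. w \<in> space N \<Longrightarrow> y w \<in> Y"
  shows "(\<lambda>w. (T w ^^ j) (y w)) \<in> borel_measurable N"
proof (induction j)
  case (Suc j)
  have "(T w ^^ j) (y w) \<in> Y" if "w \<in> space N" for w
    using maps[OF that] assms(2)[OF that] by (intro funpow_in) simp_all
  then have "(\<lambda>w. T w ((T w ^^ j) (y w))) \<in> borel_measurable N"
    by (rule measurable_eval[OF Suc])
  then show ?case by simp
qed (use assms in simp)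

end

text \<open>Moves the rationals into a varying interval, so that one countable index set serves for
  all intervals.\<close>

definition clamp_between :: "real \<Rightarrow> real \<Rightarrow> real \<Rightarrow> real" where
  "clamp_between a b x = max a (min b x)"

text \<open>Turns a real existential quantifier into countable ones: continuity approximates a zero
  at clamped rationals, and compactness attains the infimum 0.\<close>

lemma zero_in_rectangle_iff:
  fixes F :: "real \<Rightarrow> real \<Rightarrow> real"
  assumes cont: "continuous_on ({a..b} \<times> {c..d}) (\<lambda>(u, v). F u v)" and nonneg: "\<And>u v. 0 \<le> F u v"
  shows "(\<exists>u\<in>{a..b}. \<exists>v\<in>{c..d}. F u v = 0) \<longleftrightarrow> a \<le> b \<and> c \<le> d \<and>
    (\<forall>k. \<exists>p q :: rat. F (clamp_between a b (of_rat p)) (clamp_between c d (of_rat q)) < 1 / real (Suc k))"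
proof
  assume "\<exists>u\<in>{a..b}. \<exists>v\<in>{c..d}. F u v = 0"
  then obtain u v where uv: "u \<in> {a..b}" "v \<in> {c..d}" "F u v = 0" by blast
  have "\<exists>p q :: rat. F (clamp_between a b (of_rat p)) (clamp_between c d (of_rat q)) < 1 / real (Suc k)" for k
  proof -
    have "0 < 1 / real (Suc k)" by simp
    then obtain \<delta> where \<delta>: "\<delta> > 0" "\<And>w. w \<in> {a..b} \<times> {c..d} \<Longrightarrow> dist w (u, v) < \<delta> \<Longrightarrow>
        dist (case w of (u, v) \<Rightarrow> F u v) (case (u, v) of (u, v) \<Rightarrow> F u v) < 1 / real (Suc k)"
      using cont[unfolded continuous_on_iff, rule_format, of "(u, v)" "1 / real (Suc k)"] uv by auto
    obtain p where p: "u < of_rat p" "of_rat p < u + \<delta> / 2" using of_rat_dense[of u "u + \<delta> / 2"] \<delta>(1) by auto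
    obtain q where q: "v < of_rat q" "of_rat q < v + \<delta> / 2" using of_rat_dense[of v "v + \<delta> / 2"] \<delta>(1) by auto
    define u' v' where "u' = clamp_between a b (of_rat p)" and "v' = clamp_between c d (of_rat q)"
    have u': "u' \<in> {a..b}" "dist u' u < \<delta> / 2" and v': "v' \<in> {c..d}" "dist v' v < \<delta> / 2"
      using uv p q by (auto simp: u'_def v'_def clamp_between_def dist_real_def)
    have "dist (u', v') (u, v) \<le> dist u' u + dist v' v"
      by (simp add: dist_prod_def sqrt_sum_squares_le_sum)
    then have "dist (F u' v') (F u v) < 1 / real (Suc k)" using \<delta>(2)[of "(u', v')"] u' v' by simp
    then have "F u' v' < 1 / real (Suc k)" using uv(3) by (simp add: dist_real_def)
    then show ?thesis unfolding u'_def v'_def by blast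
  qed
  then show "a \<le> b \<and> c \<le> d \<and>
    (\<forall>k. \<exists>p q :: rat. F (clamp_between a b (of_rat p)) (clamp_between c d (of_rat q)) < 1 / real (Suc k))"
    using uv by auto
next
  assume r: "a \<le> b \<and> c \<le> d \<and>
    (\<forall>k. \<exists>p q :: rat. F (clamp_between a b (of_rat p)) (clamp_between c d (of_rat q)) < 1 / real (Suc k))"
  have "compact ({a..b} \<times> {c..d})" by (intro compact_Times) auto
  moreover have "{a..b} \<times> {c..d} \<noteq> {}" using r by auto
  ultimately have "\<exists>x\<in>{a..b} \<times> {c..d}. \<forall>y\<in>{a..b} \<times> {c..d}. (case x of (u, v) \<Rightarrow> F u v) \<le> (case y of (u, v) \<Rightarrow> F u v)"
    using cont by (rule continuous_attains_inf)
  then obtain u v where uv: "u \<in> {a..b}" "v \<in> {c..d}"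
    "\<And>u' v'. u' \<in> {a..b} \<Longrightarrow> v' \<in> {c..d} \<Longrightarrow> F u v \<le> F u' v'" by auto
  have "F u v = 0"
  proof (rule ccontr)
    assume "F u v \<noteq> 0"
    then have "0 < F u v" using nonneg[of u v] by simp
    then obtain k where k: "1 / real (Suc k) < F u v" using nat_approx_posE by blast
    obtain p q :: rat where "F (clamp_between a b (of_rat p)) (clamp_between c d (of_rat q)) < 1 / real (Suc k)"
      using r by blast
    moreover have "F u v \<le> F (clamp_between a b (of_rat p)) (clamp_between c d (of_rat q))"
      using r by (intro uv(3)) (auto simp: clamp_between_def)
    ultimately show False using k by simp
  qed
  then show "\<exists>u\<in>{a..b}. \<exists>v\<in>{c..d}. F u v = 0" using uv by blast
qed

text \<open>\<open>large\<close> is monotone in the interval, and every interval contains one with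
  rational ends.\<close>

lemma separating_iff_rat:
  "separating \<phi> T Q \<longleftrightarrow> (\<forall>p q :: rat. real_of_rat p \<in> {0..1} \<longrightarrow> real_of_rat q \<in> {0..1} \<longrightarrow> p < q \<longrightarrow>
      (\<exists>n. large \<phi> T Q n (of_rat p) (of_rat q)))" (is "_ \<longleftrightarrow> ?R")
proof
  assume R: ?R
  show "separating \<phi> T Q" unfolding separating_def
  proof (intro allI impI)
    fix x y :: real assume xy: "0 \<le> x" "x < y" "y \<le> 1"
    obtain p where p: "x < of_rat p" "of_rat p < y" using of_rat_dense[OF xy(2)] by (elim exE conjE)
    obtain q where q: "of_rat p < real_of_rat q" "of_rat q < y" using of_rat_dense[OF p(2)] by (elim exE conjE)
    have in01: "real_of_rat p \<in> {0..1}" "real_of_rat q \<in> {0..1}"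
      unfolding atLeastAtMost_iff using p q xy by linarith+
    have pq: "p < q" using q(1) by (simp only: of_rat_less)
    obtain n where "large \<phi> T Q n (of_rat p) (of_rat q)"
      using R[THEN spec, THEN spec, THEN mp, THEN mp, THEN mp, OF in01 pq] by (elim exE)
    then have "large \<phi> T Q n x y" using p(1) q(2) by (rule large_mono[OF _ less_imp_le less_imp_le])
    then show "\<exists>n. large \<phi> T Q n x y" by (rule exI)
  qed
next
  assume S: "separating \<phi> T Q"
  show ?R
  proof (intro allI impI)
    fix p q :: rat assume pq: "real_of_rat p \<in> {0..1}" "real_of_rat q \<in> {0..1}" "p < q"
    have "0 \<le> real_of_rat p" "real_of_rat q \<le> 1" using pq(1,2) unfolding atLeastAtMost_iff by linarith+
    moreover have "real_of_rat p < of_rat q" using pq(3) by (simp only: of_rat_less)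
    ultimately show "\<exists>n. large \<phi> T Q n (of_rat p) (of_rat q)"
      using S[unfolded separating_def, THEN spec, of "of_rat p", THEN spec, of "of_rat q"] by (simp only: simp_thms)
  qed
qed

text \<open>The chart may depend on the map as well, because on the circle it starts at a point that
  depends on the map.\<close>

locale chart_field = map_space N Y T
  for N :: "'b measure" and Y :: "'a::{metric_space, second_countable_topology} set"
    and T :: "'b \<Rightarrow> 'a \<Rightarrow> 'a" +
  fixes \<Phi> :: "'b \<Rightarrow> real \<Rightarrow> 'a"
  assumes chart: "\<And>w. w \<in> space N \<Longrightarrow> chart Y (\<Phi> w)"
    and measurable_chart: "\<And>x. x \<in> borel_measurable N \<Longrightarrow> (\<And>w. w \<in> space N \<Longrightarrow> x w \<in> {0..1}) \<Longrightarrow>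
      (\<lambda>w. \<Phi> w (x w)) \<in> borel_measurable N"
begin

section \<open>Measurability of grid points, marks and patterns\<close>

definition coord :: "('b \<Rightarrow> real) \<Rightarrow> bool" where
  "coord x \<longleftrightarrow> x \<in> borel_measurable N \<and> (\<forall>w\<in>space N. x w \<in> {0..1})"

lemma coordD: "coord x \<Longrightarrow> x \<in> borel_measurable N" "coord x \<Longrightarrow> w \<in> space N \<Longrightarrow> x w \<in> {0..1}"
  by (simp_all add: coord_def)

lemma coord_const [simp]: "c \<in> {0..1} \<Longrightarrow> coord (\<lambda>_. c)"
  by (simp add: coord_def)

lemma measurable_chart_funpow:
  assumes "coord x" shows "(\<lambda>w. (T w ^^ j) (\<Phi> w (x w))) \<in> borel_measurable N"
  by (rule measurable_funpow_eval[OF measurable_chart])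
    (use assms chart_in[OF chart] in \<open>auto simp: coord_def simp del: atLeastAtMost_iff\<close>)

lemma pred_zero:
  fixes F :: "'b \<Rightarrow> real \<Rightarrow> real \<Rightarrow> real"
  assumes co: "coord a" "coord b" "coord c" "coord d"
    and cont: "\<And>w. w \<in> space N \<Longrightarrow> continuous_on ({0..1} \<times> {0..1}) (\<lambda>(u, v). F w u v)"
    and nonneg: "\<And>w u v. 0 \<le> F w u v"
    and meas: "\<And>u v. coord u \<Longrightarrow> coord v \<Longrightarrow> (\<lambda>w. F w (u w) (v w)) \<in> borel_measurable N"
  shows "Measurable.pred N (\<lambda>w. \<exists>u\<in>{a w..b w}. \<exists>v\<in>{c w..d w}. F w u v = 0)"
proof -
  note [measurable] = coordD(1)[OF co(1)] coordD(1)[OF co(2)] coordD(1)[OF co(3)] coordD(1)[OF co(4)]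
  define cl where "cl a b p w = min 1 (max 0 (clamp_between (a w) (b w) (of_rat p)))"
    for a b :: "'b \<Rightarrow> real" and p w
  have cl: "coord (cl a b p)" if "coord a" "coord b" for a b p
  proof -
    note [measurable] = coordD(1)[OF that(1)] coordD(1)[OF that(2)]
    have "cl a b p \<in> borel_measurable N" unfolding cl_def[abs_def] clamp_between_def by measurable
    then show ?thesis by (simp add: coord_def cl_def)
  qed
  have cl_eq: "cl a b p w = clamp_between (a w) (b w) (of_rat p)"
    if "coord a" "coord b" "w \<in> space N" "a w \<le> b w" for a b p w
    using coordD(2)[OF that(1,3)] coordD(2)[OF that(2,3)] that(4) by (auto simp: cl_def clamp_between_def)
  have [measurable]: "(\<lambda>w. F w (cl a b p w) (cl c d q w)) \<in> borel_measurable N" for p q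
    using cl co by (intro meas) auto
  have "Measurable.pred N (\<lambda>w. a w \<le> b w \<and> c w \<le> d w \<and>
      (\<forall>k. \<exists>p q :: rat. F w (cl a b p w) (cl c d q w) < 1 / real (Suc k)))"
    by measurable
  moreover have "(\<exists>u\<in>{a w..b w}. \<exists>v\<in>{c w..d w}. F w u v = 0) \<longleftrightarrow>
      a w \<le> b w \<and> c w \<le> d w \<and> (\<forall>k. \<exists>p q :: rat. F w (cl a b p w) (cl c d q w) < 1 / real (Suc k))"
    if T: "w \<in> space N" for w
  proof -
    have "{a w..b w} \<times> {c w..d w} \<subseteq> {0..1} \<times> {0..1}"
      using coordD(2)[OF co(1) T] coordD(2)[OF co(2) T] coordD(2)[OF co(3) T] coordD(2)[OF co(4) T] by auto
    then have "continuous_on ({a w..b w} \<times> {c w..d w}) (\<lambda>(u, v). F w u v)"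
      using cont[OF T] by (rule continuous_on_subset[rotated])
    from zero_in_rectangle_iff[OF this nonneg] show ?thesis
      using cl_eq[OF co(1,2) T] cl_eq[OF co(3,4) T] by (auto cong: conj_cong)
  qed
  ultimately show ?thesis by (simp cong: measurable_cong)
qed

lemma continuous_chart_pair:
  assumes T: "w \<in> space N"
  shows "continuous_on ({0..1} \<times> {0..1}) (\<lambda>(u, v). dist ((T w ^^ i) (\<Phi> w u)) ((T w ^^ j) (\<Phi> w v)))"
proof -
  have "continuous_on {0..1} (\<lambda>t. (T w ^^ j) (\<Phi> w t))" for j
    using continuous_on_chart_funpow[OF chart[OF T]] maps[OF T] by blast
  then have "continuous_on ({0..1} \<times> {0..1}) (\<lambda>z. dist ((T w ^^ i) (\<Phi> w (fst z))) ((T w ^^ j) (\<Phi> w (snd z))))"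
    by (intro continuous_on_dist continuous_on_compose2[OF _ continuous_on_fst[OF continuous_on_id]]
        continuous_on_compose2[OF _ continuous_on_snd[OF continuous_on_id]]) auto
  then show ?thesis by (simp add: case_prod_beta)
qed

lemma pred_hits:
  assumes "coord x" "coord t" "coord a" "coord b"
  shows "Measurable.pred N (\<lambda>w. hits (\<Phi> w) (T w) j (x w) (t w) (a w) (b w))"
proof -
  have "Measurable.pred N (\<lambda>w. \<exists>u\<in>{x w..t w}. \<exists>v\<in>{a w..b w}. dist ((T w ^^ j) (\<Phi> w u)) ((T w ^^ 0) (\<Phi> w v)) = 0)"
  proof (rule pred_zero[OF assms continuous_chart_pair])
    fix u v assume "coord u" "coord v"
    then show "(\<lambda>w. dist ((T w ^^ j) (\<Phi> w (u w))) ((T w ^^ 0) (\<Phi> w (v w)))) \<in> borel_measurable N"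
      by (intro borel_measurable_dist measurable_chart_funpow)
  qed simp_all
  then show ?thesis by (simp add: hits_def)
qed

lemma pred_fixed_between:
  assumes "coord a" "coord b"
  shows "Measurable.pred N (\<lambda>w. \<exists>t\<in>{a w..b w}. (T w ^^ n) (\<Phi> w t) = \<Phi> w t)"
proof -
  \<comment> \<open>One quantifier only; the second one ranges over a single point to fit
    \<open>pred_zero\<close>.\<close>
  have "Measurable.pred N (\<lambda>w. \<exists>u\<in>{a w..b w}. \<exists>v\<in>{0..0::real}. dist ((T w ^^ n) (\<Phi> w u)) (\<Phi> w u) = 0)"
  proof (rule pred_zero[OF assms coord_const coord_const])
    fix w assume T: "w \<in> space N"
    have "continuous_on {0..1} (\<lambda>t. (T w ^^ j) (\<Phi> w t))" for j
      using continuous_on_chart_funpow[OF chart[OF T]] maps[OF T] by blast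
    from this[of n] this[of 0]
    have "continuous_on ({0..1} \<times> {0..1}) (\<lambda>z. dist ((T w ^^ n) (\<Phi> w (fst z))) (\<Phi> w (fst z)))"
      by (intro continuous_on_dist continuous_on_compose2[OF _ continuous_on_fst[OF continuous_on_id]]) auto
    then show "continuous_on ({0..1} \<times> {0..1}) (\<lambda>(u, v). dist ((T w ^^ n) (\<Phi> w u)) (\<Phi> w u))"
      by (simp add: case_prod_beta)
  next
    fix u v assume "coord u" "coord v"
    then show "(\<lambda>w. dist ((T w ^^ n) (\<Phi> w (u w))) (\<Phi> w (u w))) \<in> borel_measurable N"
      using measurable_chart_funpow[of u 0] by (intro borel_measurable_dist measurable_chart_funpow) auto
  qed simp_all
  then show ?thesis by simp
qed

lemma pred_chart_eq:
  assumes "coord u" "coord v" shows "Measurable.pred N (\<lambda>w. (T w ^^ j) (\<Phi> w (u w)) = \<Phi> w (v w))"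
proof -
  have [measurable]: "(\<lambda>w. dist ((T w ^^ j) (\<Phi> w (u w))) ((T w ^^ 0) (\<Phi> w (v w)))) \<in> borel_measurable N"
    by (intro borel_measurable_dist measurable_chart_funpow assms)
  have "Measurable.pred N (\<lambda>w. dist ((T w ^^ j) (\<Phi> w (u w))) ((T w ^^ 0) (\<Phi> w (v w))) = 0)" by measurable
  then show ?thesis by simp
qed

text \<open>Below 1 the infimum is attained, so sublevel sets become existence statements. The first
  conjunct excludes a fixed \<open>r\<close>, for which the value is the default 1.\<close>

lemma first_fixed_le_iff:
  assumes T: "w \<in> space N" and r: "r \<in> {0..1}" and s: "s \<in> {0..1}" "s < 1"
  shows "first_fixed (\<Phi> w) (T w) n r \<le> s \<longleftrightarrow>
    (T w ^^ n) (\<Phi> w r) \<noteq> \<Phi> w r \<and> (\<exists>t\<in>{r..s}. (T w ^^ n) (\<Phi> w t) = \<Phi> w t)"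
proof (rule first_fixed_cases[OF chart[OF T], of "T w" n r])
  assume one: "first_fixed (\<Phi> w) (T w) n r = 1"
  have "\<not> (\<exists>t\<in>{r..s}. (T w ^^ n) (\<Phi> w t) = \<Phi> w t)" if nf: "(T w ^^ n) (\<Phi> w r) \<noteq> \<Phi> w r"
  proof
    assume "\<exists>t\<in>{r..s}. (T w ^^ n) (\<Phi> w t) = \<Phi> w t"
    then obtain t where t: "t \<in> {r..s}" "(T w ^^ n) (\<Phi> w t) = \<Phi> w t" by blast
    let ?A = "insert 1 {t \<in> {r..1}. (T w ^^ n) (\<Phi> w t) = \<Phi> w t}"
    have "bdd_below ?A" using r by (auto intro!: bdd_belowI[of _ r])
    then have "Inf ?A \<le> t" using t s by (intro cInf_lower) auto
    moreover have "first_fixed (\<Phi> w) (T w) n r = Inf ?A" using r nf by (simp add: first_fixed_def)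
    ultimately show False using one t s by auto
  qed
  then show ?thesis using one s by auto
next
  fix p assume p: "first_fixed (\<Phi> w) (T w) n r = p" "0 \<le> r" "r < p" "p < 1" "(T w ^^ n) (\<Phi> w p) = \<Phi> w p"
      "\<And>t. r \<le> t \<Longrightarrow> t < p \<Longrightarrow> (T w ^^ n) (\<Phi> w t) \<noteq> \<Phi> w t"
  have "p \<le> s" if "t \<in> {r..s}" "(T w ^^ n) (\<Phi> w t) = \<Phi> w t" for t
    using p(6)[of t] that by (cases "t < p") auto
  moreover have "(T w ^^ n) (\<Phi> w r) \<noteq> \<Phi> w r" using p(6)[of r] p(3) by simp
  moreover have "\<exists>t\<in>{r..s}. (T w ^^ n) (\<Phi> w t) = \<Phi> w t" if "p \<le> s"
    using that p by (intro bexI[of _ p]) auto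
  ultimately show ?thesis unfolding p(1) by (metis (no_types, lifting))
qed (use maps[OF T] in auto)

lemma coord_first_fixed: "coord (\<lambda>w. first_fixed (\<Phi> w) (T w) n r)"
  unfolding coord_def
proof
  show "\<forall>w\<in>space N. first_fixed (\<Phi> w) (T w) n r \<in> {0..1}" by (intro ballI first_fixed_in)
  show "(\<lambda>w. first_fixed (\<Phi> w) (T w) n r) \<in> borel_measurable N"
  proof (cases "r \<in> {0..1}")
    case False
    then have "(\<lambda>w. first_fixed (\<Phi> w) (T w) n r) = (\<lambda>_. 1)" by (auto simp: first_fixed_def)
    then show ?thesis by simp
  next
    case r: True
    show ?thesis
    proof (rule borel_measurable_iff_le[THEN iffD2], rule allI)
      fix s :: real
      consider "1 \<le> s" | "s < 0" | "s \<in> {0..1}" "s < 1" by fastforce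
      then show "{w \<in> space N. first_fixed (\<Phi> w) (T w) n r \<le> s} \<in> sets N"
      proof cases
        case 1
        have le: "first_fixed (\<Phi> w) (T w) n r \<le> s" for w
          using first_fixed_in[of "\<Phi> w" "T w" n r] 1 unfolding atLeastAtMost_iff by linarith
        have "{w \<in> space N. first_fixed (\<Phi> w) (T w) n r \<le> s} = space N"
          by (simp add: le)
        then show ?thesis by simp
      next
        case 2
        have gt: "s < first_fixed (\<Phi> w) (T w) n r" for w
          using first_fixed_in[of "\<Phi> w" "T w" n r] 2 unfolding atLeastAtMost_iff by linarith
        have "{w \<in> space N. first_fixed (\<Phi> w) (T w) n r \<le> s} = {}"
          using gt by (simp add: not_le)
        then show ?thesis by (simp only: sets.empty_sets)
      next
        case 3
        have [measurable]: "Measurable.pred N (\<lambda>w. (T w ^^ n) (\<Phi> w r) = \<Phi> w r)"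
          "Measurable.pred N (\<lambda>w. \<exists>t\<in>{r..s}. (T w ^^ n) (\<Phi> w t) = \<Phi> w t)"
          using pred_chart_eq[of "\<lambda>_. r" "\<lambda>_. r"] pred_fixed_between[of "\<lambda>_. r" "\<lambda>_. s"] r 3 by simp_all
        have "{w \<in> space N. first_fixed (\<Phi> w) (T w) n r \<le> s} = {w \<in> space N.
            (T w ^^ n) (\<Phi> w r) \<noteq> \<Phi> w r \<and> (\<exists>t\<in>{r..s}. (T w ^^ n) (\<Phi> w t) = \<Phi> w t)}"
          by (intro Collect_cong conj_cong refl first_fixed_le_iff r 3)
        also have "\<dots> \<in> sets N" by measurable
        finally show ?thesis .
      qed
    qed
  qed
qed

text \<open>The grid as a finite set of functions of the map, so that quantifiers over it become
  finite ones over measurable coordinates.\<close>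

definition grid_coords :: "(nat \<times> rat) list \<Rightarrow> ('b \<Rightarrow> real) set" where
  "grid_coords ps = {\<lambda>_. 0, \<lambda>_. 1} \<union> (\<lambda>(n, r) w. first_fixed (\<Phi> w) (T w) n (of_rat r)) ` set ps"

lemma finite_grid_coords: "finite (grid_coords ps)"
  by (simp add: grid_coords_def)

lemma coord_grid_coords: assumes "q \<in> grid_coords ps" shows "coord q"
proof -
  consider "q = (\<lambda>_. 0)" | "q = (\<lambda>_. 1)" | n r where "q = (\<lambda>w. first_fixed (\<Phi> w) (T w) n (of_rat r))"
    using assms unfolding grid_coords_def by (elim UnE insertE emptyE imageE) (auto split: prod.splits)
  then show ?thesis by cases (simp_all add: coord_first_fixed)
qed

lemma grid_eq_grid_coords: "grid (\<Phi> w) (T w) ps = (\<lambda>q. q w) ` grid_coords ps"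
  by (simp add: grid_coords_def grid_def image_Un image_image case_prod_beta)

lemma pred_large:
  assumes "coord x" "coord t"
  shows "Measurable.pred N (\<lambda>w. large (\<Phi> w) (T w) (grid (\<Phi> w) (T w) ps) n (x w) (t w))"
proof -
  have [measurable]: "Measurable.pred N (\<lambda>w. \<Phi> w 0 = \<Phi> w 1)"
    using pred_chart_eq[of "\<lambda>_. 0" "\<lambda>_. 1" 0] by simp
  have "Measurable.pred N (\<lambda>w. apart (\<Phi> w) (a w) (b w) (c w) (d w) \<and>
      hits (\<Phi> w) (T w) j (x w) (t w) (a w) (b w) \<and> hits (\<Phi> w) (T w) j (x w) (t w) (c w) (d w))"
    if "coord a" "coord b" "coord c" "coord d" for a b c d j
  proof -
    note [measurable] = that[THEN coordD(1)] pred_hits[OF assms that(1,2)] pred_hits[OF assms that(3,4)]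
    show ?thesis unfolding apart_def by measurable
  qed
  then have "Measurable.pred N (\<lambda>w. \<exists>j\<in>{..n}. \<exists>a\<in>grid_coords ps. \<exists>b\<in>grid_coords ps. \<exists>c\<in>grid_coords ps. \<exists>d\<in>grid_coords ps.
      apart (\<Phi> w) (a w) (b w) (c w) (d w) \<and>
      hits (\<Phi> w) (T w) j (x w) (t w) (a w) (b w) \<and> hits (\<Phi> w) (T w) j (x w) (t w) (c w) (d w))"
    by (intro pred_intros_finite(4)) (simp_all add: finite_grid_coords coord_grid_coords)
  then show ?thesis by (simp add: large_def grid_eq_grid_coords)
qed

text \<open>A strict inequality for the infimum leaves room for a rational, and \<open>large\<close>
  passes to it by monotonicity; so strict sublevel sets are countable unions.\<close>

lemma coord_next_mark:
  assumes x: "coord x" shows "coord (\<lambda>w. next_mark (\<Phi> w) (T w) (grid (\<Phi> w) (T w) ps) n (x w))"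
  unfolding coord_def
proof
  define L where "L w = large (\<Phi> w) (T w) (grid (\<Phi> w) (T w) ps) n" for w
  have nx: "next_mark (\<Phi> w) (T w) (grid (\<Phi> w) (T w) ps) n (x w) \<in> {x w..1}" if "w \<in> space N" for w
    by (rule next_mark_in) (rule coordD(2)[OF x that])
  show "\<forall>w\<in>space N. next_mark (\<Phi> w) (T w) (grid (\<Phi> w) (T w) ps) n (x w) \<in> {0..1}"
  proof
    fix w assume w: "w \<in> space N"
    show "next_mark (\<Phi> w) (T w) (grid (\<Phi> w) (T w) ps) n (x w) \<in> {0..1}"
      using nx[OF w] coordD(2)[OF x w] unfolding atLeastAtMost_iff by linarith
  qed
  note [measurable] = coordD(1)[OF x]
  show "(\<lambda>w. next_mark (\<Phi> w) (T w) (grid (\<Phi> w) (T w) ps) n (x w)) \<in> borel_measurable N"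
  proof (rule borel_measurable_iff_less[THEN iffD2], rule allI)
    fix s :: real
    show "{w \<in> space N. next_mark (\<Phi> w) (T w) (grid (\<Phi> w) (T w) ps) n (x w) < s} \<in> sets N"
    proof (cases "1 < s")
      case True
      have "next_mark (\<Phi> w) (T w) (grid (\<Phi> w) (T w) ps) n (x w) < s" if "w \<in> space N" for w
        using nx[OF that] True unfolding atLeastAtMost_iff by linarith
      then have "{w \<in> space N. next_mark (\<Phi> w) (T w) (grid (\<Phi> w) (T w) ps) n (x w) < s} = space N"
        by auto
      then show ?thesis by simp
    next
      case False
      have [measurable]: "Measurable.pred N (\<lambda>w. real_of_rat q \<in> {0..1} \<and> L w (x w) (of_rat q))" for q
        using pred_large[OF x coord_const, of "real_of_rat q" ps n] unfolding L_def
        by (cases "real_of_rat q \<in> {0..1}") simp_all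
      have iff: "next_mark (\<Phi> w) (T w) (grid (\<Phi> w) (T w) ps) n (x w) < s \<longleftrightarrow>
          (\<exists>q::rat. of_rat q < s \<and> x w \<le> of_rat q \<and> (real_of_rat q \<in> {0..1} \<and> L w (x w) (of_rat q)))"
        if T: "w \<in> space N" for w
      proof -
        let ?A = "insert 1 {t \<in> {x w..1}. L w (x w) t}"
        have xT: "0 \<le> x w" using coordD(2)[OF x T] by simp
        have bdd: "bdd_below ?A" using coordD(2)[OF x T] by (auto intro!: bdd_belowI[of _ "x w"])
        show ?thesis unfolding next_mark_def L_def[symmetric]
        proof
          assume "Inf ?A < s"
          then obtain t where t: "t \<in> ?A" "t < s" using cInf_lessD[of ?A s] by blast
          then have t': "x w \<le> t" "L w (x w) t" using False by auto
          obtain q where q: "t < of_rat q" "of_rat q < s" using of_rat_dense[OF t(2)] by blast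
          have "L w (x w) (of_rat q)"
            using large_mono[OF t'(2)[unfolded L_def] order_refl, of "of_rat q"] q unfolding L_def by simp
          moreover have "real_of_rat q \<in> {0..1}"
            unfolding atLeastAtMost_iff using xT t' q False by linarith
          ultimately show "\<exists>q::rat. of_rat q < s \<and> x w \<le> of_rat q \<and> (real_of_rat q \<in> {0..1} \<and> L w (x w) (of_rat q))"
            using q t' by (intro exI[of _ q]) (simp del: atLeastAtMost_iff)
        next
          assume "\<exists>q::rat. of_rat q < s \<and> x w \<le> of_rat q \<and> (real_of_rat q \<in> {0..1} \<and> L w (x w) (of_rat q))"
          then obtain q where q: "of_rat q < s" "x w \<le> of_rat q" "real_of_rat q \<in> {0..1}" "L w (x w) (of_rat q)" by blast
          have "real_of_rat q \<le> 1" using q(3) unfolding atLeastAtMost_iff by (rule conjunct2)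
          then have "of_rat q \<in> ?A" using q(2,4) by simp
          then have "Inf ?A \<le> of_rat q" using bdd by (rule cInf_lower)
          then show "Inf ?A < s" using q(1) by simp
        qed
      qed
      have "{w \<in> space N. next_mark (\<Phi> w) (T w) (grid (\<Phi> w) (T w) ps) n (x w) < s} = {w \<in> space N.
          \<exists>q::rat. of_rat q < s \<and> x w \<le> of_rat q \<and> (real_of_rat q \<in> {0..1} \<and> L w (x w) (of_rat q))}"
        using iff by (intro Collect_cong conj_cong refl)
      also have "\<dots> \<in> sets N" by measurable
      finally show ?thesis .
    qed
  qed
qed

lemma coord_mark: "coord (\<lambda>w. mark (\<Phi> w) (T w) (grid (\<Phi> w) (T w) ps) n k)"
proof (induction k)
  case (Suc k)
  have "mark (\<Phi> w) (T w) (grid (\<Phi> w) (T w) ps) n (Suc k) = next_mark (\<Phi> w) (T w) (grid (\<Phi> w) (T w) ps) n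
      (mark (\<Phi> w) (T w) (grid (\<Phi> w) (T w) ps) n k)" for w
    by (simp add: mark_def)
  then show ?case using coord_next_mark[OF Suc] by (simp only:)
qed (simp add: mark_def)

lemma pred_pattern: "Measurable.pred N (\<lambda>w. pattern (\<Phi> w) (T w) (grid (\<Phi> w) (T w) ps) m)"
proof -
  obtain e l where el: "prod_decode m = (e, l)" by fastforce
  obtain i j where ij: "prod_decode l = (i, j)" by fastforce
  define s where "s i w = (case prod_decode i of (n, k) \<Rightarrow> mark (\<Phi> w) (T w) (grid (\<Phi> w) (T w) ps) n k)" for i w
  have s: "coord (s i)" for i
    unfolding s_def[abs_def] by (cases "prod_decode i") (simp add: coord_mark)
  note [measurable] = coordD(1)[OF s]
  \<comment> \<open>That an image lies in an initial arc is \<open>hits\<close> for the first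
    iterate and the one-point interval at \<open>s i\<close>.\<close>
  have pat: "pattern (\<Phi> w) (T w) (grid (\<Phi> w) (T w) ps) m \<longleftrightarrow>
      (if e = 0 then s i w \<le> s j w else hits (\<Phi> w) (T w) 1 (s i w) (s i w) 0 (s j w))" for w
    unfolding pattern_def el ij prod.case Let_def s_def[symmetric] hits_def
    by (simp add: image_iff)
  have [measurable]: "Measurable.pred N (\<lambda>w. hits (\<Phi> w) (T w) 1 (s i w) (s i w) 0 (s j w))"
    by (rule pred_hits) (simp_all add: s)
  show ?thesis unfolding pat by measurable
qed

lemma pred_separating: "Measurable.pred N (\<lambda>w. separating (\<Phi> w) (T w) (grid (\<Phi> w) (T w) ps))"
proof -
  have [measurable]: "Measurable.pred N (\<lambda>w. real_of_rat p \<in> {0..1} \<longrightarrow> real_of_rat q \<in> {0..1} \<longrightarrow> p < q \<longrightarrow>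
      (\<exists>n. large (\<Phi> w) (T w) (grid (\<Phi> w) (T w) ps) n (of_rat p) (of_rat q)))" for p q
  proof (cases "real_of_rat p \<in> {0..1} \<and> real_of_rat q \<in> {0..1}")
    case True
    then have [measurable]: "Measurable.pred N (\<lambda>w. large (\<Phi> w) (T w) (grid (\<Phi> w) (T w) ps) n (of_rat p) (of_rat q))" for n
      by (intro pred_large coord_const) (simp_all only: simp_thms)
    show ?thesis by measurable
  next
    case False
    then consider "real_of_rat p \<notin> {0..1}" | "real_of_rat q \<notin> {0..1}" by argo
    then show ?thesis by cases (simp_all del: atLeastAtMost_iff)
  qed
  show ?thesis unfolding separating_iff_rat by measurable
qed

end

section \<open>The complete invariant\<close>

text \<open>With base 3 everything after position \<open>m\<close> sums to at most half of
  \<open>(1/3) ^ m\<close>, so the first difference decides the order and no two sequences share a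
  value.\<close>

definition ternary :: "(nat \<Rightarrow> bool) \<Rightarrow> real" where
  "ternary b = (\<Sum>m. if b m then (1/3) ^ m else 0)"

lemma summable_ternary: "summable (\<lambda>m. if b m then (1/3) ^ m else (0::real))"
  by (rule summable_comparison_test[OF _ summable_geometric[of "1/3::real"]]) auto

lemma ternary_nonneg: "0 \<le> ternary b"
  unfolding ternary_def by (rule suminf_nonneg[OF summable_ternary]) simp

lemma ternary_less:
  assumes eq: "\<And>i. i < m \<Longrightarrow> b i = c i" and m: "b m" "\<not> c m"
  shows "ternary c < ternary b"
proof -
  let ?f = "\<lambda>b i. if b i then (1/3) ^ i else (0::real)"
  have split: "ternary b = (\<Sum>n. ?f b (n + Suc m)) + sum (?f b) {..<Suc m}" for b
    unfolding ternary_def by (rule suminf_split_initial_segment[OF summable_ternary])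
  have tail: "summable (\<lambda>n. ?f b (n + Suc m))" for b
    using summable_ternary by (subst summable_iff_shift)
  have "(\<Sum>n. ?f c (n + Suc m)) \<le> (\<Sum>n. (1/3) ^ Suc m * (1/3) ^ n)"
    by (rule suminf_le[OF _ tail]) (auto simp: power_add intro!: summable_mult)
  also have "\<dots> = (1/3) ^ Suc m * (3/2)"
    by (subst suminf_mult) (auto simp: suminf_geometric)
  also have "\<dots> < (1/3) ^ m" by simp
  finally have "ternary c < (1/3) ^ m + sum (?f c) {..<Suc m}" unfolding split[of c] by simp
  moreover have "sum (?f c) {..<Suc m} = sum (?f c) {..<m}" using m by simp
  moreover have "sum (?f c) {..<m} = sum (?f b) {..<m}" using eq by (intro sum.cong) auto
  moreover have "sum (?f b) {..<Suc m} = sum (?f b) {..<m} + (1/3) ^ m" using m by simp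
  moreover have "0 \<le> (\<Sum>n. ?f b (n + Suc m))" by (rule suminf_nonneg[OF tail]) simp
  ultimately show ?thesis unfolding split[of b] by linarith
qed

lemma ternary_inj: assumes "ternary b = ternary c" shows "b = c"
proof (rule ccontr)
  assume "b \<noteq> c"
  then have ex: "\<exists>m. b m \<noteq> c m" by auto
  define m where "m = (LEAST m. b m \<noteq> c m)"
  have m: "b m \<noteq> c m" unfolding m_def using ex by (rule LeastI_ex)
  have eq: "b i = c i" if "i < m" for i using not_less_Least[of i "\<lambda>m. b m \<noteq> c m"] that by (simp add: m_def)
  show False
  proof (cases "b m")
    case True
    then show False using ternary_less[of m b c] eq m assms by simp
  next
    case False
    then show False using ternary_less[of m c b] eq m assms by simp
  qed
qed

text \<open>A countable supply of charts attached to each map, closed under conjugacy by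
  \<open>transfer\<close>. \<open>closed_chart\<close> tells loops from arcs and must be the same
  for all maps, since charts of two maps are compared.\<close>

locale chart_system =
  fixes Y :: "'a::{metric_space, second_countable_topology} set"
    and \<Phi> :: "'i::countable \<Rightarrow> ('a \<Rightarrow> 'a) \<Rightarrow> real \<Rightarrow> 'a"
    and valid :: "'i \<Rightarrow> ('a \<Rightarrow> 'a) \<Rightarrow> bool"
    and closed_chart :: bool
  assumes compact_Y: "compact Y"
    and chart: "\<And>T i. T \<in> chaotic_maps Y \<Longrightarrow> valid i T \<Longrightarrow> chart Y (\<Phi> i T)"
    and ends: "\<And>T i. T \<in> chaotic_maps Y \<Longrightarrow> valid i T \<Longrightarrow> \<Phi> i T 0 = \<Phi> i T 1 \<longleftrightarrow> closed_chart"
    and valid_exists: "\<And>T. T \<in> chaotic_maps Y \<Longrightarrow> \<exists>i. valid i T"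
    and transfer: "\<And>T S g i. T \<in> chaotic_maps Y \<Longrightarrow> S \<in> chaotic_maps Y \<Longrightarrow>
      homeomorphic_map (top_of_set Y) (top_of_set Y) g \<Longrightarrow> \<forall>y\<in>Y. g (T y) = S (g y) \<Longrightarrow> valid i T \<Longrightarrow>
      \<exists>i' h. valid i' S \<and> interval_auto h \<and> (\<forall>u\<in>{0..1}. g (\<Phi> i T u) = \<Phi> i' S (h u))"
    and measurable_valid: "\<And>i. {T \<in> chaotic_maps Y. valid i T} \<in> sets (chaotic_maps_borel Y)"
    and measurable_\<Phi>: "\<And>i x. x \<in> borel_measurable (restrict_space (chaotic_maps_borel Y) {T. valid i T}) \<Longrightarrow>
      (\<And>T. T \<in> chaotic_maps Y \<Longrightarrow> valid i T \<Longrightarrow> x T \<in> {0..1}) \<Longrightarrow>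
      (\<lambda>T. \<Phi> i T (x T)) \<in> borel_measurable (restrict_space (chaotic_maps_borel Y) {T. valid i T})"
begin

definition admissible :: "'i \<times> (nat \<times> rat) list \<Rightarrow> ('a \<Rightarrow> 'a) \<Rightarrow> bool" where
  "admissible p T \<longleftrightarrow> valid (fst p) T \<and> separating (\<Phi> (fst p) T) T (grid (\<Phi> (fst p) T) T (snd p))"

definition code :: "'i \<times> (nat \<times> rat) list \<Rightarrow> ('a \<Rightarrow> 'a) \<Rightarrow> nat \<Rightarrow> bool" where
  "code p T = pattern (\<Phi> (fst p) T) T (grid (\<Phi> (fst p) T) T (snd p))"

text \<open>The value \<open>0\<close> always occurs, so that inadmissible indices leave no trace in the range.\<close>

definition invariant :: "('a \<Rightarrow> 'a) \<Rightarrow> nat \<Rightarrow> real" where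
  "invariant T m = (case m of 0 \<Rightarrow> 0 | Suc k \<Rightarrow>
     if admissible (from_nat k) T then 1 + ternary (code (from_nat k) T) else 0)"

lemma admissible_exists:
  assumes "T \<in> chaotic_maps Y" shows "\<exists>p. admissible p T"
proof -
  obtain i where i: "valid i T" using valid_exists[OF assms] by blast
  obtain ps where "separating (\<Phi> i T) T (grid (\<Phi> i T) T ps)"
    by (rule separating_grid_exists[OF chart[OF assms i] assms])
  then have "admissible (i, ps) T" using i by (simp add: admissible_def)
  then show ?thesis by (rule exI)
qed

lemma range_invariant:
  "range (invariant T) = insert 0 {1 + ternary (code p T) |p. admissible p T}"
proof (intro equalityI subsetI)
  fix z assume "z \<in> range (invariant T)"
  then obtain m where m: "z = invariant T m" by blast
  then show "z \<in> insert 0 {1 + ternary (code p T) |p. admissible p T}"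
  proof (cases "\<exists>k. m = Suc k \<and> admissible (from_nat k) T")
    case True
    then obtain k where "m = Suc k" "admissible (from_nat k) T" by blast
    then show ?thesis unfolding m by (intro insertI2 CollectI exI[of _ "from_nat k"]) (simp add: invariant_def)
  next
    case False
    then have "invariant T m = 0" by (cases m) (simp_all add: invariant_def)
    then show ?thesis unfolding m by simp
  qed
next
  fix z assume "z \<in> insert 0 {1 + ternary (code p T) |p. admissible p T}"
  then consider "z = 0" | p where "z = 1 + ternary (code p T)" "admissible p T" by blast
  then show "z \<in> range (invariant T)"
  proof cases
    case 1
    then show ?thesis by (intro range_eqI[of _ _ 0]) (simp add: invariant_def)
  next
    case 2
    then show ?thesis by (intro range_eqI[of _ _ "Suc (to_nat p)"]) (simp add: invariant_def)
  qed
qed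

lemma conjugate_of_code_eq:
  assumes T: "T \<in> chaotic_maps Y" and S: "S \<in> chaotic_maps Y"
    and p: "admissible p T" and q: "admissible q S" and eq: "code p T = code q S"
  shows "conjugate (top_of_set Y) T (top_of_set Y) S"
proof (rule conjugate_of_pattern_eq)
  show "chart Y (\<Phi> (fst p) T)" "chart Y (\<Phi> (fst q) S)"
    using chart T S p q by (simp_all add: admissible_def)
  show "\<Phi> (fst p) T 0 = \<Phi> (fst p) T 1 \<longleftrightarrow> \<Phi> (fst q) S 0 = \<Phi> (fst q) S 1"
    using ends T S p q by (simp add: admissible_def)
  show "continuous_on Y T" "T \<in> Y \<rightarrow> Y" "continuous_on Y S" "S \<in> Y \<rightarrow> Y"
    using chaotic_mapsD[OF compact_Y] T S by simp_all
  show "separating (\<Phi> (fst p) T) T (grid (\<Phi> (fst p) T) T (snd p))"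
    "separating (\<Phi> (fst q) S) S (grid (\<Phi> (fst q) S) S (snd q))"
    using p q by (simp_all add: admissible_def)
  show "pattern (\<Phi> (fst p) T) T (grid (\<Phi> (fst p) T) T (snd p)) =
      pattern (\<Phi> (fst q) S) S (grid (\<Phi> (fst q) S) S (snd q))"
    using eq by (simp add: code_def)
qed (rule finite_grid grid_subset)+

text \<open>A conjugacy carries the chart and the grid of \<open>T\<close> to a chart and a grid of
  \<open>S\<close> with other indices but the same pattern.\<close>

lemma code_transfer:
  assumes T: "T \<in> chaotic_maps Y" and S: "S \<in> chaotic_maps Y"
    and g: "homeomorphic_map (top_of_set Y) (top_of_set Y) g" "\<forall>y\<in>Y. g (T y) = S (g y)"
    and p: "admissible p T"
  shows "\<exists>q. admissible q S \<and> code q S = code p T"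
proof -
  obtain i ps where ip: "p = (i, ps)" by (cases p)
  have i: "valid i T" and sep: "separating (\<Phi> i T) T (grid (\<Phi> i T) T ps)"
    using p by (simp_all add: admissible_def ip)
  obtain i' h where i': "valid i' S" and h: "interval_auto h" "\<forall>u\<in>{0..1}. g (\<Phi> i T u) = \<Phi> i' S (h u)"
    using transfer[OF T S g i] by (elim exE conjE)
  have "inj_on g Y" using homeomorphic_imp_injective_map[OF g(1)] by simp
  then interpret chart_conjugacy h Y "\<Phi> i T" "\<Phi> i' S" T S g
    using chart[OF T i] chart[OF S i'] chaotic_mapsD(2)[OF compact_Y T] g(2) h(2)
    by - (rule chart_conjugacy.intro[OF h(1)], rule chart_conjugacy_axioms.intro, simp_all)
  obtain ps' where ps': "grid (\<Phi> i' S) S ps' = h ` grid (\<Phi> i T) T ps"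
    by (rule grid_transfer[OF chaotic_mapsD(1)[OF compact_Y T]])
  have "admissible (i', ps') S"
    using i' separating_transfer[OF grid_subset sep] by (simp add: admissible_def ps')
  moreover have "code (i', ps') S = code p T"
    using pattern_transfer[OF grid_subset] by (simp add: code_def ps' ip)
  ultimately show ?thesis by blast
qed

lemma range_invariant_subset:
  assumes T: "T \<in> chaotic_maps Y" and S: "S \<in> chaotic_maps Y"
    and conj: "conjugate (top_of_set Y) T (top_of_set Y) S"
  shows "range (invariant T) \<subseteq> range (invariant S)"
proof -
  obtain g where g: "homeomorphic_map (top_of_set Y) (top_of_set Y) g" "\<forall>y\<in>Y. g (T y) = S (g y)"
    using conj by (auto simp: conjugate_def)
  show ?thesis
    unfolding range_invariant
  proof
    fix z assume "z \<in> insert 0 {1 + ternary (code p T) |p. admissible p T}"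
    then consider "z = 0" | p where "z = 1 + ternary (code p T)" "admissible p T" by blast
    then show "z \<in> insert 0 {1 + ternary (code p S) |p. admissible p S}"
    proof cases
      case 2
      then obtain q where "admissible q S" "code q S = code p T"
        using code_transfer[OF T S g 2(2)] by (elim exE conjE)
      then show ?thesis using 2 by (intro insertI2 CollectI exI[of _ q]) simp
    qed simp
  qed
qed

lemma conjugate_sym:
  assumes T: "T \<in> chaotic_maps Y" and conj: "conjugate (top_of_set Y) T (top_of_set Y) S"
  shows "conjugate (top_of_set Y) S (top_of_set Y) T"
proof -
  obtain g where g: "homeomorphic_map (top_of_set Y) (top_of_set Y) g" "\<forall>y\<in>Y. g (T y) = S (g y)"
    using conj by (auto simp: conjugate_def)
  obtain k where k: "homeomorphic_maps (top_of_set Y) (top_of_set Y) g k"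
    using g(1) unfolding homeomorphic_map_maps by (elim exE)
  then have "homeomorphic_maps (top_of_set Y) (top_of_set Y) k g" by (rule homeomorphic_maps_sym[THEN iffD1])
  then have k': "homeomorphic_map (top_of_set Y) (top_of_set Y) k" by (rule homeomorphic_maps_imp_map)
  have gk: "g (k y) = y" "k (g y) = y" "k y \<in> Y" if "y \<in> Y" for y
    using k that by (auto simp: homeomorphic_maps_def)
  have "k (S y) = T (k y)" if y: "y \<in> Y" for y
  proof -
    have "g (T (k y)) = S y" using g(2) gk(1,3)[OF y] by simp
    moreover have "k (g (T (k y))) = T (k y)"
      by (rule gk(2)) (use chaotic_mapsD(2)[OF compact_Y T] gk(3)[OF y] in blast)
    ultimately show ?thesis by simp
  qed
  then show ?thesis unfolding conjugate_def using k' by (intro exI[of _ k]) simp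
qed

text \<open>A single common code suffices for a conjugacy. The summand 1 keeps codes apart from the
  filler 0, and \<open>admissible_exists\<close> provides at least one code.\<close>

lemma invariant_complete:
  assumes T: "T \<in> chaotic_maps Y" and S: "S \<in> chaotic_maps Y"
  shows "conjugate (top_of_set Y) T (top_of_set Y) S \<longleftrightarrow> range (invariant T) = range (invariant S)"
proof
  assume "conjugate (top_of_set Y) T (top_of_set Y) S"
  then show "range (invariant T) = range (invariant S)"
    using range_invariant_subset T S conjugate_sym by (intro equalityI) simp_all
next
  assume eq: "range (invariant T) = range (invariant S)"
  obtain p where p: "admissible p T" using admissible_exists[OF T] by blast
  then have "1 + ternary (code p T) \<in> range (invariant T)"
    unfolding range_invariant by (intro insertI2 CollectI exI[of _ p]) simp
  then have "1 + ternary (code p T) \<in> range (invariant S)" by (simp only: eq)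
  moreover have "1 + ternary (code p T) \<noteq> 0" using ternary_nonneg[of "code p T"] by linarith
  ultimately have "1 + ternary (code p T) \<in> {1 + ternary (code q S) |q. admissible q S}"
    unfolding range_invariant by (elim insertE) simp_all
  then obtain q where q: "admissible q S" "1 + ternary (code p T) = 1 + ternary (code q S)"
    by (elim CollectE exE conjE)
  then have "code p T = code q S" by (intro ternary_inj) simp
  then show "conjugate (top_of_set Y) T (top_of_set Y) S"
    using conjugate_of_code_eq T S p q(1) by simp
qed

text \<open>Charts exist only where the index is valid, so measurability is proved on that
  measurable part and the function is continued by 0.\<close>

lemma measurable_code_or_zero:
  "(\<lambda>T. if admissible p T then 1 + ternary (code p T) else 0) \<in> borel_measurable (chaotic_maps_borel Y)"
proof -
  obtain i ps where ip: "p = (i, ps)" by (cases p)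
  define M where "M = chaotic_maps_borel Y"
  define N where "N = restrict_space M {T. valid i T}"
  have spN: "space N = {T \<in> chaotic_maps Y. valid i T}"
    by (auto simp: N_def M_def space_restrict_space)
  interpret chart_field N Y "\<lambda>T. T" "\<Phi> i"
  proof
    show "compact Y" by (rule compact_Y)
    show "continuous_on Y T \<and> T \<in> Y \<rightarrow> Y" if "T \<in> space N" for T
      using chaotic_mapsD[OF compact_Y] that by (simp add: spN)
    show "(\<lambda>T. T x) \<in> borel_measurable N" if "x \<in> Y" for x
      unfolding N_def M_def by (rule measurable_restrict_space1[OF measurable_eval_point[OF compact_Y that]])
    show "chart Y (\<Phi> i T)" if "T \<in> space N" for T
      using chart that by (simp add: spN)
    show "(\<lambda>T. \<Phi> i T (x T)) \<in> borel_measurable N"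
      if "x \<in> borel_measurable N" "\<And>T. T \<in> space N \<Longrightarrow> x T \<in> {0..1}" for x
      using measurable_\<Phi>[of x i] that unfolding N_def[symmetric] M_def[symmetric] spN by simp
  qed
  define R where "R T = (if separating (\<Phi> i T) T (grid (\<Phi> i T) T ps) then 1 + ternary (code p T) else 0)" for T
  have "(\<lambda>T. ternary (code p T)) \<in> borel_measurable N"
    unfolding ternary_def
  proof (rule borel_measurable_suminf)
    fix m
    have "Measurable.pred N (\<lambda>T. code p T m)" unfolding code_def ip fst_conv snd_conv by (rule pred_pattern)
    then show "(\<lambda>T. if code p T m then (1/3) ^ m else (0::real)) \<in> borel_measurable N"
      by (intro measurable_If) (simp_all add: pred_def)
  qed
  then have "R \<in> borel_measurable N"
    unfolding R_def[abs_def] using pred_separating[of ps]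
    by (intro measurable_If borel_measurable_add) (simp_all add: pred_def)
  moreover have "{T. valid i T} \<inter> space M = {T \<in> chaotic_maps Y. valid i T}" by (auto simp: M_def)
  then have "{T. valid i T} \<inter> space M \<in> sets M" using measurable_valid by (simp add: M_def)
  ultimately have "(\<lambda>T. indicator {T. valid i T} T *\<^sub>R R T) \<in> borel_measurable M"
    unfolding N_def by (simp add: borel_measurable_restrict_space_iff)
  moreover have "(\<lambda>T. indicator {T. valid i T} T *\<^sub>R R T) =
      (\<lambda>T. if admissible p T then 1 + ternary (code p T) else 0)"
    by (rule ext) (simp add: R_def admissible_def ip indicator_def)
  ultimately show ?thesis by (simp add: M_def)
qed

lemma measurable_invariant: "invariant \<in> chaotic_maps_borel Y \<rightarrow>\<^sub>M borel"
proof (rule measurable_coordinatewise_then_product)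
  fix m
  show "(\<lambda>T. invariant T m) \<in> borel_measurable (chaotic_maps_borel Y)"
    by (cases m) (simp_all add: invariant_def measurable_code_or_zero)
qed

theorem conjugacy_reducible:
  "borel_reducible (chaotic_maps_borel Y) (chaotic_conjugacy Y) (borel :: (nat \<Rightarrow> real) measure) eq_plus_rel"
  unfolding borel_reducible_def
proof (rule bexI[OF _ measurable_invariant], intro ballI)
  fix T S assume "T \<in> space (chaotic_maps_borel Y)" "S \<in> space (chaotic_maps_borel Y)"
  then have TS: "T \<in> chaotic_maps Y" "S \<in> chaotic_maps Y" by simp_all
  show "(T, S) \<in> chaotic_conjugacy Y \<longleftrightarrow> (invariant T, invariant S) \<in> eq_plus_rel"
    unfolding chaotic_conjugacy_def eq_plus_rel_def using TS invariant_complete[OF TS] by simp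
qed

end

section \<open>Charts of the interval and of the circle\<close>

text \<open>One chart for each orientation; a decreasing conjugacy exchanges the two.\<close>

definition interval_chart :: "bool \<Rightarrow> (real \<Rightarrow> real) \<Rightarrow> real \<Rightarrow> real" where
  "interval_chart i T t = (if i then t else 1 - t)"

lemma interval_transfer:
  assumes g: "homeomorphic_map (top_of_set {0..1::real}) (top_of_set {0..1}) g"
  shows "\<exists>i' h. interval_auto h \<and> (\<forall>u\<in>{0..1}. g (interval_chart i T u) = interval_chart i' S (h u))"
proof -
  have inj: "inj_on g {0..1}" and im: "g ` {0..1} = {0..1}" and cont: "continuous_on {0..1} g"
    using homeomorphic_imp_injective_map[OF g] homeomorphic_imp_surjective_map[OF g]
      homeomorphic_imp_continuous_map[OF g] by simp_all
  have flip: "(\<lambda>u. 1 - u) ` {0..1} = {0..1::real}"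
  proof (intro equalityI subsetI)
    fix z :: real assume "z \<in> {0..1}"
    then show "z \<in> (\<lambda>u. 1 - u) ` {0..1}" by (intro image_eqI[of _ _ "1 - z"]) auto
  qed auto
  have im2: "(\<lambda>u. g (1 - u)) ` {0..1} = {0..1}" "(\<lambda>u. 1 - g u) ` {0..1} = {0..1}"
    "(\<lambda>u. 1 - g (1 - u)) ` {0..1} = {0..1}"
  proof -
    show 1: "(\<lambda>u. g (1 - u)) ` {0..1} = {0..1}" using im flip by (metis image_image)
    show "(\<lambda>u. 1 - g u) ` {0..1} = {0..1}" using im flip by (metis image_image)
    show "(\<lambda>u. 1 - g (1 - u)) ` {0..1} = {0..1}" using 1 flip by (metis image_image)
  qed
  consider "strict_mono_on {0..1} g" | "strict_antimono_on {0..1} g"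
    using injective_eq_monotone_map[of "{0..1}" g] inj cont by auto
  then show ?thesis
  proof cases
    case 1
    note m = strict_mono_onD[OF 1]
    have "interval_auto g" using 1 im by (rule interval_auto.intro)
    moreover have "interval_auto (\<lambda>u. 1 - g (1 - u))"
      by (rule interval_auto.intro[OF _ im2(3)], rule strict_mono_onI) (use m in simp)
    ultimately show ?thesis
      by (cases i) (auto simp: interval_chart_def intro!: exI[of _ i])
  next
    case 2
    have m: "g y < g x" if "x \<in> {0..1}" "y \<in> {0..1}" "x < y" for x y
      using 2 that by (auto simp: monotone_on_def)
    have "interval_auto (\<lambda>u. 1 - g u)"
      by (rule interval_auto.intro[OF _ im2(2)], rule strict_mono_onI) (use m in simp)
    moreover have "interval_auto (\<lambda>u. g (1 - u))"
      by (rule interval_auto.intro[OF _ im2(1)], rule strict_mono_onI) (use m in simp)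
    ultimately show ?thesis
      by (cases i) (auto simp: interval_chart_def intro!: exI[of _ "\<not> i"])
  qed
qed

lemma chart_interval: "chart {0..1} (interval_chart i T)"
proof (cases i)
  case True
  then have "interval_chart i T = (\<lambda>t. t)" by (auto simp: interval_chart_def)
  then show ?thesis by (simp add: chart_def)
next
  case False
  then have eq: "interval_chart i T = (\<lambda>t. 1 - t)" by (auto simp: interval_chart_def)
  have "z \<in> (\<lambda>t. 1 - t) ` {0..1}" if "z \<in> {0..1}" for z :: real
    using that by (intro image_eqI[of _ _ "1 - z"]) auto
  then have "(\<lambda>t. 1 - t) ` {0..1} = {0..1::real}" by auto
  moreover have "continuous_on {0..1} (\<lambda>t::real. 1 - t)" by (intro continuous_intros)
  ultimately show ?thesis unfolding eq chart_def by auto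
qed

interpretation interval: chart_system "{0..1::real}" interval_chart "\<lambda>_ _. True" False
proof
  show "{T \<in> chaotic_maps {0..1::real}. True} \<in> sets (chaotic_maps_borel {0..1})"
    using sets.top[of "chaotic_maps_borel {0..1::real}"] by simp
  show "(\<lambda>T. interval_chart i T (x T)) \<in> borel_measurable (restrict_space (chaotic_maps_borel {0..1}) {T. True})"
    if "x \<in> borel_measurable (restrict_space (chaotic_maps_borel {0..1}) {T. True})" for i x
    using that by (cases i) (simp_all add: interval_chart_def)
  show "\<exists>i' h. True \<and> interval_auto h \<and> (\<forall>u\<in>{0..1}. g (interval_chart i T u) = interval_chart i' S (h u))"
    if "homeomorphic_map (top_of_set {0..1}) (top_of_set {0..1}) g" for T S g i
    using interval_transfer[OF that] by simp
qed (auto simp: chart_interval interval_chart_def)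

section \<open>The circle: orientations, base points and lifts\<close>

definition circle_point :: "bool \<Rightarrow> real \<Rightarrow> complex" where
  "circle_point e t = cis (2 * pi * (if e then t else - t))"

lemma circle_point_add: "circle_point e (s + t) = circle_point e s * circle_point e t"
  by (simp add: circle_point_def cis_mult algebra_simps)

lemma circle_point_0 [simp]: "circle_point e 0 = 1"
  by (simp add: circle_point_def)

lemma circle_point_1 [simp]: "circle_point e 1 = 1"
  by (auto simp: circle_point_def complex_eq_iff)

lemma norm_circle_point [simp]: "norm (circle_point e t) = 1"
  by (simp add: circle_point_def)

lemma circle_point_nonzero [simp]: "circle_point e t \<noteq> 0"
  by (metis norm_circle_point norm_zero zero_neq_one)

lemma circle_point_flip: "circle_point (\<not> e) t = circle_point e (1 - t)"
proof -
  have "circle_point e (1 - t) = circle_point e 1 * circle_point e (- t)"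
    using circle_point_add[of e 1 "- t"] by simp
  then show ?thesis by (simp add: circle_point_def)
qed

lemma circle_point_eq_1_iff:
  assumes "\<bar>t\<bar> \<le> 1" shows "circle_point e t = 1 \<longleftrightarrow> t = 0 \<or> \<bar>t\<bar> = 1"
proof
  assume "circle_point e t = 1"
  then have "cos (2 * pi * t) = 1" by (auto simp: circle_point_def complex_eq_iff split: if_splits)
  then obtain n :: int where "2 * pi * t = of_int n * 2 * pi" using cos_one_2pi_int by blast
  then have t: "t = of_int n" by simp
  then have "\<bar>n\<bar> \<le> 1" using assms by linarith
  then have "n = 0 \<or> n = 1 \<or> n = - 1" by linarith
  then show "t = 0 \<or> \<bar>t\<bar> = 1" using t by auto
next
  assume "t = 0 \<or> \<bar>t\<bar> = 1"
  then consider "t = 0" | "t = 1" | "t = - 1" by linarith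
  then show "circle_point e t = 1"
    by cases (auto simp: circle_point_def complex_eq_iff)
qed

lemma circle_point_surj:
  assumes "norm z = 1" obtains t where "0 \<le> t" "t < 1" "circle_point True t = z"
proof -
  define t where "t = Arg2pi z / (2 * pi)"
  have "z = cis (Arg2pi z)" using Arg2pi_eq[of z] assms by (simp add: cis_conv_exp)
  then have "circle_point True t = z" by (simp add: circle_point_def t_def)
  moreover have "0 \<le> t" "t < 1" using Arg2pi_ge_0[of z] Arg2pi_lt_2pi[of z] by (simp_all add: t_def field_simps)
  ultimately show ?thesis using that by blast
qed

text \<open>The coordinate is taken in \<open>(0, 1]\<close>, so that a nonnegative rational fits
  strictly below it when it serves as a base.\<close>

lemma circle_point_surj_pos:
  assumes "norm z = 1" obtains t where "0 < t" "t \<le> 1" "circle_point e t = z"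
proof -
  obtain t where t: "0 \<le> t" "t < 1" "circle_point True t = z" using assms by (rule circle_point_surj)
  show ?thesis
  proof (cases e)
    case True
    show ?thesis
    proof (cases "t = 0")
      case True
      then show ?thesis using t that[of 1] by simp
    next
      case False
      then show ?thesis using t that[of t] \<open>e\<close> by simp
    qed
  next
    case False
    then show ?thesis using t that[of "1 - t"] circle_point_flip[of True "1 - t"] by simp
  qed
qed

lemma chart_circle:
  assumes "norm c = 1" shows "chart (sphere 0 1) (\<lambda>t. c * circle_point e t)"
  unfolding chart_def
proof (intro conjI ballI impI)
  have c: "c \<noteq> 0" using assms by auto
  show "continuous_on {0..1} (\<lambda>t. c * circle_point e t)"
    unfolding circle_point_def cis_conv_exp by (cases e) (auto intro!: continuous_intros)
  show "(\<lambda>t. c * circle_point e t) ` {0..1} = sphere 0 1"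
  proof (intro equalityI subsetI)
    fix z assume "z \<in> (\<lambda>t. c * circle_point e t) ` {0..1}"
    then show "z \<in> sphere 0 1" using assms by (auto simp: norm_mult)
  next
    fix z :: complex assume "z \<in> sphere 0 1"
    then have "norm (z / c) = 1" using assms by (simp add: norm_divide)
    then obtain t where "0 < t" "t \<le> 1" "circle_point e t = z / c" by (rule circle_point_surj_pos)
    then show "z \<in> (\<lambda>t. c * circle_point e t) ` {0..1}" using c by (intro image_eqI[of _ _ t]) auto
  qed
  fix s t :: real assume st: "s \<in> {0..1}" "t \<in> {0..1}" "c * circle_point e s = c * circle_point e t"
  have "circle_point e s = circle_point e t * circle_point e (s - t)" by (simp flip: circle_point_add)
  then have "circle_point e (s - t) = 1" using st(3) c by simp
  then have "s - t = 0 \<or> \<bar>s - t\<bar> = 1" using st by (subst (asm) circle_point_eq_1_iff) auto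
  then show "s = t \<or> {s, t} = {0, 1}" using st by (auto simp: abs_if split: if_splits)
qed

text \<open>Up to a rotation \<open>g\<close> along the chart is a loop at 1. Its angle is
  continuous and injective inside \<open>(0, 1)\<close>, hence monotone, and the direction decides
  \<open>e\<close>.\<close>

lemma circle_lift:
  assumes g: "homeomorphic_map (top_of_set (sphere (0::complex) 1)) (top_of_set (sphere 0 1)) g"
    and \<phi>: "chart (sphere 0 1) \<phi>" and closed: "\<phi> 0 = \<phi> 1"
  shows "\<exists>e h. interval_auto h \<and> (\<forall>u\<in>{0..1}. g (\<phi> u) = g (\<phi> 0) * circle_point e (h u))"
proof -
  have inj: "inj_on g (sphere 0 1)" and im: "g ` sphere 0 1 = sphere 0 1" and cont: "continuous_on (sphere 0 1) g"
    using homeomorphic_imp_injective_map[OF g] homeomorphic_imp_surjective_map[OF g]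
      homeomorphic_imp_continuous_map[OF g] by simp_all
  define c where "c = g (\<phi> 0)"
  have gin: "norm (g (\<phi> u)) = 1" if "u \<in> {0..1}" for u
    using im chart_in[OF \<phi> that] by (metis dist_0_norm image_eqI mem_sphere)
  have c: "norm c = 1" "c \<noteq> 0" using gin[of 0] by (auto simp: c_def)
  define \<psi> where "\<psi> u = g (\<phi> u) / c" for u
  have \<psi>n: "norm (\<psi> u) = 1" if "u \<in> {0..1}" for u using gin[OF that] c by (simp add: \<psi>_def norm_divide)
  have \<psi>inj: "u = v \<or> {u, v} = {0, 1}" if "u \<in> {0..1}" "v \<in> {0..1}" "\<psi> u = \<psi> v" for u v
  proof -
    have "g (\<phi> u) = g (\<phi> v)" using that(3) c by (simp add: \<psi>_def)
    then have "\<phi> u = \<phi> v" using inj_onD[OF inj] chart_in[OF \<phi>] that by blast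
    then show ?thesis using chart_eqD[OF \<phi>] that by blast
  qed
  have \<psi>0: "\<psi> 0 = 1" "\<psi> 1 = 1" using c closed by (simp_all add: \<psi>_def c_def)
  define A where "A u = Arg2pi (\<psi> u) / (2 * pi)" for u
  have A01: "0 \<le> A u" "A u < 1" for u
    using Arg2pi_ge_0[of "\<psi> u"] Arg2pi_lt_2pi[of "\<psi> u"] by (simp_all add: A_def field_simps)
  have A: "circle_point True (A u) = \<psi> u" if "u \<in> {0..1}" for u
    using Arg2pi_eq[of "\<psi> u"] \<psi>n[OF that] by (simp add: circle_point_def A_def cis_conv_exp)
  have not1: "\<psi> u \<noteq> 1" if "u \<in> {0<..<1}" for u
    using \<psi>inj[of u 0] \<psi>0 that by (auto simp: doubleton_eq_iff)
  have Apos: "0 < A u" if "u \<in> {0<..<1}" for u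
  proof -
    have "A u \<noteq> 0" using A[of u] not1[OF that] that by auto
    then show ?thesis using A01(1)[of u] by simp
  qed
  have "continuous_on {0<..<1} A"
  proof -
    have nonpos: "\<psi> u \<notin> \<real>\<^sub>\<ge>\<^sub>0" if "u \<in> {0<..<1}" for u
    proof
      assume "\<psi> u \<in> \<real>\<^sub>\<ge>\<^sub>0"
      then obtain r where "\<psi> u = of_real r" "r \<ge> 0" by (auto elim: nonneg_Reals_cases)
      moreover from this have "r = 1" using \<psi>n[of u] that by auto
      ultimately show False using not1[OF that] by simp
    qed
    have "continuous_on {0..1} \<psi>"
      unfolding \<psi>_def
      by (intro continuous_on_divide continuous_on_const continuous_on_compose2[OF cont chart_continuous[OF \<phi>]])
        (use chart_in[OF \<phi>] c in auto)
    then have \<psi>c: "continuous_on {0<..<1} \<psi>" by (rule continuous_on_subset) auto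
    have "continuous_on (- \<real>\<^sub>\<ge>\<^sub>0) Arg2pi"
      by (intro continuous_at_imp_continuous_on ballI continuous_at_Arg2pi) simp
    then have "continuous_on {0<..<1} (\<lambda>u. Arg2pi (\<psi> u))"
      by (rule continuous_on_compose2[OF _ \<psi>c]) (use nonpos in auto)
    then show ?thesis unfolding A_def by (intro continuous_intros) auto
  qed
  moreover have "inj_on A {0<..<1}"
  proof (rule inj_onI)
    fix u v assume uv: "u \<in> {0<..<1}" "v \<in> {0<..<1}" "A u = A v"
    then have "\<psi> u = \<psi> v" using A[of u] A[of v] by simp
    then show "u = v" using \<psi>inj[of u v] uv by (auto simp: doubleton_eq_iff)
  qed
  ultimately have mono: "strict_mono_on {0<..<1} A \<or> strict_antimono_on {0<..<1} A"
    using injective_eq_monotone_map[of "{0<..<1}" A] by simp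
  have Asurj: "\<exists>u\<in>{0<..<1}. A u = t" if t: "t \<in> {0<..<1}" for t
  proof -
    have "norm (c * circle_point True t) = 1" using c by (simp add: norm_mult)
    then have "c * circle_point True t \<in> g ` sphere 0 1" unfolding im by simp
    then obtain y where "y \<in> sphere 0 1" "g y = c * circle_point True t" by auto
    then obtain u where u: "u \<in> {0..1}" "g (\<phi> u) = c * circle_point True t" using chartE[OF \<phi>] by metis
    then have \<psi>u: "\<psi> u = circle_point True t" using c by (simp add: \<psi>_def)
    then have "\<psi> u \<noteq> 1" using t by (subst \<psi>u, subst circle_point_eq_1_iff) auto
    then have "u \<noteq> 0" "u \<noteq> 1" using \<psi>0 by auto
    then have u': "u \<in> {0<..<1}" using u by auto
    have "circle_point True (A u) = circle_point True t * circle_point True (A u - t)" by (simp flip: circle_point_add)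
    then have "circle_point True (A u - t) = 1" using A[OF u(1)] \<psi>u by simp
    then have "A u - t = 0 \<or> \<bar>A u - t\<bar> = 1"
      using A01[of u] t by (subst (asm) circle_point_eq_1_iff) auto
    then have "A u = t" using A01[of u] Apos[OF u'] t by auto
    then show ?thesis using u' by blast
  qed
  from mono show ?thesis
  proof
    assume m: "strict_mono_on {0<..<1} A"
    \<comment> \<open>\<open>Arg2pi\<close> is 0 at both ends of the loop, so the value at 1 has to
      be set by hand.\<close>
    define h where "h u = (if u \<in> {0<..<1} then A u else u)" for u
    have "strict_mono_on {0..1} h"
    proof (rule strict_mono_onI)
      fix u v :: real assume uv: "u \<in> {0..1}" "v \<in> {0..1}" "u < v"
      then show "h u < h v"
        using strict_mono_onD[OF m, of u v] Apos[of v] A01[of u] A01[of v] by (auto simp: h_def)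
    qed
    moreover have "h ` {0..1} = {0..1}"
    proof (intro equalityI subsetI)
      fix z assume "z \<in> h ` {0..1}"
      then show "z \<in> {0..1}" using A01 by (auto simp: h_def less_imp_le)
    next
      fix z :: real assume z: "z \<in> {0..1}"
      show "z \<in> h ` {0..1}"
      proof (cases "z \<in> {0<..<1}")
        case True
        then obtain u where "u \<in> {0<..<1}" "A u = z" using Asurj by blast
        then show ?thesis by (intro image_eqI[of _ _ u]) (auto simp: h_def)
      next
        case False
        then show ?thesis using z by (intro image_eqI[of _ _ z]) (auto simp: h_def)
      qed
    qed
    ultimately have "interval_auto h" by (rule interval_auto.intro)
    moreover have "g (\<phi> u) = g (\<phi> 0) * circle_point True (h u)" if u: "u \<in> {0..1}" for u
    proof (cases "u \<in> {0<..<1}")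
      case True
      then show ?thesis using A[OF u] c by (simp add: h_def \<psi>_def c_def field_simps)
    next
      case False
      then have "u = 0 \<or> u = 1" using u by auto
      then show ?thesis using closed by (auto simp: h_def)
    qed
    ultimately show ?thesis by (intro exI[of _ True] exI[of _ h] conjI ballI)
  next
    assume "strict_antimono_on {0<..<1} A"
    then have m: "A v < A u" if "u \<in> {0<..<1}" "v \<in> {0<..<1}" "u < v" for u v
      using that by (auto simp: monotone_on_def)
    \<comment> \<open>The angle decreases, so it is measured in the opposite direction.\<close>
    define h where "h u = (if u \<in> {0<..<1} then 1 - A u else u)" for u
    have "strict_mono_on {0..1} h"
    proof (rule strict_mono_onI)
      fix u v :: real assume uv: "u \<in> {0..1}" "v \<in> {0..1}" "u < v"
      then show "h u < h v"
        using m[of u v] Apos[of u] A01[of u] A01[of v] by (auto simp: h_def)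
    qed
    moreover have "h ` {0..1} = {0..1}"
    proof (intro equalityI subsetI)
      fix z assume "z \<in> h ` {0..1}"
      then show "z \<in> {0..1}" using A01 by (auto simp: h_def less_imp_le)
    next
      fix z :: real assume z: "z \<in> {0..1}"
      show "z \<in> h ` {0..1}"
      proof (cases "z \<in> {0<..<1}")
        case True
        then obtain u where "u \<in> {0<..<1}" "A u = 1 - z" using Asurj[of "1 - z"] by auto
        then show ?thesis by (intro image_eqI[of _ _ u]) (auto simp: h_def)
      next
        case False
        then show ?thesis using z by (intro image_eqI[of _ _ z]) (auto simp: h_def)
      qed
    qed
    ultimately have "interval_auto h" by (rule interval_auto.intro)
    moreover have "g (\<phi> u) = g (\<phi> 0) * circle_point False (h u)" if u: "u \<in> {0..1}" for u
    proof (cases "u \<in> {0<..<1}")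
      case True
      then have "circle_point False (h u) = \<psi> u"
        using A[OF u] circle_point_flip[of True "1 - A u"] by (simp add: h_def)
      then show ?thesis using c by (simp add: \<psi>_def c_def)
    next
      case False
      then have "u = 0 \<or> u = 1" using u by auto
      then show ?thesis using closed by (auto simp: h_def)
    qed
    ultimately show ?thesis by (intro exI[of _ False] exI[of _ h] conjI ballI)
  qed
qed

lemma first_fixed_ge:
  assumes "r \<in> {0..1}" shows "r \<le> first_fixed \<phi> T n r"
proof (cases "(T ^^ n) (\<phi> r) = \<phi> r")
  case True
  then show ?thesis using assms by (simp add: first_fixed_def)
next
  case False
  then have "first_fixed \<phi> T n r = Inf (insert 1 {t \<in> {r..1}. (T ^^ n) (\<phi> t) = \<phi> t})"
    using assms by (simp add: first_fixed_def)
  moreover have "r \<le> Inf (insert 1 {t \<in> {r..1}. (T ^^ n) (\<phi> t) = \<phi> t})"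
    using assms by (intro cInf_greatest) auto
  ultimately show ?thesis by simp
qed

lemma not_fixed_before_first_fixed:
  assumes r: "r \<in> {0..1}" "(T ^^ n) (\<phi> r) \<noteq> \<phi> r" and t: "r \<le> t" "t < first_fixed \<phi> T n r"
  shows "(T ^^ n) (\<phi> t) \<noteq> \<phi> t"
proof
  assume fx: "(T ^^ n) (\<phi> t) = \<phi> t"
  let ?A = "insert 1 {t \<in> {r..1}. (T ^^ n) (\<phi> t) = \<phi> t}"
  have ff: "first_fixed \<phi> T n r = Inf ?A" using r by (simp add: first_fixed_def)
  have "t \<le> 1" using t(2) first_fixed_in[of \<phi> T n r] unfolding atLeastAtMost_iff by linarith
  moreover have "bdd_below ?A" using r by (auto intro!: bdd_belowI[of _ r])
  ultimately have "Inf ?A \<le> t" using fx t(1) by (intro cInf_lower) auto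
  then show False using t(2) ff by simp
qed

type_synonym circle_index = "bool \<times> nat \<times> rat"

definition circle_base :: "circle_index \<Rightarrow> (complex \<Rightarrow> complex) \<Rightarrow> real" where
  "circle_base = (\<lambda>(e, n, r) T. first_fixed (circle_point e) T n (of_rat r))"

definition circle_chart :: "circle_index \<Rightarrow> (complex \<Rightarrow> complex) \<Rightarrow> real \<Rightarrow> complex" where
  "circle_chart i T t = circle_point (fst i) (circle_base i T) * circle_point (fst i) t"

text \<open>The last clause rejects the default 1 of \<open>first_fixed\<close> unless that point is
  really fixed. The base is then fixed by the iterate and has an arc without such points just before
  it.\<close>

definition circle_valid :: "circle_index \<Rightarrow> (complex \<Rightarrow> complex) \<Rightarrow> bool" where
  "circle_valid = (\<lambda>(e, n, r) T. of_rat r \<in> {0..1::real} \<and>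
     (T ^^ n) (circle_point e (of_rat r)) \<noteq> circle_point e (of_rat r) \<and>
     (T ^^ n) (circle_point e (circle_base (e, n, r) T)) = circle_point e (circle_base (e, n, r) T))"

lemma chart_circle_point: "chart (sphere 0 1) (circle_point e)"
  using chart_circle[of 1 e] by simp

lemma circle_point_minus_1: "circle_point e (t - 1) = circle_point e t"
  using circle_point_add[of e "t - 1" 1] by simp

lemma continuous_circle_point: "continuous_on UNIV (circle_point e)"
  unfolding circle_point_def[abs_def] cis_conv_exp by (cases e) (auto intro!: continuous_intros)

lemma circle_valid_exists:
  assumes T: "T \<in> chaotic_maps (sphere (0::complex) 1)" shows "\<exists>i. circle_valid i T"
proof -
  let ?\<phi> = "circle_point True"
  note \<phi> = chart_circle_point[of True]
  note Tc = chaotic_mapsD[OF chart_compact[OF \<phi>] T]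
  have "(0::real) \<le> 0" "(0::real) < 1" "(1::real) \<le> 1" by simp_all
  then obtain n r t where nr: "0 < real_of_rat r" "real_of_rat r < t" "t < 1"
    "(T ^^ n) (?\<phi> (of_rat r)) \<noteq> ?\<phi> (of_rat r)" "(T ^^ n) (?\<phi> t) = ?\<phi> t"
    "0 < first_fixed ?\<phi> T n (of_rat r)" "first_fixed ?\<phi> T n (of_rat r) < 1"
    by (rule first_fixed_dense[OF \<phi> T])
  have "(T ^^ n) (?\<phi> (first_fixed ?\<phi> T n (of_rat r))) = ?\<phi> (first_fixed ?\<phi> T n (of_rat r))"
  proof (rule first_fixed_cases[OF \<phi> Tc, of n "of_rat r"])
    assume "first_fixed ?\<phi> T n (of_rat r) = 1"
    then show ?thesis using nr(7) by simp
  next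
    fix p assume "first_fixed ?\<phi> T n (of_rat r) = p" "(T ^^ n) (?\<phi> p) = ?\<phi> p"
    then show ?thesis by simp
  qed
  moreover have "real_of_rat r \<in> {0..1}" unfolding atLeastAtMost_iff using nr(1-3) by linarith
  ultimately have "circle_valid (True, n, r) T"
    using nr(4) unfolding circle_valid_def circle_base_def prod.case by blast
  then show ?thesis by (rule exI)
qed

text \<open>\<open>g\<close> maps the base to a fixed point of the same iterate with an arc free of
  fixed points on the corresponding side. A rational in that arc names the new base in the new
  orientation.\<close>

lemma circle_transfer:
  fixes T S :: "complex \<Rightarrow> complex"
  assumes T: "T \<in> chaotic_maps (sphere 0 1)"
    and g: "homeomorphic_map (top_of_set (sphere (0::complex) 1)) (top_of_set (sphere 0 1)) g"
    and gT: "\<forall>y\<in>sphere 0 1. g (T y) = S (g y)" and valid: "circle_valid i T"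
  shows "\<exists>i' h. circle_valid i' S \<and> interval_auto h \<and>
    (\<forall>u\<in>{0..1}. g (circle_chart i T u) = circle_chart i' S (h u))"
proof -
  obtain e n r where i: "i = (e, n, r)" by (cases i)
  define \<theta> where "\<theta> = first_fixed (circle_point e) T n (of_rat r)"
  define \<phi> where "\<phi> u = circle_point e \<theta> * circle_point e u" for u
  have chart_i: "circle_chart i T u = \<phi> u" for u
    by (simp add: circle_chart_def circle_base_def i \<phi>_def \<theta>_def)
  have v0: "real_of_rat r \<in> {0..1} \<and> (T ^^ n) (circle_point e (of_rat r)) \<noteq> circle_point e (of_rat r) \<and>
      (T ^^ n) (circle_point e \<theta>) = circle_point e \<theta>"
    using valid unfolding circle_valid_def circle_base_def i prod.case \<theta>_def .
  note v = conjunct1[OF v0] conjunct1[OF conjunct2[OF v0]] conjunct2[OF conjunct2[OF v0]]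
  \<comment> \<open>The length of the arc before the base that carries no fixed point; in the chart
    that starts at the base this arc has the coordinates from \<open>1 - \<eta>\<close> to
    1.\<close>
  define \<eta> where "\<eta> = \<theta> - of_rat r"
  have r\<theta>: "real_of_rat r \<le> \<theta>" unfolding \<theta>_def using v(1) by (rule first_fixed_ge)
  have "real_of_rat r \<noteq> \<theta>"
  proof
    assume "real_of_rat r = \<theta>"
    then show False using v(2,3) by simp
  qed
  moreover have "\<theta> \<in> {0..1}" unfolding \<theta>_def by (rule first_fixed_in)
  ultimately have \<eta>: "0 < \<eta>" "\<eta> \<le> 1"
    using v(1) r\<theta> unfolding \<eta>_def atLeastAtMost_iff by linarith+
  have \<phi>chart: "chart (sphere 0 1) \<phi>" unfolding \<phi>_def[abs_def] by (rule chart_circle) simp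
  have \<phi>01: "\<phi> 0 = circle_point e \<theta>" "\<phi> 0 = \<phi> 1" by (simp_all add: \<phi>_def)
  obtain e' h where h0: "interval_auto h \<and> (\<forall>u\<in>{0..1}. g (\<phi> u) = g (\<phi> 0) * circle_point e' (h u))"
    using circle_lift[OF g \<phi>chart \<phi>01(2)] by (elim exE)
  note h = conjunct1[OF h0] conjunct2[OF h0, THEN bspec]
  have "g (\<phi> 0) \<in> sphere 0 1"
    using homeomorphic_imp_surjective_map[OF g] chart_in[OF \<phi>chart, of 0] by auto
  then have "norm (g (\<phi> 0)) = 1" by simp
  then obtain \<theta>' where \<theta>': "0 < \<theta>'" "\<theta>' \<le> 1" "circle_point e' \<theta>' = g (\<phi> 0)" by (rule circle_point_surj_pos)
  define \<phi>' where "\<phi>' u = circle_point e' \<theta>' * circle_point e' u" for u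
  have \<phi>'chart: "chart (sphere 0 1) \<phi>'" unfolding \<phi>'_def[abs_def] by (rule chart_circle) simp
  have g\<phi>: "g (\<phi> u) = \<phi>' (h u)" if "u \<in> {0..1}" for u using h(2)[OF that] \<theta>'(3) by (simp add: \<phi>'_def)
  have "compact (sphere (0::complex) 1)" by simp
  note Tc = chaotic_mapsD[OF this T]
  have inj: "inj_on g (sphere 0 1)" using homeomorphic_imp_injective_map[OF g] by simp
  interpret chart_conjugacy h "sphere 0 1" \<phi> \<phi>' T S g
  proof (rule chart_conjugacy.intro[OF h(1)], rule chart_conjugacy_axioms.intro)
    show "g (T y) = S (g y)" if "y \<in> sphere 0 1" for y using gT that by blast
  qed (use \<phi>chart \<phi>'chart inj g\<phi> Tc(2) in simp_all)
  have fixed': "(S ^^ n) (circle_point e' \<theta>') = circle_point e' \<theta>'"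
  proof -
    have "(S ^^ n) (\<phi>' (h 0)) = \<phi>' (h 0)" by (subst eq_transfer) (simp_all add: \<phi>01(1) v(3))
    then show ?thesis by (simp add: \<phi>'_def)
  qed
  have nofix: "(S ^^ n) (\<phi>' s) \<noteq> \<phi>' s" if s: "h (1 - \<eta>) < s" "s < 1" for s
  proof -
    have "1 - \<eta> \<in> {0..1}" using \<eta> by simp
    then have "0 \<le> h (1 - \<eta>)" using in_range[of "1 - \<eta>"] by simp
    then have "s \<in> {0..1}" using s by simp
    then obtain t where t: "t \<in> {0..1}" "h t = s" by (rule surjE)
    have "1 - \<eta> < t" using less_iff[OF \<open>1 - \<eta> \<in> {0..1}\<close> t(1)] s t by simp
    moreover have "t < 1" using less_iff[OF t(1), of 1] s t by simp
    \<comment> \<open>One full turn back, \<open>\<theta> + t - 1\<close> names the same point and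
      lies between \<open>r\<close> and \<open>\<theta>\<close>.\<close>
    ultimately have "real_of_rat r \<le> \<theta> + t - 1" "\<theta> + t - 1 < first_fixed (circle_point e) T n (of_rat r)"
      unfolding \<eta>_def \<theta>_def by linarith+
    then have "(T ^^ n) (circle_point e (\<theta> + t - 1)) \<noteq> circle_point e (\<theta> + t - 1)"
      by (rule not_fixed_before_first_fixed[where r = "of_rat r" and T = T and n = n and \<phi> = "circle_point e", OF v(1,2)])
    moreover have "circle_point e (\<theta> + t - 1) = \<phi> t"
      unfolding circle_point_minus_1 by (simp add: \<phi>_def circle_point_add)
    ultimately have "(T ^^ n) (\<phi> t) \<noteq> \<phi> t" by simp
    then show ?thesis using eq_transfer[OF t(1) t(1), of n] t(2) by simp
  qed
  have "h (1 - \<eta>) < h 1" using \<eta> by (subst less_iff) simp_all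
  \<comment> \<open>The arc may extend past coordinate 0; \<open>max 0\<close> cuts it there, and
    \<open>\<theta>' > 0\<close> leaves room for a rational.\<close>
  then have lt: "max 0 (\<theta>' - 1 + h (1 - \<eta>)) < \<theta>'" using \<theta>'(1) by simp
  obtain r' where r': "max 0 (\<theta>' - 1 + h (1 - \<eta>)) < real_of_rat r'" "real_of_rat r' < \<theta>'"
    using of_rat_dense[OF lt] by (elim exE conjE)
  have r'0: "0 \<le> real_of_rat r'" "\<theta>' - 1 + h (1 - \<eta>) < real_of_rat r'" using r'(1) by linarith+
  have before: "(S ^^ n) (circle_point e' s) \<noteq> circle_point e' s" if "real_of_rat r' \<le> s" "s < \<theta>'" for s
  proof -
    have "h (1 - \<eta>) < s - \<theta>' + 1" "s - \<theta>' + 1 < 1" using that r'0(2) by linarith+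
    then have "(S ^^ n) (\<phi>' (s - \<theta>' + 1)) \<noteq> \<phi>' (s - \<theta>' + 1)" by (rule nofix)
    moreover have "\<phi>' (s - \<theta>' + 1) = circle_point e' s"
      unfolding \<phi>'_def circle_point_add[symmetric] using circle_point_minus_1[of e' "s + 1"] by (simp add: algebra_simps)
    ultimately show ?thesis by simp
  qed
  have base': "first_fixed (circle_point e') S n (of_rat r') = \<theta>'"
    by (rule first_fixedI[where T = S and n = n and \<phi> = "circle_point e'", OF r'0(1) r'(2) \<theta>'(2) fixed' before])
  have "real_of_rat r' \<in> {0..1}" unfolding atLeastAtMost_iff using r'0(1) r'(2) \<theta>'(2) by linarith
  moreover have "(S ^^ n) (circle_point e' (of_rat r')) \<noteq> circle_point e' (of_rat r')"
    using r'(2) by (intro before) simp_all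
  ultimately have "circle_valid (e', n, r') S"
    unfolding circle_valid_def circle_base_def prod.case base' using fixed' by (intro conjI)
  moreover have "circle_chart (e', n, r') S u = \<phi>' u" for u
    by (simp add: circle_chart_def circle_base_def base' \<phi>'_def)
  then have "\<forall>u\<in>{0..1}. g (circle_chart i T u) = circle_chart (e', n, r') S (h u)"
    using g\<phi> by (simp add: chart_i)
  ultimately show ?thesis using h(1) by (intro exI conjI)
qed

lemma circle_chart_field:
  "chart_field (chaotic_maps_borel (sphere 0 1)) (sphere 0 1) (\<lambda>T. T) (\<lambda>_. circle_point e)"
proof
  show c: "compact (sphere (0::complex) 1)" by simp
  show "continuous_on (sphere 0 1) T \<and> T \<in> sphere 0 1 \<rightarrow> sphere 0 1"
    if "T \<in> space (chaotic_maps_borel (sphere (0::complex) 1))" for T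
    using chaotic_mapsD[OF c, of T] that by simp
  show "(\<lambda>T. T x) \<in> borel_measurable (chaotic_maps_borel (sphere 0 1))" if "x \<in> sphere (0::complex) 1" for x
    by (rule measurable_eval_point[OF c that])
  show "chart (sphere 0 1) (circle_point e)" by (rule chart_circle_point)
  show "(\<lambda>T. circle_point e (x T)) \<in> borel_measurable (chaotic_maps_borel (sphere 0 1))"
    if "x \<in> borel_measurable (chaotic_maps_borel (sphere 0 1))" for x
    using that borel_measurable_continuous_onI[OF continuous_circle_point] by (rule measurable_compose)
qed

lemma measurable_circle_base:
  "circle_base i \<in> borel_measurable (chaotic_maps_borel (sphere 0 1))"
proof -
  obtain e n r where i: "i = (e, n, r)" by (cases i)
  interpret chart_field "chaotic_maps_borel (sphere 0 1)" "sphere 0 1" "\<lambda>T. T" "\<lambda>_. circle_point e"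
    by (rule circle_chart_field)
  show ?thesis using coordD(1)[OF coord_first_fixed[of n "of_rat r"]] by (simp add: circle_base_def i)
qed

lemma measurable_circle_valid:
  "{T \<in> chaotic_maps (sphere 0 1). circle_valid i T} \<in> sets (chaotic_maps_borel (sphere 0 1))"
proof -
  obtain e n r where i: "i = (e, n, r)" by (cases i)
  interpret chart_field "chaotic_maps_borel (sphere 0 1)" "sphere 0 1" "\<lambda>T. T" "\<lambda>_. circle_point e"
    by (rule circle_chart_field)
  show ?thesis
  proof (cases "real_of_rat r \<in> {0..1}")
    case False
    then have "{T \<in> chaotic_maps (sphere 0 1). circle_valid i T} = {}"
      unfolding circle_valid_def i prod.case by (simp only: simp_thms empty_def)
    then show ?thesis by (simp only: sets.empty_sets)
  next
    case True
    have "coord (circle_base i)" using coord_first_fixed[of n "of_rat r"] by (simp add: circle_base_def i)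
    then have "Measurable.pred (chaotic_maps_borel (sphere 0 1))
        (\<lambda>T. (T ^^ n) (circle_point e (of_rat r)) \<noteq> circle_point e (of_rat r) \<and>
          (T ^^ n) (circle_point e (circle_base i T)) = circle_point e (circle_base i T))"
      using True by (intro pred_intros_logic pred_chart_eq coord_const)
    then show ?thesis using True
      unfolding circle_valid_def i prod.case pred_def by (simp only: space_chaotic_maps_borel simp_thms)
  qed
qed

interpretation circle: chart_system "sphere (0::complex) 1" circle_chart circle_valid True
proof
  fix i T assume "T \<in> chaotic_maps (sphere (0::complex) 1)" "circle_valid i T"
  show "chart (sphere 0 1) (circle_chart i T)"
    unfolding circle_chart_def[abs_def] by (rule chart_circle) simp
  show "circle_chart i T 0 = circle_chart i T 1 \<longleftrightarrow> True" by (simp add: circle_chart_def)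
next
  fix i and x :: "(complex \<Rightarrow> complex) \<Rightarrow> real"
  let ?N = "restrict_space (chaotic_maps_borel (sphere 0 1)) {T. circle_valid i T}"
  assume x: "x \<in> borel_measurable ?N"
  note cp = borel_measurable_continuous_onI[OF continuous_circle_point]
  show "(\<lambda>T. circle_chart i T (x T)) \<in> borel_measurable ?N"
    unfolding circle_chart_def
    by (intro borel_measurable_times measurable_compose[OF _ cp] x
        measurable_restrict_space1[OF measurable_circle_base])
qed (use circle_transfer circle_valid_exists measurable_circle_valid in auto)

theorem mainTheorem2:
  shows "(borel_reducible (borel :: real measure) vitali_rel
            (chaotic_maps_borel {0..1::real}) (chaotic_conjugacy {0..1::real}) \<and>
          borel_reducible (chaotic_maps_borel {0..1::real}) (chaotic_conjugacy {0..1::real})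
            (borel :: (nat \<Rightarrow> real) measure) eq_plus_rel) \<and>
         (borel_reducible (borel :: real measure) vitali_rel
            (chaotic_maps_borel (sphere (0::complex) 1)) (chaotic_conjugacy (sphere (0::complex) 1)) \<and>
          borel_reducible (chaotic_maps_borel (sphere (0::complex) 1)) (chaotic_conjugacy (sphere (0::complex) 1))
            (borel :: (nat \<Rightarrow> real) measure) eq_plus_rel)"
  by (intro conjI interval.conjugacy_reducible circle.conjugacy_reducible
      line_compactification.vitali_reducible[OF line_compactification_interval]
      line_compactification.vitali_reducible[OF line_compactification_circle])

end
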